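(* Let $X$ be a stack presented by an orbifold groupoid $\mathcal{G}\rightrightarrows M$, and let $\pi:M\to M/\mathcal{G}$ be the quotient map to the diffeological orbit space. Every Riemannian metric on $X$ descends to a weak Riemannian metric on $M/\mathcal{G}$ that is definite with respect to $\pi$. Conversely, every weak Riemannian metric $g$ on $M/\mathcal{G}$ that is definite with respect to $\pi$ pulls back to a $0$-metric $\pi^*g$ on $\mathcal{G}$, which defines a Riemannian metric on $X$ that induces $g$.
   Context: Diffeology. A diffeological space is a set $X$ with, for each open subset $U$ of each $\mathbb{R}^n$ ($n\ge 0$), a set of maps $U\to X$ called plots, such that constant maps are plots, plots are closed under precomposition with $C^\infty$ maps between open subsets of Euclidean spaces, and a map that is locally a plot is a plot. A map is smooth if it sends plots to plots by composition. A manifold is a diffeological space whose plots are the $C^\infty$ maps. A quotient $X/R$ has as plots the maps that locally lift to plots of $X$. The functor $T_2$. $T_2X$ is the quotient of $\coprod_{p:U\to X \text{ plot},\,U\subseteq\mathbb{R}^n} U\times\mathbb{R}^n\times\mathbb{R}^n$ by the equivalence relation generated by $(p;r,v,w)\sim(q;f(r),D_rf(v),D_rf(w))$ whenever $q\circ f=p$ with $f$ a $C^\infty$ map, with the quotient diffeology; write $T_2p(r,v,w)$ for the class. A smooth $h:X\to Y$ induces $T_2h(T_2p(r,v,w))=T_2(h\circ p)(r,v,w)$. For a manifold, $T_2M=TM\times_M TM$. A weak Riemannian metric on $X$ is a smooth map $g:T_2X\to\mathbb{R}$ such that for each plot $p:U\to X$, $p^*g:=g\circ T_2p:T_2U\to\mathbb{R}$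 is a symmetric and positive (i.e. positive semi-definite) covariant $2$-tensor on $U$. A weak Riemannian metric $g$ on $M/\mathcal{G}$ is definite with respect to $\pi$ if $\pi^*g:=g\circ T_2\pi$ is a Riemannian metric on $M$. Lie groupoids. Manifolds are Hausdorff and second-countable. A Lie groupoid $\mathcal{G}\rightrightarrows M$ has base a manifold $M$ and arrow space $\mathcal{G}$ a not-necessarily Hausdorff nor second-countable manifold, smooth structure maps, source $s$ and target $t$ submersions, with Hausdorff source and target fibres. $M/\mathcal{G}$ is the set of orbits $t(s^{-1}(x))$ with the quotient diffeology. An orbifold groupoid is a Lie groupoid that is étale ($\dim\mathcal{G}=\dim M$) and proper (the anchor $(t,s):\mathcal{G}\to M\times M$ is a proper map; this requires $\mathcal{G}$ Hausdorff). For general $\mathcal{G}$, $\mathcal{F}$ is the singular foliation of $M$ by connected components of orbits, $N\mathcal{F}=TM/T\mathcal{F}$ with classes $[v]$, $N_2\mathcal{F}=N\mathcal{F}\times_MN\mathcal{F}$, and $\mathcal{G}$ acts on $N\mathcal{F}$ by $g\cdot[v]=[Tt(\xi)]$, where $\xi\in T_g\mathcal{G}$ satisfies $[Ts(\xi)]=[v]$, and diagonally on $N_2\mathcal{F}$. If $\mathcal{G}$ is étale, $\mathcal{F}$ is the foliation by points, so $N\mathcal{F}=TM$ and $N_2\mathcal{F}=T_2M$. Metrics on groupoids and stacks. For a surjective submersion $p:E\to B$, a Riemannian metric on $E$ is $p$-transverse if for any $e,e'$ in the same fibre, the composite of the isomorphisms $(\ker T_ep)^\perp\to T_{p(e)}B\to(\ker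 T_{e'}p)^\perp$ induced by $Tp$ is a linear isometry; it then has a push-forward metric $p_*$ on $B$, making each $(\ker T_ep)^\perp\to T_{p(e)}B$ an isometry. Let $\mathcal{G}^{(2)}=\{(g,h):s(g)=t(h)\}$, $\mathrm{pr}_1(g,h)=g$, with the $S_3$-action permuting the vertices of the commutative triangle $(g,h,gh)$ (generated by $(g,h)\mapsto(h^{-1},g^{-1})$ and $(g,h)\mapsto(gh,h^{-1})$). A $2$-metric on $\mathcal{G}$ is an $S_3$-invariant, $\mathrm{pr}_1$-transverse Riemannian metric $\eta^2$ on $\mathcal{G}^{(2)}$. For a Riemannian metric $\eta$ on $M$ let $\eta^N:N_2\mathcal{F}\to\mathbb{R}$, $\eta^N([v],[w])=\eta(v^\perp,w^\perp)$, where $v^\perp$ is the orthogonal projection of $v\in T_xM$ to $(T_x\mathcal{F})^\perp$; $\eta$ is a $0$-metric on $\mathcal{G}$ if $\eta^N$ is $\mathcal{G}$-invariant. A $2$-metric induces a $0$-metric $\eta=s_*(\mathrm{pr}_1)_*\eta^2$. Two $2$-metrics are equivalent if their induced $0$-metrics satisfy $\eta_1^N=\eta_2^N$. A Riemannian metric on the stack presented by $\mathcal{G}$ (the class of $\mathcal{G}$ up to Morita equivalence) is an equivalence class of $2$-metrics on $\mathcal{G}$. When $\mathcal{G}$ is étale, a $0$-metric $\eta$ defines the Riemannian metric on the stack represented by the $2$-metric $\eta^2=\mathrm{pr}_1^*s^*\eta$, whose induced $0$-metric is $\eta$. Induced metric. There is a unique map $\lambda:N_2\mathcal{F}\to T_2(M/\mathcal{G})$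 with $\lambda([v],[w])=T_2\pi(v,w)$ (so $\lambda=T_2\pi$ for étale $\mathcal{G}$). A $0$-metric $\eta$ induces (or descends to) the weak Riemannian metric $\overline{\eta}$ on $M/\mathcal{G}$ if $\overline{\eta}\circ\lambda=\eta^N$. A Riemannian metric $[\eta^2]$ on the stack induces (or descends to) $\overline{\eta}$ if the $0$-metric of any representative does. *)

theory Defs
  imports "HOL-Analysis.Analysis"
begin

section \<open>Smooth maps between open subsets of Euclidean spaces\<close>

text \<open>The dimension has to range over all natural numbers inside one statement, so the space
  of dimension \<open>n\<close> is the library's \<^const>\<open>Euclidean_space\<close>: the real sequences that vanish
  from index \<open>n\<close> on, with the product topology.\<close>

type_synonym rvec = "nat \<Rightarrow> real"

abbreviation Rn :: "nat \<Rightarrow> rvec set" where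
  "Rn n \<equiv> topspace (Euclidean_space n)"

definition partial_deriv :: "nat \<Rightarrow> (rvec \<Rightarrow> real) \<Rightarrow> rvec \<Rightarrow> real" where
  "partial_deriv i f x = deriv (\<lambda>t. f (x(i := t))) (x i)"

primrec C_k :: "nat \<Rightarrow> nat \<Rightarrow> rvec set \<Rightarrow> (rvec \<Rightarrow> real) \<Rightarrow> bool" where
  "C_k 0 n U f \<longleftrightarrow> continuous_map (subtopology (Euclidean_space n) U) euclideanreal f"
| "C_k (Suc k) n U f \<longleftrightarrow>
     continuous_map (subtopology (Euclidean_space n) U) euclideanreal f \<and>
     (\<forall>i<n. (\<forall>x\<in>U. (\<lambda>t. f (x(i := t))) differentiable at (x i)) \<and>
            C_k k n U (partial_deriv i f))"

definition smooth_fun :: "nat \<Rightarrow> rvec set \<Rightarrow> (rvec \<Rightarrow> real) \<Rightarrow> bool" where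
  "smooth_fun n U f \<longleftrightarrow> (\<forall>k. C_k k n U f)"

definition smooth_map :: "nat \<Rightarrow> rvec set \<Rightarrow> nat \<Rightarrow> rvec set \<Rightarrow> (rvec \<Rightarrow> rvec) \<Rightarrow> bool" where
  "smooth_map n U m V f \<longleftrightarrow>
     U \<subseteq> Rn n \<and> V \<subseteq> Rn m \<and> f \<in> U \<rightarrow> V \<and> (\<forall>j<m. smooth_fun n U (\<lambda>x. f x j))"

text \<open>\<open>jacobian n f r v\<close> is \<open>D\<^sub>r f(v)\<close> for \<open>f\<close> defined on an open subset of \<^term>\<open>Rn n\<close>.\<close>

definition jacobian :: "nat \<Rightarrow> (rvec \<Rightarrow> rvec) \<Rightarrow> rvec \<Rightarrow> rvec \<Rightarrow> rvec" where
  "jacobian n f r v = (\<lambda>j. \<Sum>i<n. v i * partial_deriv i (\<lambda>x. f x j) r)"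

lemma partial_deriv_cong:
  assumes U: "openin (Euclidean_space n) U" and eq: "\<And>x. x \<in> U \<Longrightarrow> f x = g x"
    and x: "x \<in> U" and i: "i < n"
  shows "\<forall>\<^sub>F t in nhds (x i). f (x(i := t)) = g (x(i := t))"
    and "partial_deriv i f x = partial_deriv i g x"
proof -
  have xR: "x \<in> Rn n" using U x openin_subset by blast
  have "continuous_map euclideanreal (powertop_real UNIV) (\<lambda>t. x(i := t))"
    by (auto simp: continuous_map_componentwise_UNIV fun_upd_apply)
  then have "continuous_map euclideanreal (Euclidean_space n) (\<lambda>t. x(i := t))"
    using xR i by (auto simp: Euclidean_space_def continuous_map_in_subtopology)
  then have "openin euclideanreal {t \<in> topspace euclideanreal. x(i := t) \<in> U}"
    using U by (rule openin_continuous_map_preimage)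
  then have "open {t. x(i := t) \<in> U}" by simp
  moreover have "x i \<in> {t. x(i := t) \<in> U}" using x by simp
  ultimately have "\<forall>\<^sub>F t in nhds (x i). x(i := t) \<in> U"
    by (metis (mono_tags, lifting) eventually_nhds mem_Collect_eq)
  then show ev: "\<forall>\<^sub>F t in nhds (x i). f (x(i := t)) = g (x(i := t))"
    by (rule eventually_mono) (use eq in auto)
  show "partial_deriv i f x = partial_deriv i g x"
    unfolding partial_deriv_def by (rule deriv_cong_ev[OF ev]) simp
qed

lemma C_k_cong:
  assumes U: "openin (Euclidean_space n) U"
  shows "C_k k n U f \<Longrightarrow> (\<And>x. x \<in> U \<Longrightarrow> f x = g x) \<Longrightarrow> C_k k n U g"
proof (induction k arbitrary: f g)
  case 0
  then show ?case by (auto elim: continuous_map_eq)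
next
  case (Suc k)
  have c: "continuous_map (subtopology (Euclidean_space n) U) euclideanreal g"
    using Suc.prems by (auto elim: continuous_map_eq)
  have d: "(\<lambda>t. g (x(i := t))) differentiable at (x i)" if "i < n" "x \<in> U" for i x
  proof -
    have "(\<lambda>t. f (x(i := t))) differentiable at (x i)"
      using Suc.prems(1) that by simp
    then obtain D where D: "((\<lambda>t. f (x(i := t))) has_derivative D) (at (x i))"
      unfolding differentiable_def by blast
    have ev: "\<forall>\<^sub>F t in nhds (x i). f (x(i := t)) = g (x(i := t))"
      by (rule partial_deriv_cong(1)[OF U Suc.prems(2) that(2) that(1)])
    have "((\<lambda>t. g (x(i := t))) has_derivative D) (at (x i))"
      by (rule has_derivative_transform_eventually[OF D])
         (use ev eventually_nhds_x_imp_x[OF ev] in \<open>auto simp: eventually_at_filter elim: eventually_mono\<close>)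
    then show ?thesis
      unfolding differentiable_def by blast
  qed
  have "C_k k n U (partial_deriv i g)" if "i < n" for i
    using Suc.IH[of "partial_deriv i f" "partial_deriv i g"] Suc.prems(1) that
      partial_deriv_cong(2)[OF U Suc.prems(2) _ that] by simp
  with c d show ?case by simp
qed

lemma smooth_map_cong:
  assumes "smooth_map n U m V f" "openin (Euclidean_space n) U" "\<And>x. x \<in> U \<Longrightarrow> f x = g x"
  shows "smooth_map n U m V g"
  unfolding smooth_map_def smooth_fun_def
proof (intro conjI allI impI)
  show "U \<subseteq> Rn n" "V \<subseteq> Rn m" "g \<in> U \<rightarrow> V"
    using assms by (auto simp: smooth_map_def Pi_iff)
  show "C_k k n U (\<lambda>x. g x j)" if "j < m" for j k
    by (rule C_k_cong[OF assms(2), where f = "\<lambda>x. f x j"])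
       (use assms that in \<open>auto simp: smooth_map_def smooth_fun_def\<close>)
qed

lemma smooth_map_subset:
  assumes "smooth_map n U m V f" "W \<subseteq> U" "f ` W \<subseteq> V'" "V' \<subseteq> V"
  shows "smooth_map n W m V' f"
proof -
  have "C_k k n U h \<Longrightarrow> C_k k n W h" for k h
  proof (induction k arbitrary: h)
    case 0
    then show ?case using assms(2) by (auto intro: continuous_map_from_subtopology_mono)
  next
    case (Suc k)
    then show ?case using assms(2) by (auto intro: continuous_map_from_subtopology_mono)
  qed
  then show ?thesis
    using assms by (auto simp: smooth_map_def smooth_fun_def)
qed

lemma smooth_map_continuous:
  assumes "smooth_map n U m V f"
  shows "continuous_map (subtopology (Euclidean_space n) U) (Euclidean_space m) f"
proof -
  have c: "continuous_map (subtopology (Euclidean_space n) U) euclideanreal (\<lambda>x. f x j)" if "j < m" for j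
    using assms that by (metis C_k.simps(1) smooth_fun_def smooth_map_def)
  have "continuous_map (subtopology (Euclidean_space n) U) (Euclidean_space m)
          (\<lambda>x i. if i < m then f x i else 0)"
    using c by (simp add: continuous_map_componentwise_Euclidean_space)
  then show ?thesis
  proof (rule continuous_map_eq)
    fix x assume "x \<in> topspace (subtopology (Euclidean_space n) U)"
    then have "f x \<in> Rn m" using assms by (auto simp: smooth_map_def)
    then show "(\<lambda>i. if i < m then f x i else 0) = f x"
      by (auto simp: topspace_Euclidean_space)
  qed
qed

section \<open>Diffeological spaces\<close>

text \<open>A plot \<open>p : U \<rightarrow> X\<close> with \<open>U \<subseteq> \<real>\<^sup>n\<close> is the triple \<open>(n, U, p)\<close>, where \<open>p\<close> is
  extensional, i.e. \<^const>\<open>undefined\<close> outside \<open>U\<close>.\<close>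

type_synonym 'a plot = "nat \<times> rvec set \<times> (rvec \<Rightarrow> 'a)"

record 'a diffeology =
  Pts :: "'a set"
  Plots :: "'a plot set"

definition diffeological_space :: "'a diffeology \<Rightarrow> bool" where
  "diffeological_space X \<longleftrightarrow>
     (\<forall>(n, U, p) \<in> Plots X. openin (Euclidean_space n) U \<and> p \<in> U \<rightarrow>\<^sub>E Pts X) \<and>
     (\<forall>n U. \<forall>x \<in> Pts X. openin (Euclidean_space n) U \<longrightarrow> (n, U, \<lambda>_\<in>U. x) \<in> Plots X) \<and>
     (\<forall>n U m V q f. openin (Euclidean_space n) U \<and> (m, V, q) \<in> Plots X \<and> smooth_map n U m V f
        \<longrightarrow> (n, U, restrict (q \<circ> f) U) \<in> Plots X) \<and>
     (\<forall>n U p. openin (Euclidean_space n) U \<and> p \<in> U \<rightarrow>\<^sub>E Pts X \<and>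
        (\<forall>r\<in>U. \<exists>V. openin (Euclidean_space n) V \<and> r \<in> V \<and> V \<subseteq> U \<and> (n, V, restrict p V) \<in> Plots X)
        \<longrightarrow> (n, U, p) \<in> Plots X)"

definition smooth_between :: "'a diffeology \<Rightarrow> 'b diffeology \<Rightarrow> ('a \<Rightarrow> 'b) \<Rightarrow> bool" where
  "smooth_between X Y h \<longleftrightarrow> h \<in> Pts X \<rightarrow> Pts Y \<and>
     (\<forall>(n, U, p) \<in> Plots X. (n, U, restrict (h \<circ> p) U) \<in> Plots Y)"

definition D_topology :: "'a diffeology \<Rightarrow> 'a topology" where
  "D_topology X = topology (\<lambda>S. S \<subseteq> Pts X \<and>
     (\<forall>(n, U, p) \<in> Plots X. openin (Euclidean_space n) {r\<in>U. p r \<in> S}))"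

lemma istopology_D_topology:
  "istopology (\<lambda>S. S \<subseteq> Pts X \<and>
     (\<forall>(n, U, p) \<in> Plots X. openin (Euclidean_space n) {r\<in>U. p r \<in> S}))"
proof -
  have 1: "openin (Euclidean_space n) {r\<in>U. p r \<in> S \<inter> T}"
    if "openin (Euclidean_space n) {r\<in>U. p r \<in> S}" "openin (Euclidean_space n) {r\<in>U. p r \<in> T}"
    for n U and p :: "rvec \<Rightarrow> 'a" and S T
  proof -
    have "{r\<in>U. p r \<in> S \<inter> T} = {r\<in>U. p r \<in> S} \<inter> {r\<in>U. p r \<in> T}" by auto
    with that show ?thesis by (simp add: openin_Int)
  qed
  have 2: "openin (Euclidean_space n) {r\<in>U. p r \<in> \<Union>\<K>}"
    if "\<forall>K\<in>\<K>. openin (Euclidean_space n) {r\<in>U. p r \<in> K}"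
    for n U and p :: "rvec \<Rightarrow> 'a" and \<K>
  proof -
    have "{r\<in>U. p r \<in> \<Union>\<K>} = (\<Union>K\<in>\<K>. {r\<in>U. p r \<in> K})" by auto
    with that show ?thesis by auto
  qed
  show ?thesis
    unfolding istopology_def
  proof (intro conjI allI impI)
    fix S T
    assume a: "S \<subseteq> Pts X \<and> (\<forall>(n, U, p) \<in> Plots X. openin (Euclidean_space n) {r\<in>U. p r \<in> S})"
      and b: "T \<subseteq> Pts X \<and> (\<forall>(n, U, p) \<in> Plots X. openin (Euclidean_space n) {r\<in>U. p r \<in> T})"
    show "S \<inter> T \<subseteq> Pts X" using a by auto
    show "\<forall>(n, U, p) \<in> Plots X. openin (Euclidean_space n) {r\<in>U. p r \<in> S \<inter> T}"
      using a b 1 by fast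
  next
    fix \<K>
    assume a: "\<forall>K\<in>\<K>. K \<subseteq> Pts X \<and>
      (\<forall>(n, U, p) \<in> Plots X. openin (Euclidean_space n) {r\<in>U. p r \<in> K})"
    show "\<Union>\<K> \<subseteq> Pts X" using a by auto
    show "\<forall>(n, U, p) \<in> Plots X. openin (Euclidean_space n) {r\<in>U. p r \<in> \<Union>\<K>}"
      using a 2 by fast
  qed
qed

lemma openin_D_topology:
  "openin (D_topology X) S \<longleftrightarrow> S \<subseteq> Pts X \<and>
     (\<forall>(n, U, p) \<in> Plots X. openin (Euclidean_space n) {r\<in>U. p r \<in> S})"
  unfolding D_topology_def by (subst topology_inverse'[OF istopology_D_topology]) simp

definition real_diffeology :: "real diffeology" where
  "real_diffeology = \<lparr>Pts = UNIV,
     Plots = {(n, U, p). openin (Euclidean_space n) U \<and> p \<in> extensional U \<and> smooth_fun n U p}\<rparr>"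

definition open_diffeology :: "nat \<Rightarrow> rvec set \<Rightarrow> rvec diffeology" where
  "open_diffeology n U = \<lparr>Pts = U,
     Plots = {(m, V, f). openin (Euclidean_space m) V \<and> f \<in> extensional V \<and> smooth_map m V n U f}\<rparr>"

definition prod_diffeology :: "'a diffeology \<Rightarrow> 'b diffeology \<Rightarrow> ('a \<times> 'b) diffeology" where
  "prod_diffeology X Y = \<lparr>Pts = Pts X \<times> Pts Y,
     Plots = {(n, U, p). p \<in> extensional U \<and> (n, U, restrict (fst \<circ> p) U) \<in> Plots X \<and>
                         (n, U, restrict (snd \<circ> p) U) \<in> Plots Y}\<rparr>"

definition sub_diffeology :: "'a diffeology \<Rightarrow> 'a set \<Rightarrow> 'a diffeology" where
  "sub_diffeology X S = \<lparr>Pts = Pts X \<inter> S,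
     Plots = {(n, U, p) \<in> Plots X. p \<in> U \<rightarrow> S}\<rparr>"

definition quotient_diffeology :: "'a diffeology \<Rightarrow> ('a \<times> 'a) set \<Rightarrow> 'a set diffeology" where
  "quotient_diffeology X R = \<lparr>Pts = Pts X // R,
     Plots = {(n, U, p). openin (Euclidean_space n) U \<and> p \<in> U \<rightarrow>\<^sub>E Pts X // R \<and>
       (\<forall>r\<in>U. \<exists>V q. openin (Euclidean_space n) V \<and> r \<in> V \<and> V \<subseteq> U \<and> (n, V, q) \<in> Plots X \<and>
          (\<forall>z\<in>V. p z = R `` {q z}))}\<rparr>"

lemma diffeological_space_quotient:
  assumes X: "diffeological_space X" and R: "equiv (Pts X) R"
  shows "diffeological_space (quotient_diffeology X R)"
  unfolding diffeological_space_def
proof (intro conjI allI ballI impI)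
  fix P assume "P \<in> Plots (quotient_diffeology X R)"
  then show "case P of (n, U, p) \<Rightarrow>
      openin (Euclidean_space n) U \<and> p \<in> U \<rightarrow>\<^sub>E Pts (quotient_diffeology X R)"
    by (auto simp: quotient_diffeology_def)
next
  fix n U c assume c: "c \<in> Pts (quotient_diffeology X R)" and U: "openin (Euclidean_space n) U"
  then obtain x where x: "x \<in> Pts X" "c = R `` {x}"
    by (auto simp: quotient_diffeology_def quotient_def)
  then have "(n, U, \<lambda>_\<in>U. x) \<in> Plots X"
    using X U by (simp add: diffeological_space_def)
  then have "\<exists>V q. openin (Euclidean_space n) V \<and> r \<in> V \<and> V \<subseteq> U \<and> (n, V, q) \<in> Plots X \<and>
      (\<forall>z\<in>V. (\<lambda>_\<in>U. c) z = R `` {q z})" if "r \<in> U" for r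
    using that U x by (intro exI[of _ U] exI[of _ "\<lambda>_\<in>U. x"]) auto
  then show "(n, U, \<lambda>_\<in>U. c) \<in> Plots (quotient_diffeology X R)"
    using U c by (auto simp: quotient_diffeology_def)
next
  fix n U m V q f
  assume "openin (Euclidean_space n) U \<and> (m, V, q) \<in> Plots (quotient_diffeology X R) \<and>
    smooth_map n U m V f"
  then have U: "openin (Euclidean_space n) U" and q: "(m, V, q) \<in> Plots (quotient_diffeology X R)"
    and f: "smooth_map n U m V f" by auto
  have qloc: "\<forall>y\<in>V. \<exists>V' h. openin (Euclidean_space m) V' \<and> y \<in> V' \<and> V' \<subseteq> V \<and>
      (m, V', h) \<in> Plots X \<and> (\<forall>z\<in>V'. q z = R `` {h z})"
    using q by (simp add: quotient_diffeology_def)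
  have fV: "f \<in> U \<rightarrow> V" using f by (simp add: smooth_map_def)
  have UE: "U \<subseteq> Rn n" using U openin_subset by blast
  have "\<exists>W h. openin (Euclidean_space n) W \<and> r \<in> W \<and> W \<subseteq> U \<and> (n, W, h) \<in> Plots X \<and>
      (\<forall>z\<in>W. restrict (q \<circ> f) U z = R `` {h z})" if r: "r \<in> U" for r
  proof -
    obtain V' h where V': "openin (Euclidean_space m) V'" "f r \<in> V'" "V' \<subseteq> V" "(m, V', h) \<in> Plots X"
      "\<forall>z\<in>V'. q z = R `` {h z}"
      using bspec[OF qloc funcset_mem[OF fV r]] by blast
    define W where "W = {z\<in>U. f z \<in> V'}"
    have "openin (subtopology (Euclidean_space n) U)
            {z \<in> topspace (subtopology (Euclidean_space n) U). f z \<in> V'}"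
      using smooth_map_continuous[OF f] V'(1) by (rule openin_continuous_map_preimage)
    moreover have "topspace (subtopology (Euclidean_space n) U) = U"
      using UE by auto
    ultimately have W: "openin (Euclidean_space n) W"
      using U unfolding W_def by (metis openin_open_subtopology)
    have "smooth_map n W m V' f"
      by (rule smooth_map_subset[OF f _ _ V'(3)]) (auto simp: W_def)
    then have "(n, W, restrict (h \<circ> f) W) \<in> Plots X"
      using X W V'(4) by (auto simp: diffeological_space_def)
    then show ?thesis
      using W V' r by (intro exI[of _ W] exI[of _ "restrict (h \<circ> f) W"]) (auto simp: W_def)
  qed
  moreover have "restrict (q \<circ> f) U \<in> U \<rightarrow>\<^sub>E Pts X // R"
    using q fV by (auto simp: quotient_diffeology_def PiE_iff Pi_iff)
  ultimately show "(n, U, restrict (q \<circ> f) U) \<in> Plots (quotient_diffeology X R)"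
    using U by (simp add: quotient_diffeology_def)
next
  fix n U p
  assume "openin (Euclidean_space n) U \<and> p \<in> U \<rightarrow>\<^sub>E Pts (quotient_diffeology X R) \<and>
    (\<forall>r\<in>U. \<exists>V. openin (Euclidean_space n) V \<and> r \<in> V \<and> V \<subseteq> U \<and>
       (n, V, restrict p V) \<in> Plots (quotient_diffeology X R))"
  then have U: "openin (Euclidean_space n) U" and p: "p \<in> U \<rightarrow>\<^sub>E Pts X // R"
    and loc: "\<And>r. r \<in> U \<Longrightarrow> \<exists>V. openin (Euclidean_space n) V \<and> r \<in> V \<and> V \<subseteq> U \<and>
       (n, V, restrict p V) \<in> Plots (quotient_diffeology X R)"
    by (auto simp: quotient_diffeology_def)
  have "\<exists>W q. openin (Euclidean_space n) W \<and> r \<in> W \<and> W \<subseteq> U \<and> (n, W, q) \<in> Plots X \<and>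
      (\<forall>z\<in>W. p z = R `` {q z})" if r: "r \<in> U" for r
  proof -
    obtain V where V: "r \<in> V" "V \<subseteq> U" "(n, V, restrict p V) \<in> Plots (quotient_diffeology X R)"
      using loc[OF r] by blast
    have ploc: "\<forall>y\<in>V. \<exists>W q. openin (Euclidean_space n) W \<and> y \<in> W \<and> W \<subseteq> V \<and> (n, W, q) \<in> Plots X \<and>
        (\<forall>z\<in>W. restrict p V z = R `` {q z})"
      using V(3) by (simp add: quotient_diffeology_def)
    obtain W q where W: "openin (Euclidean_space n) W" "r \<in> W" "W \<subseteq> V" "(n, W, q) \<in> Plots X"
      "\<forall>z\<in>W. restrict p V z = R `` {q z}"
      using bspec[OF ploc V(1)] by (elim exE conjE) (rule that)
    have "p z = R `` {q z}" if "z \<in> W" for z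
      using subsetD[OF W(3) that] bspec[OF W(5) that] by simp
    then show ?thesis
      using V(2) W by (intro exI[of _ W] exI[of _ q]) auto
  qed
  then show "(n, U, p) \<in> Plots (quotient_diffeology X R)"
    using U p by (simp add: quotient_diffeology_def)
qed

section \<open>Manifolds\<close>

text \<open>A chart is a pair \<open>(V, \<phi>)\<close> of an open set of \<open>T\<close> and a homeomorphism from \<open>V\<close> onto an
  open subset of \<^term>\<open>Rn n\<close>. No separation or countability axiom is imposed here.\<close>

definition smooth_atlas :: "nat \<Rightarrow> 'a topology \<Rightarrow> ('a set \<times> ('a \<Rightarrow> rvec)) set \<Rightarrow> bool" where
  "smooth_atlas n T A \<longleftrightarrow>
     (\<forall>(V, \<phi>) \<in> A. openin T V \<and> openin (Euclidean_space n) (\<phi> ` V) \<and>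
        homeomorphic_map (subtopology T V) (subtopology (Euclidean_space n) (\<phi> ` V)) \<phi>) \<and>
     (\<Union>(V, \<phi>) \<in> A. V) = topspace T \<and>
     (\<forall>(V, \<phi>) \<in> A. \<forall>(W, \<psi>) \<in> A. smooth_map n (\<phi> ` (V \<inter> W)) n (\<psi> ` W) (\<psi> \<circ> inv_into V \<phi>))"

definition atlas_diffeology ::
    "nat \<Rightarrow> 'a topology \<Rightarrow> ('a set \<times> ('a \<Rightarrow> rvec)) set \<Rightarrow> 'a diffeology" where
  "atlas_diffeology n T A = \<lparr>Pts = topspace T,
     Plots = {(k, U, p). openin (Euclidean_space k) U \<and> p \<in> U \<rightarrow>\<^sub>E topspace T \<and>
       continuous_map (subtopology (Euclidean_space k) U) T p \<and>
       (\<forall>(V, \<phi>) \<in> A. smooth_map k {r\<in>U. p r \<in> V} n (\<phi> ` V) (\<phi> \<circ> p))}\<rparr>"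

definition manifold :: "nat \<Rightarrow> 'a diffeology \<Rightarrow> bool" where
  "manifold n X \<longleftrightarrow> diffeological_space X \<and> (\<exists>T A. smooth_atlas n T A \<and> X = atlas_diffeology n T A)"

text \<open>The topology of the manifold is recovered from the diffeology as the D-topology
  (lemma \<open>D_topology_atlas_diffeology\<close>), so the topological conditions on manifolds are
  stated for it.\<close>

lemma D_topology_atlas_diffeology:
  assumes A: "smooth_atlas n T A"
  shows "D_topology (atlas_diffeology n T A) = T"
proof -
  have "openin (D_topology (atlas_diffeology n T A)) S \<longleftrightarrow> openin T S" for S
  proof
    assume S: "openin T S"
    have "openin (Euclidean_space k) {r\<in>U. p r \<in> S}"
      if "openin (Euclidean_space k) U" "continuous_map (subtopology (Euclidean_space k) U) T p"
      for k U p
    proof -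
      have "openin (subtopology (Euclidean_space k) U)
              {r \<in> topspace (subtopology (Euclidean_space k) U). p r \<in> S}"
        using that(2) S by (rule openin_continuous_map_preimage)
      moreover have "topspace (subtopology (Euclidean_space k) U) = U"
        using openin_subset[OF that(1)] by auto
      ultimately show ?thesis
        using that(1) by (metis openin_open_subtopology)
    qed
    then show "openin (D_topology (atlas_diffeology n T A)) S"
      using openin_subset[OF S] by (auto simp: openin_D_topology atlas_diffeology_def)
  next
    assume S: "openin (D_topology (atlas_diffeology n T A)) S"
    have loc: "openin T (S \<inter> V)" if VA: "(V, \<phi>) \<in> A" for V \<phi>
    proof -
      have V: "openin T V" "openin (Euclidean_space n) (\<phi> ` V)"
        and hom: "homeomorphic_map (subtopology T V) (subtopology (Euclidean_space n) (\<phi> ` V)) \<phi>"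
        using A VA by (auto simp: smooth_atlas_def)
      have VT: "V \<subseteq> topspace T" and VE: "\<phi> ` V \<subseteq> Rn n"
        using V openin_subset by blast+
      have tV: "topspace (subtopology T V) = V"
        using VT by auto
      have inj: "inj_on \<phi> V"
        using homeomorphic_imp_injective_map[OF hom] tV by simp
      obtain \<psi> where \<psi>: "homeomorphic_maps (subtopology T V) (subtopology (Euclidean_space n) (\<phi> ` V)) \<phi> \<psi>"
        using hom homeomorphic_map_maps by blast
      have inv: "inv_into V \<phi> y = \<psi> y" if "y \<in> \<phi> ` V" for y
        using that \<psi> inj tV by (auto simp: homeomorphic_maps_def)
      define p where "p = restrict (inv_into V \<phi>) (\<phi> ` V)"
      have p: "p \<in> \<phi> ` V \<rightarrow>\<^sub>E V"
        by (auto simp: p_def inv_into_into)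
      have p\<phi>: "p (\<phi> x) = x" if "x \<in> V" for x
        using that inj by (simp add: p_def)
      have pre: "{r \<in> \<phi> ` V. p r \<in> S'} = \<phi> ` (V \<inter> S')" for S'
      proof -
        have "{r \<in> \<phi> ` V. p r \<in> S'} = \<phi> ` {x \<in> V. p (\<phi> x) \<in> S'}" by blast
        also have "{x \<in> V. p (\<phi> x) \<in> S'} = V \<inter> S'" using p\<phi> by auto
        finally show ?thesis .
      qed
      have "continuous_map (subtopology (Euclidean_space n) (\<phi> ` V)) (subtopology T V) p"
      proof (rule continuous_map_eq)
        show "continuous_map (subtopology (Euclidean_space n) (\<phi> ` V)) (subtopology T V) \<psi>"
          using \<psi> by (simp add: homeomorphic_maps_def)
        show "\<psi> y = p y" if "y \<in> topspace (subtopology (Euclidean_space n) (\<phi> ` V))" for y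
          using that inv by (simp add: p_def)
      qed
      then have cont: "continuous_map (subtopology (Euclidean_space n) (\<phi> ` V)) T p"
        by (simp add: continuous_map_in_subtopology)
      have "smooth_map n {r \<in> \<phi> ` V. p r \<in> W} n (\<omega> ` W) (\<omega> \<circ> p)" if W: "(W, \<omega>) \<in> A" for W \<omega>
      proof -
        have eq: "{r \<in> \<phi> ` V. p r \<in> W} = \<phi> ` (V \<inter> W)"
          by (rule pre)
        have "smooth_map n (\<phi> ` (V \<inter> W)) n (\<omega> ` W) (\<omega> \<circ> inv_into V \<phi>)"
          using A VA W by (fastforce simp: smooth_atlas_def)
        moreover have "openin (Euclidean_space n) (\<phi> ` (V \<inter> W))"
        proof -
          have "openin (subtopology T V) (V \<inter> W)"
            using A W V(1) by (auto simp: smooth_atlas_def openin_subtopology_Int2)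
          then have "openin (subtopology (Euclidean_space n) (\<phi> ` V)) (\<phi> ` (V \<inter> W))"
            using hom homeomorphic_map_openness_eq by blast
          then show ?thesis
            using V(2) by (simp add: openin_open_subtopology)
        qed
        ultimately show ?thesis
          unfolding eq by (rule smooth_map_cong) (auto simp: p_def)
      qed
      then have "(n, \<phi> ` V, p) \<in> Plots (atlas_diffeology n T A)"
        using V p cont VT by (auto simp: atlas_diffeology_def PiE_iff)
      then have "openin (Euclidean_space n) {r \<in> \<phi> ` V. p r \<in> S}"
        using S by (fastforce simp: openin_D_topology)
      moreover have "{r \<in> \<phi> ` V. p r \<in> S} = \<phi> ` (S \<inter> V)"
        unfolding pre by (simp add: Int_commute)
      ultimately have "openin (subtopology (Euclidean_space n) (\<phi> ` V)) (\<phi> ` (S \<inter> V))"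
        using V(2) by (auto simp: openin_open_subtopology)
      then have "openin (subtopology T V) (S \<inter> V)"
        using homeomorphic_map_openness[OF hom, of "S \<inter> V"] tV VT by auto
      then show ?thesis
        using V(1) by (metis openin_open_subtopology)
    qed
    have "S \<subseteq> topspace T"
      using S by (auto simp: openin_D_topology atlas_diffeology_def)
    moreover have "(\<Union>(V, \<phi>) \<in> A. V) = topspace T"
      using A by (simp add: smooth_atlas_def)
    ultimately have "S = (\<Union>(V, \<phi>) \<in> A. S \<inter> V)"
      by blast
    moreover have "openin T (\<Union>(V, \<phi>) \<in> A. S \<inter> V)"
      using loc by (intro openin_Union) auto
    ultimately show "openin T S"
      by simp
  qed
  then show ?thesis
    by (simp add: topology_eq)
qed

definition hausdorff_sc_manifold :: "nat \<Rightarrow> 'a diffeology \<Rightarrow> bool" where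
  "hausdorff_sc_manifold n X \<longleftrightarrow>
     manifold n X \<and> Hausdorff_space (D_topology X) \<and> second_countable (D_topology X)"

section \<open>The tangent functors\<close>

text \<open>\<open>tangent k X\<close> is the quotient of the coproduct of the \<open>U \<times> (\<real>\<^sup>n)\<^sup>k\<close> over all plots
  \<open>p : U \<rightarrow> X\<close> by the equivalence relation generated by
  \<open>(p; r, v\<^sub>1, \<dots>, v\<^sub>k) \<sim> (q; f r, D\<^sub>r f(v\<^sub>1), \<dots>, D\<^sub>r f(v\<^sub>k))\<close> whenever \<open>q \<circ> f = p\<close>.
  The functor \<open>T\<^sub>2\<close> is the case \<open>k = 2\<close>; the tangent bundle of a manifold is the case \<open>k = 1\<close>.\<close>

type_synonym 'a tvec = "'a plot \<times> rvec \<times> rvec list"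

definition pre_tangent_set :: "nat \<Rightarrow> 'a diffeology \<Rightarrow> 'a tvec set" where
  "pre_tangent_set k X =
     {((n, U, p), r, vs) | n U p r vs. (n, U, p) \<in> Plots X \<and> r \<in> U \<and> length vs = k \<and> set vs \<subseteq> Rn n}"

definition pre_tangent :: "nat \<Rightarrow> 'a diffeology \<Rightarrow> 'a tvec diffeology" where
  "pre_tangent k X = \<lparr>Pts = pre_tangent_set k X,
     Plots = {(l, W, \<sigma>). openin (Euclidean_space l) W \<and> \<sigma> \<in> W \<rightarrow>\<^sub>E pre_tangent_set k X \<and>
       (\<forall>z\<in>W. \<exists>W'. openin (Euclidean_space l) W' \<and> z \<in> W' \<and> W' \<subseteq> W \<and>
          (\<exists>n U p \<rho> \<nu>. (n, U, p) \<in> Plots X \<and> smooth_map l W' n U \<rho> \<and>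
             length \<nu> = k \<and> (\<forall>v \<in> set \<nu>. smooth_map l W' n (Rn n) v) \<and>
             (\<forall>y\<in>W'. \<sigma> y = ((n, U, p), \<rho> y, map (\<lambda>v. v y) \<nu>))))}\<rparr>"

definition tangent_step :: "'a diffeology \<Rightarrow> 'a tvec \<Rightarrow> 'a tvec \<Rightarrow> bool" where
  "tangent_step X a b \<longleftrightarrow> (\<exists>n U p m V q f r vs.
     (n, U, p) \<in> Plots X \<and> (m, V, q) \<in> Plots X \<and> smooth_map n U m V f \<and>
     (\<forall>x\<in>U. q (f x) = p x) \<and> r \<in> U \<and> set vs \<subseteq> Rn n \<and>
     a = ((n, U, p), r, vs) \<and> b = ((m, V, q), f r, map (jacobian n f r) vs))"

definition tangent_rel :: "nat \<Rightarrow> 'a diffeology \<Rightarrow> ('a tvec \<times> 'a tvec) set" where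
  "tangent_rel k X = {(a, b). a \<in> pre_tangent_set k X \<and> b \<in> pre_tangent_set k X \<and>
     equivclp (tangent_step X) a b}"

definition tangent :: "nat \<Rightarrow> 'a diffeology \<Rightarrow> 'a tvec set diffeology" where
  "tangent k X = quotient_diffeology (pre_tangent k X) (tangent_rel k X)"

definition tangent_class :: "nat \<Rightarrow> 'a diffeology \<Rightarrow> 'a plot \<Rightarrow> rvec \<Rightarrow> rvec list \<Rightarrow> 'a tvec set" where
  "tangent_class k X P r vs = tangent_rel k X `` {(P, r, vs)}"

text \<open>\<open>tangent_map k Y h\<close> is \<open>T\<^sub>k h : T\<^sub>k X \<rightarrow> T\<^sub>k Y\<close>. For a smooth \<open>h\<close>, all the classes in the
  union coincide.\<close>

definition tangent_map ::
    "nat \<Rightarrow> 'b diffeology \<Rightarrow> ('a \<Rightarrow> 'b) \<Rightarrow> 'a tvec set \<Rightarrow> 'b tvec set" where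
  "tangent_map k Y h \<tau> =
     (\<Union>((n, U, p), r, vs) \<in> \<tau>. tangent_class k Y (n, U, restrict (h \<circ> p) U) r vs)"

abbreviation T2 :: "'a diffeology \<Rightarrow> 'a tvec set diffeology" where
  "T2 \<equiv> tangent 2"

abbreviation T2_map :: "'b diffeology \<Rightarrow> ('a \<Rightarrow> 'b) \<Rightarrow> 'a tvec set \<Rightarrow> 'b tvec set" where
  "T2_map \<equiv> tangent_map 2"

text \<open>For a manifold \<open>M\<close>, \<open>T\<^sub>2 M\<close> is \<open>TM \<times>\<^sub>M TM\<close>, with the two projections
  \<open>tangent_proj M 0\<close> and \<open>tangent_proj M 1\<close>.\<close>

definition tangent_proj :: "'a diffeology \<Rightarrow> nat \<Rightarrow> 'a tvec set \<Rightarrow> 'a tvec set" where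
  "tangent_proj X i \<tau> = (\<Union>(P, r, vs) \<in> \<tau>. tangent_class 1 X P r [vs ! i])"

definition tangent_at :: "'a diffeology \<Rightarrow> 'a \<Rightarrow> 'a tvec set set" where
  "tangent_at X x = {tangent_class 1 X (n, U, p) r [v] | n U p r v.
     (n, U, p) \<in> Plots X \<and> r \<in> U \<and> v \<in> Rn n \<and> p r = x}"

definition zero_vectors :: "'a diffeology \<Rightarrow> 'a tvec set set" where
  "zero_vectors X = {tangent_class 1 X (n, U, p) r [\<lambda>_. 0] | n U p r. (n, U, p) \<in> Plots X \<and> r \<in> U}"

definition submersion :: "'a diffeology \<Rightarrow> 'b diffeology \<Rightarrow> ('a \<Rightarrow> 'b) \<Rightarrow> bool" where
  "submersion E B p \<longleftrightarrow> smooth_between E B p \<and>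
     (\<forall>e \<in> Pts E. tangent_map 1 B p ` tangent_at E e = tangent_at B (p e))"

section \<open>Metrics\<close>

text \<open>Covariant 2-tensors on a manifold \<open>X\<close>, as functions on \<open>TX \<times>\<^sub>X TX\<close>. The vector space
  structure on the tangent spaces of a manifold is the one for which the tangent maps of all
  charts, equivalently of all plots, are linear; so fibrewise bilinearity is bilinearity of
  \<open>(v, w) \<mapsto> h (T\<^sub>2 p(r, v, w))\<close>.\<close>

definition covariant_2tensor :: "'a diffeology \<Rightarrow> ('a tvec set \<Rightarrow> real) \<Rightarrow> bool" where
  "covariant_2tensor X h \<longleftrightarrow> smooth_between (T2 X) real_diffeology h \<and>
     (\<forall>(n, U, p) \<in> Plots X. \<forall>r\<in>U. \<forall>u\<in>Rn n. \<forall>v\<in>Rn n. \<forall>w\<in>Rn n. \<forall>a b.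
        h (tangent_class 2 X (n, U, p) r [\<lambda>i. a * u i + b * v i, w]) =
          a * h (tangent_class 2 X (n, U, p) r [u, w]) + b * h (tangent_class 2 X (n, U, p) r [v, w]) \<and>
        h (tangent_class 2 X (n, U, p) r [w, \<lambda>i. a * u i + b * v i]) =
          a * h (tangent_class 2 X (n, U, p) r [w, u]) + b * h (tangent_class 2 X (n, U, p) r [w, v]))"

definition symmetric_tensor :: "'a diffeology \<Rightarrow> ('a tvec set \<Rightarrow> real) \<Rightarrow> bool" where
  "symmetric_tensor X h \<longleftrightarrow> (\<forall>(n, U, p) \<in> Plots X. \<forall>r\<in>U. \<forall>v\<in>Rn n. \<forall>w\<in>Rn n.
     h (tangent_class 2 X (n, U, p) r [v, w]) = h (tangent_class 2 X (n, U, p) r [w, v]))"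

definition positive_tensor :: "'a diffeology \<Rightarrow> ('a tvec set \<Rightarrow> real) \<Rightarrow> bool" where
  "positive_tensor X h \<longleftrightarrow> (\<forall>(n, U, p) \<in> Plots X. \<forall>r\<in>U. \<forall>v\<in>Rn n.
     0 \<le> h (tangent_class 2 X (n, U, p) r [v, v]))"

definition positive_definite_tensor :: "'a diffeology \<Rightarrow> ('a tvec set \<Rightarrow> real) \<Rightarrow> bool" where
  "positive_definite_tensor X h \<longleftrightarrow> (\<forall>(n, U, p) \<in> Plots X. \<forall>r\<in>U. \<forall>v\<in>Rn n.
     tangent_class 1 X (n, U, p) r [v] \<notin> zero_vectors X \<longrightarrow>
     0 < h (tangent_class 2 X (n, U, p) r [v, v]))"

definition riemannian_metric :: "'a diffeology \<Rightarrow> ('a tvec set \<Rightarrow> real) \<Rightarrow> bool" where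
  "riemannian_metric X h \<longleftrightarrow>
     covariant_2tensor X h \<and> symmetric_tensor X h \<and> positive_definite_tensor X h"

definition weak_riemannian_metric :: "'a diffeology \<Rightarrow> ('a tvec set \<Rightarrow> real) \<Rightarrow> bool" where
  "weak_riemannian_metric X g \<longleftrightarrow> smooth_between (T2 X) real_diffeology g \<and>
     (\<forall>(n, U, p) \<in> Plots X.
        covariant_2tensor (open_diffeology n U) (g \<circ> T2_map X p) \<and>
        symmetric_tensor (open_diffeology n U) (g \<circ> T2_map X p) \<and>
        positive_tensor (open_diffeology n U) (g \<circ> T2_map X p))"

text \<open>\<open>horizontal B p h \<xi>\<close>: the vector \<open>\<xi> \<in> T\<^sub>e E\<close> is \<open>h\<close>-orthogonal to the kernel of \<open>T\<^sub>e p\<close>.\<close>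

definition horizontal ::
    "'e diffeology \<Rightarrow> 'b diffeology \<Rightarrow> ('e \<Rightarrow> 'b) \<Rightarrow> ('e tvec set \<Rightarrow> real) \<Rightarrow> 'e tvec set \<Rightarrow> bool" where
  "horizontal E B p h \<xi> \<longleftrightarrow> (\<forall>\<kappa> \<in> Pts (T2 E).
     tangent_proj E 0 \<kappa> = \<xi> \<and> tangent_map 1 B p (tangent_proj E 1 \<kappa>) \<in> zero_vectors B \<longrightarrow> h \<kappa> = 0)"

definition horizontal_pairs ::
    "'e diffeology \<Rightarrow> 'b diffeology \<Rightarrow> ('e \<Rightarrow> 'b) \<Rightarrow> ('e tvec set \<Rightarrow> real) \<Rightarrow> 'e tvec set set" where
  "horizontal_pairs E B p h = {\<sigma> \<in> Pts (T2 E).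
     horizontal E B p h (tangent_proj E 0 \<sigma>) \<and> horizontal E B p h (tangent_proj E 1 \<sigma>)}"

text \<open>The linear isomorphism between the horizontal spaces at two points \<open>e\<close>, \<open>e'\<close> of a fibre
  relates the horizontal vectors with the same image in \<open>TB\<close>, so it is isometric iff horizontal
  pairs with the same image in \<open>T\<^sub>2 B\<close> have the same inner product. (Having the same image forces
  \<open>e\<close> and \<open>e'\<close> to be in the same fibre.)\<close>

definition transverse_metric ::
    "'e diffeology \<Rightarrow> 'b diffeology \<Rightarrow> ('e \<Rightarrow> 'b) \<Rightarrow> ('e tvec set \<Rightarrow> real) \<Rightarrow> bool" where
  "transverse_metric E B p h \<longleftrightarrow> riemannian_metric E h \<and>
     (\<forall>\<sigma> \<in> horizontal_pairs E B p h. \<forall>\<sigma>' \<in> horizontal_pairs E B p h.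
        T2_map B p \<sigma> = T2_map B p \<sigma>' \<longrightarrow> h \<sigma> = h \<sigma>')"

definition pushforward_metric ::
    "'e diffeology \<Rightarrow> 'b diffeology \<Rightarrow> ('e \<Rightarrow> 'b) \<Rightarrow> ('e tvec set \<Rightarrow> real) \<Rightarrow> 'b tvec set \<Rightarrow> real" where
  "pushforward_metric E B p h \<tau> =
     (THE c. \<exists>\<sigma> \<in> horizontal_pairs E B p h. T2_map B p \<sigma> = \<tau> \<and> c = h \<sigma>)"

section \<open>Lie groupoids\<close>

record ('m, 'g) groupoid =
  base :: "'m diffeology"
  arr :: "'g diffeology"
  src :: "'g \<Rightarrow> 'm"
  tgt :: "'g \<Rightarrow> 'm"
  idn :: "'m \<Rightarrow> 'g"
  ginv :: "'g \<Rightarrow> 'g"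
  gmult :: "'g \<Rightarrow> 'g \<Rightarrow> 'g"

text \<open>The space of composable pairs, an embedded submanifold of the product when \<open>src\<close> or \<open>tgt\<close>
  is a submersion; the smooth maps into it are those that are smooth into the product.\<close>

definition arr2 :: "('m, 'g) groupoid \<Rightarrow> ('g \<times> 'g) diffeology" where
  "arr2 G = sub_diffeology (prod_diffeology (arr G) (arr G)) {(g, h). src G g = tgt G h}"

definition groupoid_laws :: "('m, 'g) groupoid \<Rightarrow> bool" where
  "groupoid_laws G \<longleftrightarrow>
     src G \<in> Pts (arr G) \<rightarrow> Pts (base G) \<and> tgt G \<in> Pts (arr G) \<rightarrow> Pts (base G) \<and>
     (\<forall>x \<in> Pts (base G). idn G x \<in> Pts (arr G) \<and> src G (idn G x) = x \<and> tgt G (idn G x) = x) \<and>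
     (\<forall>g \<in> Pts (arr G). \<forall>h \<in> Pts (arr G). src G g = tgt G h \<longrightarrow>
        gmult G g h \<in> Pts (arr G) \<and> src G (gmult G g h) = src G h \<and> tgt G (gmult G g h) = tgt G g) \<and>
     (\<forall>g \<in> Pts (arr G). \<forall>h \<in> Pts (arr G). \<forall>k \<in> Pts (arr G).
        src G g = tgt G h \<and> src G h = tgt G k \<longrightarrow>
        gmult G (gmult G g h) k = gmult G g (gmult G h k)) \<and>
     (\<forall>g \<in> Pts (arr G). gmult G (idn G (tgt G g)) g = g \<and> gmult G g (idn G (src G g)) = g) \<and>
     (\<forall>g \<in> Pts (arr G). ginv G g \<in> Pts (arr G) \<and>
        src G (ginv G g) = tgt G g \<and> tgt G (ginv G g) = src G g \<and>
        gmult G g (ginv G g) = idn G (tgt G g) \<and> gmult G (ginv G g) g = idn G (src G g))"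

definition lie_groupoid :: "nat \<Rightarrow> nat \<Rightarrow> ('m, 'g) groupoid \<Rightarrow> bool" where
  "lie_groupoid d n G \<longleftrightarrow>
     groupoid_laws G \<and> manifold d (arr G) \<and> hausdorff_sc_manifold n (base G) \<and>
     submersion (arr G) (base G) (src G) \<and> submersion (arr G) (base G) (tgt G) \<and>
     smooth_between (base G) (arr G) (idn G) \<and> smooth_between (arr G) (arr G) (ginv G) \<and>
     smooth_between (arr2 G) (arr G) (\<lambda>(g, h). gmult G g h) \<and>
     (\<forall>x \<in> Pts (base G).
        Hausdorff_space (subtopology (D_topology (arr G)) {g \<in> Pts (arr G). src G g = x}) \<and>
        Hausdorff_space (subtopology (D_topology (arr G)) {g \<in> Pts (arr G). tgt G g = x}))"

definition proper_groupoid :: "('m, 'g) groupoid \<Rightarrow> bool" where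
  "proper_groupoid G \<longleftrightarrow> Hausdorff_space (D_topology (arr G)) \<and>
     proper_map (D_topology (arr G)) (prod_topology (D_topology (base G)) (D_topology (base G)))
       (\<lambda>g. (tgt G g, src G g))"

definition orbifold_groupoid :: "('m, 'g) groupoid \<Rightarrow> bool" where
  "orbifold_groupoid G \<longleftrightarrow> (\<exists>n. lie_groupoid n n G) \<and> proper_groupoid G"

definition orbit_rel :: "('m, 'g) groupoid \<Rightarrow> ('m \<times> 'm) set" where
  "orbit_rel G = {(src G g, tgt G g) | g. g \<in> Pts (arr G)}"

definition orbit_space :: "('m, 'g) groupoid \<Rightarrow> 'm set diffeology" where
  "orbit_space G = quotient_diffeology (base G) (orbit_rel G)"

lemma equiv_orbit_rel:
  assumes "groupoid_laws G"
  shows "equiv (Pts (base G)) (orbit_rel G)"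
proof (intro equivI)
  show "orbit_rel G \<subseteq> Pts (base G) \<times> Pts (base G)"
    using assms by (auto simp: groupoid_laws_def orbit_rel_def)
  show "refl_on (Pts (base G)) (orbit_rel G)"
  proof (rule refl_onI)
    fix x assume "x \<in> Pts (base G)"
    then have "idn G x \<in> Pts (arr G)" "src G (idn G x) = x" "tgt G (idn G x) = x"
      using assms by (auto simp: groupoid_laws_def)
    then show "(x, x) \<in> orbit_rel G"
      unfolding orbit_rel_def by (metis (mono_tags, lifting) mem_Collect_eq)
  qed
  show "sym (orbit_rel G)"
  proof (rule symI)
    fix x y assume "(x, y) \<in> orbit_rel G"
    then obtain g where "g \<in> Pts (arr G)" "src G g = x" "tgt G g = y"
      by (auto simp: orbit_rel_def)
    moreover from this have "ginv G g \<in> Pts (arr G)" "src G (ginv G g) = y" "tgt G (ginv G g) = x"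
      using assms by (auto simp: groupoid_laws_def)
    ultimately show "(y, x) \<in> orbit_rel G"
      unfolding orbit_rel_def by (metis (mono_tags, lifting) mem_Collect_eq)
  qed
  show "trans (orbit_rel G)"
  proof (rule transI)
    fix x y z assume "(x, y) \<in> orbit_rel G" "(y, z) \<in> orbit_rel G"
    then obtain g h where "g \<in> Pts (arr G)" "src G g = x" "tgt G g = y"
      "h \<in> Pts (arr G)" "src G h = y" "tgt G h = z"
      by (auto simp: orbit_rel_def)
    moreover from this have "gmult G h g \<in> Pts (arr G)" "src G (gmult G h g) = x"
      "tgt G (gmult G h g) = z"
      using assms by (auto simp: groupoid_laws_def)
    ultimately show "(x, z) \<in> orbit_rel G"
      unfolding orbit_rel_def by (metis (mono_tags, lifting) mem_Collect_eq)
  qed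
qed

lemma diffeological_space_orbit_space:
  "lie_groupoid d n G \<Longrightarrow> diffeological_space (orbit_space G)"
  unfolding orbit_space_def
  by (intro diffeological_space_quotient equiv_orbit_rel)
     (auto simp: lie_groupoid_def hausdorff_sc_manifold_def manifold_def)

definition orbit_proj :: "('m, 'g) groupoid \<Rightarrow> 'm \<Rightarrow> 'm set" where
  "orbit_proj G x = orbit_rel G `` {x}"

text \<open>The pullback of \<open>g\<close> along the orbit projection, a function on \<open>T\<^sub>2\<close> of the base.\<close>

definition orbit_pullback ::
    "('m, 'g) groupoid \<Rightarrow> ('m set tvec set \<Rightarrow> real) \<Rightarrow> 'm tvec set \<Rightarrow> real" where
  "orbit_pullback G g = g \<circ> T2_map (orbit_space G) (orbit_proj G)"

definition definite_on_orbits :: "('m, 'g) groupoid \<Rightarrow> ('m set tvec set \<Rightarrow> real) \<Rightarrow> bool" where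
  "definite_on_orbits G g \<longleftrightarrow> riemannian_metric (base G) (orbit_pullback G g)"

section \<open>Metrics on etale groupoids and on the stacks they present\<close>

text \<open>From here on \<open>G\<close> is etale. The foliation of the base \<open>M\<close> is the one by points, its normal
  bundle is \<open>TM\<close>, so \<open>N\<^sub>2F = T\<^sub>2 M\<close>, \<open>\<eta>\<^sup>N = \<eta>\<close> and \<open>\<lambda> = T\<^sub>2 \<pi>\<close>. An arrow \<open>g\<close> acts on tangent
  vectors by \<open>g \<cdot> Ts(\<xi>) = Tt(\<xi>)\<close> for \<open>\<xi> \<in> T\<^sub>g G\<close>.\<close>

definition metric_0 :: "('m, 'g) groupoid \<Rightarrow> ('m tvec set \<Rightarrow> real) \<Rightarrow> bool" where
  "metric_0 G \<eta> \<longleftrightarrow> riemannian_metric (base G) \<eta> \<and>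
     (\<forall>\<tau> \<in> Pts (T2 (arr G)). \<eta> (T2_map (base G) (tgt G) \<tau>) = \<eta> (T2_map (base G) (src G) \<tau>))"

definition metric_2 :: "('m, 'g) groupoid \<Rightarrow> (('g \<times> 'g) tvec set \<Rightarrow> real) \<Rightarrow> bool" where
  "metric_2 G \<eta>2 \<longleftrightarrow>
     riemannian_metric (arr2 G) \<eta>2 \<and>
     (\<forall>\<tau> \<in> Pts (T2 (arr2 G)).
        \<eta>2 (T2_map (arr2 G) (\<lambda>(g, h). (ginv G h, ginv G g)) \<tau>) = \<eta>2 \<tau> \<and>
        \<eta>2 (T2_map (arr2 G) (\<lambda>(g, h). (gmult G g h, ginv G h)) \<tau>) = \<eta>2 \<tau>) \<and>
     transverse_metric (arr2 G) (arr G) fst \<eta>2"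

definition induced_metric_0 ::
    "('m, 'g) groupoid \<Rightarrow> (('g \<times> 'g) tvec set \<Rightarrow> real) \<Rightarrow> 'm tvec set \<Rightarrow> real" where
  "induced_metric_0 G \<eta>2 =
     pushforward_metric (arr G) (base G) (src G) (pushforward_metric (arr2 G) (arr G) fst \<eta>2)"

definition metric_2_equiv ::
    "('m, 'g) groupoid \<Rightarrow> ((('g \<times> 'g) tvec set \<Rightarrow> real) \<times> (('g \<times> 'g) tvec set \<Rightarrow> real)) set" where
  "metric_2_equiv G = {(\<eta>2, \<theta>2). metric_2 G \<eta>2 \<and> metric_2 G \<theta>2 \<and>
     (\<forall>\<tau> \<in> Pts (T2 (base G)). induced_metric_0 G \<eta>2 \<tau> = induced_metric_0 G \<theta>2 \<tau>)}"

text \<open>The Riemannian metrics on the stack presented by \<open>G\<close>.\<close>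

definition stack_metrics :: "('m, 'g) groupoid \<Rightarrow> (('g \<times> 'g) tvec set \<Rightarrow> real) set set" where
  "stack_metrics G = {\<eta>2. metric_2 G \<eta>2} // metric_2_equiv G"

text \<open>The stack metric defined by a 0-metric \<open>\<eta>\<close>: the class of the pullback of \<open>\<eta>\<close> along the
  source map and the first projection. The class is empty, hence not a member of
  \<^term>\<open>stack_metrics G\<close>, if that pullback is not a 2-metric.\<close>

definition stack_metric_of :: "('m, 'g) groupoid \<Rightarrow> ('m tvec set \<Rightarrow> real) \<Rightarrow>
    (('g \<times> 'g) tvec set \<Rightarrow> real) set" where
  "stack_metric_of G \<eta> =
     metric_2_equiv G `` {\<eta> \<circ> T2_map (base G) (src G) \<circ> T2_map (arr G) fst}"

definition metric_0_induces ::
    "('m, 'g) groupoid \<Rightarrow> ('m tvec set \<Rightarrow> real) \<Rightarrow> ('m set tvec set \<Rightarrow> real) \<Rightarrow> bool" where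
  "metric_0_induces G \<eta> g \<longleftrightarrow> (\<forall>\<tau> \<in> Pts (T2 (base G)). orbit_pullback G g \<tau> = \<eta> \<tau>)"

definition stack_metric_induces ::
    "('m, 'g) groupoid \<Rightarrow> (('g \<times> 'g) tvec set \<Rightarrow> real) set \<Rightarrow> ('m set tvec set \<Rightarrow> real) \<Rightarrow> bool" where
  "stack_metric_induces G \<mu> g \<longleftrightarrow> (\<forall>\<eta>2 \<in> \<mu>. metric_0_induces G (induced_metric_0 G \<eta>2) g)"

end

theory Submission
  imports Defs "Jordan_Normal_Form.Determinant"
begin

text \<open>In an etale groupoid the source map, and with it the first projection of the space of composable
  pairs, has local inverses by the inverse function theorem, so all tangent vectors are horizontal and a
  2-metric is the pullback of its push-forward along every face map. Restricting to units, the induced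
  0-metric \<open>\<eta>\<close> pulls back to the same metric on arrows along source and target.

  A plot of the orbit space lifts locally to the base, and \<open>\<eta>\<close> evaluated on a lift does not depend on
  the lift: by properness, two lifts are near each point related by finitely many local sections of the
  source map, one of which works near each point of a dense set; there the values agree by invariance, and
  hence everywhere by continuity. So \<open>\<eta>\<close> descends. Conversely, a pullback from the orbit space is invariant
  because \<open>\<pi> \<circ> src = \<pi> \<circ> tgt\<close>.\<close>

section \<open>Calculus on open subsets of Euclidean spaces\<close>

text \<open>Why density is needed in comparing lifts: two lifts of one plot need not be related by a
  single local section near a given point. For the reflection of the line, take the lifts
  \<open>q t = exp (- 1 / t^2)\<close> and \<open>q' t = sgn t * exp (- 1 / t^2)\<close>, extended
  by 0. They differ by the identity for positive \<open>t\<close> and by the reflection for negative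
  \<open>t\<close>, and by neither on a neighbourhood of 0. Tangent spaces are bare quotients here:
  a chain of generating steps runs through plots of varying dimension and preserves little beyond
  the base point. So no vector space structure is built. A construction on classes is a function of
  representatives that single steps preserve (\<open>tangent_rel_invariant\<close>), and injectivity
  on fibres is expressed by zero vectors. The dimension is a variable ranging over all naturals,
  with \<open>Rn n\<close> a set of sequences. Hence the chain rule and the inverse function theorem
  are derived from partial derivatives, with coordinate cubes as neighbourhoods.\<close>

definition cube :: "nat \<Rightarrow> rvec \<Rightarrow> real \<Rightarrow> rvec set" where
  "cube n x e = {y \<in> Rn n. \<forall>i<n. \<bar>y i - x i\<bar> < e}"

lemma cube_self: "x \<in> Rn n \<Longrightarrow> e > 0 \<Longrightarrow> x \<in> cube n x e"
  by (simp add: cube_def)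

lemma cube_mono: "d \<le> e \<Longrightarrow> cube n x d \<subseteq> cube n x e"
  by (force simp: cube_def)

lemma cube_upd: "y \<in> cube n x e \<Longrightarrow> i < n \<Longrightarrow> \<bar>t - x i\<bar> < e \<Longrightarrow> y(i := t) \<in> cube n x e"
  by (auto simp: cube_def topspace_Euclidean_space)

lemma continuous_map_coord: "continuous_map (Euclidean_space n) euclideanreal (\<lambda>x. x i)"
  unfolding Euclidean_space_def
  by (intro continuous_map_from_subtopology continuous_map_product_projection) simp

lemma openin_cube: "openin (Euclidean_space n) (cube n x e)"
proof -
  have "openin (Euclidean_space n) {y \<in> Rn n. y i \<in> {x i - e<..<x i + e}}" for i
    by (rule openin_continuous_map_preimage[OF continuous_map_coord]) simp
  \<comment> \<open>The intersection with \<open>Rn n\<close> covers the case \<open>n = 0\<close>,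
    where the family of conditions is empty.\<close>
  then have "openin (Euclidean_space n)
      ((\<Inter>i\<in>{..<n}. {y \<in> Rn n. y i \<in> {x i - e<..<x i + e}}) \<inter> Rn n)"
    by (intro openin_INT) auto
  moreover have "(\<Inter>i\<in>{..<n}. {y \<in> Rn n. y i \<in> {x i - e<..<x i + e}}) \<inter> Rn n = cube n x e"
    by (auto simp: cube_def abs_diff_less_iff)
  ultimately show ?thesis by simp
qed

text \<open>A basic open set of the product restricts each coordinate to an open set. On
  \<open>Rn n\<close> the coordinates from \<open>n\<close> on are all 0, so only finitely many
  radii matter and their minimum is a radius for the cube.\<close>

lemma cube_in_openin:
  assumes "openin (Euclidean_space n) U" "x \<in> U"
  obtains e where "e > 0" "cube n x e \<subseteq> U"
proof -
  obtain S where S: "openin (powertop_real UNIV) S" "U = S \<inter> Rn n"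
    using assms(1) by (auto simp: Euclidean_space_def openin_subtopology)
  then obtain B where B: "\<And>i. open (B i)" "x \<in> PiE UNIV B" "PiE UNIV B \<subseteq> S"
    using assms(2) unfolding openin_product_topology_alt by simp metis
  have "\<exists>e>0. \<forall>t. \<bar>t - x i\<bar> < e \<longrightarrow> t \<in> B i" for i
    using B(1)[of i] B(2) by (auto simp: open_dist dist_real_def PiE_iff)
  then obtain e where e: "\<And>i. e i > 0" "\<And>i t. \<bar>t - x i\<bar> < e i \<Longrightarrow> t \<in> B i"
    by metis
  \<comment> \<open>Inserting 1 keeps the minimum defined and positive when
    \<open>n = 0\<close>.\<close>
  define d where "d = Min (insert 1 (e ` {..<n}))"
  have d: "d > 0" "\<And>i. i < n \<Longrightarrow> d \<le> e i"
    using e(1) by (auto simp: d_def)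
  have "cube n x d \<subseteq> U"
  proof
    fix y assume y: "y \<in> cube n x d"
    have xR: "x \<in> Rn n" using assms S by auto
    have "y i \<in> B i" for i
    proof (cases "i < n")
      case True
      then show ?thesis using y d(2)[OF True] by (intro e(2)) (force simp: cube_def)
    next
      case False
      then have "y i = x i" using y xR by (auto simp: cube_def topspace_Euclidean_space)
      then show ?thesis using e by simp
    qed
    then show "y \<in> U" using B(3) S(2) y by (auto simp: cube_def)
  qed
  with d(1) show ?thesis by (rule that)
qed

lemma openin_Euclidean_space_cube:
  "openin (Euclidean_space n) U \<longleftrightarrow> U \<subseteq> Rn n \<and> (\<forall>x\<in>U. \<exists>e>0. cube n x e \<subseteq> U)"
proof
  assume "openin (Euclidean_space n) U"
  then show "U \<subseteq> Rn n \<and> (\<forall>x\<in>U. \<exists>e>0. cube n x e \<subseteq> U)"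
    using openin_subset cube_in_openin by metis
next
  assume *: "U \<subseteq> Rn n \<and> (\<forall>x\<in>U. \<exists>e>0. cube n x e \<subseteq> U)"
  show "openin (Euclidean_space n) U"
  proof (subst openin_subopen, rule ballI)
    fix x assume "x \<in> U"
    with * obtain e where "e > 0" "cube n x e \<subseteq> U" "x \<in> Rn n" by blast
    then show "\<exists>T. openin (Euclidean_space n) T \<and> x \<in> T \<and> T \<subseteq> U"
      using openin_cube[of n x e] cube_self by blast
  qed
qed

lemma topspace_subtopology_openin: "openin X U \<Longrightarrow> topspace (subtopology X U) = U"
  using openin_subset by fastforce

lemma openin_preimage_open:
  assumes "openin X U" "continuous_map (subtopology X U) Y f" "openin Y S"
  shows "openin X {x\<in>U. f x \<in> S}"
  using openin_continuous_map_preimage[OF assms(2,3)] assms(1)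
  by (auto simp: topspace_subtopology_openin openin_open_subtopology simp del: topspace_subtopology)

lemma continuous_map_cubeD:
  assumes "openin (Euclidean_space n) U" "continuous_map (subtopology (Euclidean_space n) U) euclideanreal f"
    "x \<in> U" "e > 0"
  obtains d where "d > 0" "cube n x d \<subseteq> U" "\<And>y. y \<in> cube n x d \<Longrightarrow> \<bar>f y - f x\<bar> < e"
proof -
  have "openin (Euclidean_space n) {y\<in>U. f y \<in> {f x - e<..<f x + e}}"
    by (rule openin_preimage_open[OF assms(1,2)]) simp
  moreover have "x \<in> {y\<in>U. f y \<in> {f x - e<..<f x + e}}" using assms by auto
  ultimately obtain d where "d > 0" "cube n x d \<subseteq> {y\<in>U. f y \<in> {f x - e<..<f x + e}}"
    by (rule cube_in_openin)
  then show ?thesis by (intro that[of d]) (auto simp: abs_less_iff)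
qed

lemma continuous_map_cubeI:
  assumes U: "openin (Euclidean_space n) U"
    and c: "\<And>x e. x \<in> U \<Longrightarrow> e > 0 \<Longrightarrow> \<exists>d>0. \<forall>y \<in> cube n x d \<inter> U. \<bar>f y - f x\<bar> < e"
  shows "continuous_map (subtopology (Euclidean_space n) U) euclideanreal f"
  unfolding continuous_map_def
proof (intro conjI allI impI)
  fix S assume S: "openin euclideanreal S"
  have "openin (Euclidean_space n) {x\<in>U. f x \<in> S}"
    unfolding openin_Euclidean_space_cube
  proof (intro conjI ballI)
    show "{x\<in>U. f x \<in> S} \<subseteq> Rn n" using U openin_subset by blast
    fix x assume x: "x \<in> {x\<in>U. f x \<in> S}"
    then obtain e where e: "e > 0" "\<And>t. \<bar>t - f x\<bar> < e \<Longrightarrow> t \<in> S"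
      using S by (auto simp: open_dist dist_real_def)
    obtain d where d: "d > 0" "\<forall>y \<in> cube n x d \<inter> U. \<bar>f y - f x\<bar> < e"
      using c[of x e] x e by auto
    obtain d' where d': "d' > 0" "cube n x d' \<subseteq> U" using cube_in_openin[OF U, of x] x by auto
    have "cube n x (min d d') \<subseteq> {x\<in>U. f x \<in> S}"
      using d(2) d'(2) e(2) cube_mono[of "min d d'" d n x] cube_mono[of "min d d'" d' n x]
      by (simp add: subset_iff)
    then show "\<exists>e>0. cube n x e \<subseteq> {x \<in> U. f x \<in> S}" using d d' by (intro exI[of _ "min d d'"]) auto
  qed
  then show "openin (subtopology (Euclidean_space n) U)
      {x \<in> topspace (subtopology (Euclidean_space n) U). f x \<in> S}"
    using U by (auto simp: topspace_subtopology_openin openin_open_subtopology simp del: topspace_subtopology)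
qed auto

section \<open>Differentiability from continuous partial derivatives\<close>

lemma has_partial_deriv:
  assumes "C_k (Suc k) n U f" "x \<in> U" "i < n"
  shows "((\<lambda>t. f (x(i := t))) has_real_derivative partial_deriv i f x) (at (x i))"
  using assms unfolding partial_deriv_def
  by (simp add: DERIV_deriv_iff_real_differentiable)

lemma has_partial_deriv':
  assumes "C_k (Suc k) n U f" "x(i := t) \<in> U" "i < n"
  shows "((\<lambda>t. f (x(i := t))) has_real_derivative partial_deriv i f (x(i := t))) (at t)"
  using has_partial_deriv[OF assms] by simp

lemma continuous_map_partial_deriv:
  "C_k (Suc k) n U f \<Longrightarrow> i < n \<Longrightarrow>
     continuous_map (subtopology (Euclidean_space n) U) euclideanreal (partial_deriv i f)"
  by (cases k) auto

text \<open>Moving from \<open>z\<close> to \<open>y\<close> one coordinate at a time reduces the estimate to the mean value theorem.\<close>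

lemma strict_differentiability:
  assumes U: "openin (Euclidean_space n) U" and f: "C_k (Suc k) n U f" and x: "x \<in> U" and e: "e > 0"
  shows "\<exists>d>0. cube n x d \<subseteq> U \<and> (\<forall>y \<in> cube n x d. \<forall>z \<in> cube n x d.
       \<bar>f y - f z - (\<Sum>i<n. (y i - z i) * partial_deriv i f x)\<bar> \<le> e * (\<Sum>i<n. \<bar>y i - z i\<bar>))"
proof -
  obtain d0 where d0: "d0 > 0" "cube n x d0 \<subseteq> U" using cube_in_openin[OF U x] .
  have "\<exists>d>0. \<forall>y\<in>cube n x d. \<bar>partial_deriv i f y - partial_deriv i f x\<bar> < e" if "i < n" for i
    by (rule continuous_map_cubeD[OF U continuous_map_partial_deriv[OF f that] x e]) blast
  then obtain D where D: "\<And>i. i < n \<Longrightarrow> D i > 0"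
    "\<And>i y. i < n \<Longrightarrow> y \<in> cube n x (D i) \<Longrightarrow> \<bar>partial_deriv i f y - partial_deriv i f x\<bar> < e"
    by metis
  define d where "d = Min (insert d0 (D ` {..<n}))"
  have d: "d > 0" "d \<le> d0" "\<And>i. i < n \<Longrightarrow> d \<le> D i"
    using D(1) d0 by (auto simp: d_def)
  have sub: "cube n x d \<subseteq> U" using d0 cube_mono[OF d(2)] by blast
  have pd: "\<bar>partial_deriv i f y - partial_deriv i f x\<bar> < e" if "i < n" "y \<in> cube n x d" for i y
    using D(2)[OF that(1)] cube_mono[OF d(3)[OF that(1)]] that(2) by blast
  have main: "\<bar>f y - f z - (\<Sum>i<n. (y i - z i) * partial_deriv i f x)\<bar> \<le> e * (\<Sum>i<n. \<bar>y i - z i\<bar>)"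
    if y: "y \<in> cube n x d" and z: "z \<in> cube n x d" for y z
  proof -
    \<comment> \<open>\<open>w m\<close> has its first \<open>m\<close> coordinates from
      \<open>y\<close> and the rest from \<open>z\<close>. Since a cube is a product of intervals,
      these intermediate points remain where \<open>pd\<close> controls the partial
      derivatives.\<close>
    define w where "w m = (\<lambda>i. if i < m then y i else z i)" for m :: nat
    have wc: "w m \<in> cube n x d" for m
      using y z by (auto simp: w_def cube_def topspace_Euclidean_space)
    have step: "\<bar>f (w (Suc i)) - f (w i) - (y i - z i) * partial_deriv i f x\<bar> \<le> e * \<bar>y i - z i\<bar>"
      if i: "i < n" for i
    proof -
      define \<phi> where "\<phi> t = f ((w i)(i := t))" for t
      have S: "w (Suc i) = (w i)(i := y i)" "w i = (w i)(i := z i)"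
        by (auto simp: w_def less_Suc_eq)
      have b: "\<bar>y i - x i\<bar> < d" "\<bar>z i - x i\<bar> < d" using y z i by (auto simp: cube_def)
      have der: "(\<phi> has_real_derivative partial_deriv i f ((w i)(i := t))) (at t)"
        if "\<bar>t - x i\<bar> < d" for t
        unfolding \<phi>_def using cube_upd[OF wc i that] sub by (intro has_partial_deriv'[OF f _ i]) blast
      have "\<exists>t. \<bar>t - x i\<bar> < d \<and> \<phi> (y i) - \<phi> (z i) = (y i - z i) * partial_deriv i f ((w i)(i := t))"
      proof (cases "y i" "z i" rule: linorder_cases)
        case less
        obtain t where "t > y i" "t < z i" "\<phi> (z i) - \<phi> (y i) = (z i - y i) * partial_deriv i f ((w i)(i := t))"
          using MVT2[OF less, of \<phi> "\<lambda>t. partial_deriv i f ((w i)(i := t))"] der b by force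
        then show ?thesis using b by (intro exI[of _ t]) (auto simp: algebra_simps)
      next
        case equal
        then show ?thesis using b by auto
      next
        case greater
        obtain t where "t > z i" "t < y i" "\<phi> (y i) - \<phi> (z i) = (y i - z i) * partial_deriv i f ((w i)(i := t))"
          using MVT2[OF greater, of \<phi> "\<lambda>t. partial_deriv i f ((w i)(i := t))"] der b by force
        then show ?thesis using b by (intro exI[of _ t]) auto
      qed
      then obtain t where t: "\<bar>t - x i\<bar> < d"
        "\<phi> (y i) - \<phi> (z i) = (y i - z i) * partial_deriv i f ((w i)(i := t))" by blast
      have "f (w (Suc i)) - f (w i) - (y i - z i) * partial_deriv i f x
          = (y i - z i) * (partial_deriv i f ((w i)(i := t)) - partial_deriv i f x)"
        using t(2) S unfolding \<phi>_def by (simp add: algebra_simps)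
      also have "\<bar>\<dots>\<bar> \<le> \<bar>y i - z i\<bar> * e"
        unfolding abs_mult using pd[OF i cube_upd[OF wc[of i] i t(1)]] by (intro mult_left_mono) auto
      finally show ?thesis by (simp add: mult.commute)
    qed
    have "f y - f z = f (w n) - f (w 0)"
    proof -
      have "w n = y" using y z by (auto simp: w_def cube_def topspace_Euclidean_space)
      moreover have "w 0 = z" by (simp add: w_def)
      ultimately show ?thesis by simp
    qed
    also have "\<dots> = (\<Sum>i<n. f (w (Suc i)) - f (w i))" by (rule sum_lessThan_telescope[symmetric])
    finally have "f y - f z - (\<Sum>i<n. (y i - z i) * partial_deriv i f x) =
        (\<Sum>i<n. f (w (Suc i)) - f (w i) - (y i - z i) * partial_deriv i f x)"
      by (simp add: sum_subtractf)
    also have "\<bar>\<dots>\<bar> \<le> (\<Sum>i<n. e * \<bar>y i - z i\<bar>)"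
      using step by (intro order_trans[OF sum_abs sum_mono]) auto
    finally show ?thesis by (simp add: sum_distrib_left)
  qed
  show ?thesis using d(1) sub main by blast
qed

text \<open>Dividing the estimate of \<open>strict_differentiability\<close> by
  \<open>t - t0\<close> leaves an error proportional to the difference quotients of
  \<open>c\<close>, and these are bounded near \<open>t0\<close> because they converge. The curve is
  only required to stay in \<open>Rn m\<close> near \<open>t0\<close>, as a map on an open set is
  arbitrary outside it.\<close>

lemma has_derivative_along_curve:
  assumes V: "openin (Euclidean_space m) V" and h: "C_k (Suc k) m V h" and t0: "c t0 \<in> V"
    and cR: "\<forall>\<^sub>F t in at t0. c t \<in> Rn m"
    and c': "\<And>j. j < m \<Longrightarrow> ((\<lambda>t. c t j) has_real_derivative c' j) (at t0)"
  shows "((\<lambda>t. h (c t)) has_real_derivative (\<Sum>j<m. c' j * partial_deriv j h (c t0))) (at t0)"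
proof -
  define q where "q j t = (c t j - c t0 j) / (t - t0)" for j t
  have q: "(q j \<longlongrightarrow> c' j) (at t0)" if "j < m" for j
    using c'[OF that] by (simp add: has_field_derivative_iff q_def[abs_def])
  define K where "K = (\<Sum>j<m. \<bar>c' j\<bar>)"
  have K0: "K \<ge> 0" by (simp add: K_def sum_nonneg)
  have "((\<lambda>t. \<Sum>j<m. \<bar>q j t\<bar>) \<longlongrightarrow> K) (at t0)"
    unfolding K_def using q by (intro tendsto_sum tendsto_rabs) auto
  then have evK: "\<forall>\<^sub>F t in at t0. (\<Sum>j<m. \<bar>q j t\<bar>) < K + 1"
    by (rule order_tendstoD) simp
  define R where "R t = (h (c t) - h (c t0)) / (t - t0) - (\<Sum>j<m. q j t * partial_deriv j h (c t0))" for t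
  have "(R \<longlongrightarrow> 0) (at t0)"
  proof (rule tendstoI)
    fix e :: real assume e: "e > 0"
    \<comment> \<open>\<open>K\<close> is the limit of the sums of the
      \<open>\<bar>q j t\<bar>\<close>, so \<open>K + 1\<close> bounds them near \<open>t0\<close>;
      the total error is then below \<open>e' * (K + 1) = e\<close>.\<close>
    define e' where "e' = e / (K + 1)"
    have e': "e' > 0" using e K0 by (simp add: e'_def)
    obtain d where d: "d > 0" "cube m (c t0) d \<subseteq> V"
      "\<forall>y \<in> cube m (c t0) d. \<forall>z \<in> cube m (c t0) d.
       \<bar>h y - h z - (\<Sum>i<m. (y i - z i) * partial_deriv i h (c t0))\<bar> \<le> e' * (\<Sum>i<m. \<bar>y i - z i\<bar>)"
      using strict_differentiability[OF V h t0 e'] by (elim exE conjE)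
    have "\<forall>\<^sub>F t in at t0. \<bar>c t j - c t0 j\<bar> < d" if "j < m" for j
    proof -
      have "((\<lambda>t. c t j) \<longlongrightarrow> c t0 j) (at t0)"
        using DERIV_isCont[OF c'[OF that]] by (simp add: isCont_def)
      then show ?thesis using d(1) by (auto dest!: tendstoD simp: dist_real_def)
    qed
    then have "\<forall>\<^sub>F t in at t0. \<forall>j\<in>{..<m}. \<bar>c t j - c t0 j\<bar> < d"
      by (intro eventually_ball_finite) auto
    then have evc: "\<forall>\<^sub>F t in at t0. c t \<in> cube m (c t0) d"
      using cR by eventually_elim (auto simp: cube_def)
    have "\<forall>\<^sub>F t in at t0. t \<noteq> t0" by (simp add: eventually_at_filter)
    then show "\<forall>\<^sub>F t in at t0. dist (R t) 0 < e"
      using evc evK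
    proof eventually_elim
      case (elim t)
      have tp: "\<bar>t - t0\<bar> > 0" using elim by simp
      have c0: "c t0 \<in> cube m (c t0) d"
        using d(1) t0 V openin_subset by (intro cube_self) blast
      have "R t = (h (c t) - h (c t0) - (\<Sum>j<m. (c t j - c t0 j) * partial_deriv j h (c t0))) / (t - t0)"
        by (simp add: R_def q_def sum_divide_distrib diff_divide_distrib[of "h (c t) - h (c t0)"])
      then have "\<bar>R t\<bar> \<le> e' * (\<Sum>j<m. \<bar>c t j - c t0 j\<bar>) / \<bar>t - t0\<bar>"
        using d(3)[rule_format, OF elim(2) c0] by (simp add: abs_divide divide_right_mono)
      also have "\<dots> = e' * (\<Sum>j<m. \<bar>q j t\<bar>)"
        by (simp add: q_def sum_divide_distrib[symmetric] abs_divide)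
      also have "\<dots> < e' * (K + 1)" using elim e' by simp
      also have "\<dots> = e" using K0 by (simp add: e'_def)
      finally show ?case by (simp add: dist_real_def)
    qed
  qed
  then have "((\<lambda>t. R t + (\<Sum>j<m. q j t * partial_deriv j h (c t0))) \<longlongrightarrow>
      0 + (\<Sum>j<m. c' j * partial_deriv j h (c t0))) (at t0)"
    using q by (intro tendsto_intros) auto
  then show ?thesis by (simp add: has_field_derivative_iff R_def)
qed

section \<open>Closure properties of the classes \<open>C_k\<close> and the chain rule\<close>

lemma C_k_mono: "C_k (Suc k) n U f \<Longrightarrow> C_k k n U f"
  by (induction k arbitrary: f) auto

lemma C_k_continuous: "C_k k n U f \<Longrightarrow> continuous_map (subtopology (Euclidean_space n) U) euclideanreal f"
  by (cases k) auto

lemma C_k_const: "C_k k n U (\<lambda>_. c)"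
proof (induction k arbitrary: c)
  case (Suc k)
  have "partial_deriv i (\<lambda>_. c) = (\<lambda>_. 0)" for i by (auto simp: partial_deriv_def)
  with Suc show ?case by simp
qed simp

text \<open>Lets a derivative be given by a formula instead of \<open>partial_deriv\<close>. The two
  need to agree only on the open set \<open>U\<close>, which \<open>C_k_cong\<close> allows.\<close>

lemma C_k_SucI:
  assumes U: "openin (Euclidean_space n) U"
    and c: "continuous_map (subtopology (Euclidean_space n) U) euclideanreal f"
    and d: "\<And>i x. i < n \<Longrightarrow> x \<in> U \<Longrightarrow> ((\<lambda>t. f (x(i := t))) has_real_derivative f' i x) (at (x i))"
    and C: "\<And>i. i < n \<Longrightarrow> C_k k n U (f' i)"
  shows "C_k (Suc k) n U f"
  unfolding C_k.simps
proof (intro conjI c allI impI ballI)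
  fix i assume i: "i < n"
  show "(\<lambda>t. f (x(i := t))) differentiable at (x i)" if "x \<in> U" for x
    using d[OF i that] real_differentiable_def by blast
  show "C_k k n U (partial_deriv i f)"
    by (rule C_k_cong[OF U C[OF i]]) (simp add: partial_deriv_def DERIV_imp_deriv[OF d[OF i]])
qed

lemma C_k_coord:
  assumes U: "openin (Euclidean_space n) U"
  shows "C_k k n U (\<lambda>x. x j)"
proof (cases k)
  case 0
  then show ?thesis by (simp add: continuous_map_from_subtopology continuous_map_coord)
next
  case (Suc k)
  show ?thesis unfolding Suc
  proof (rule C_k_SucI[OF U, where f' = "\<lambda>i x. if i = j then 1 else 0"])
    show "((\<lambda>t. (x(i := t)) j) has_real_derivative (if i = j then 1 else 0)) (at (x i))" for i x
      by (auto intro!: derivative_eq_intros)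
  qed (auto simp: continuous_map_from_subtopology continuous_map_coord C_k_const)
qed

lemma C_k_add:
  assumes U: "openin (Euclidean_space n) U"
  shows "C_k k n U f \<Longrightarrow> C_k k n U g \<Longrightarrow> C_k k n U (\<lambda>x. f x + g x)"
proof (induction k arbitrary: f g)
  case 0
  then show ?case by (auto intro: continuous_map_add)
next
  case (Suc k)
  show ?case
  proof (rule C_k_SucI[OF U, where f' = "\<lambda>i x. partial_deriv i f x + partial_deriv i g x"])
    fix i x assume ix: "i < n" "x \<in> U"
    show "((\<lambda>t. f (x(i := t)) + g (x(i := t))) has_real_derivative
        partial_deriv i f x + partial_deriv i g x) (at (x i))"
      by (rule DERIV_add[OF has_partial_deriv[OF Suc.prems(1) ix(2,1)] has_partial_deriv[OF Suc.prems(2) ix(2,1)]])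
  qed (use Suc in \<open>auto intro!: continuous_map_add\<close>)
qed

lemma C_k_mult:
  assumes U: "openin (Euclidean_space n) U"
  shows "C_k k n U f \<Longrightarrow> C_k k n U g \<Longrightarrow> C_k k n U (\<lambda>x. f x * g x)"
proof (induction k arbitrary: f g)
  case 0
  then show ?case by (auto intro: continuous_map_real_mult)
next
  case (Suc k)
  have fg: "C_k k n U f" "C_k k n U g" using Suc.prems C_k_mono by blast+
  show ?case
  proof (rule C_k_SucI[OF U, where f' = "\<lambda>i x. partial_deriv i f x * g x + partial_deriv i g x * f x"])
    fix i x assume ix: "i < n" "x \<in> U"
    show "((\<lambda>t. f (x(i := t)) * g (x(i := t))) has_real_derivative
        partial_deriv i f x * g x + partial_deriv i g x * f x) (at (x i))"
      using DERIV_mult[OF has_partial_deriv[OF Suc.prems(1) ix(2,1)] has_partial_deriv[OF Suc.prems(2) ix(2,1)]]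
      unfolding fun_upd_triv .
  qed (use Suc fg in \<open>auto intro!: continuous_map_real_mult C_k_add[OF U]\<close>)
qed

lemma C_k_sum:
  assumes U: "openin (Euclidean_space n) U"
  shows "(\<And>i. i \<in> I \<Longrightarrow> C_k k n U (f i)) \<Longrightarrow> C_k k n U (\<lambda>x. \<Sum>i\<in>I. f i x)"
  by (induction I rule: infinite_finite_induct) (auto intro: C_k_const C_k_add[OF U])

lemma C_k_prod:
  assumes U: "openin (Euclidean_space n) U"
  shows "(\<And>i. i \<in> I \<Longrightarrow> C_k k n U (f i)) \<Longrightarrow> C_k k n U (\<lambda>x. \<Prod>i\<in>I. f i x)"
  by (induction I rule: infinite_finite_induct) (auto intro: C_k_const C_k_mult[OF U])

lemma C_k_inverse:
  assumes U: "openin (Euclidean_space n) U" and nz: "\<And>x. x \<in> U \<Longrightarrow> f x \<noteq> 0"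
  shows "C_k k n U f \<Longrightarrow> C_k k n U (\<lambda>x. inverse (f x))"
proof (induction k)
  case 0
  then show ?case using nz U by (auto intro: continuous_map_real_inverse simp: topspace_subtopology_openin)
next
  case (Suc k)
  have f: "C_k k n U f" using Suc.prems C_k_mono by blast
  show ?case
  \<comment> \<open>The derivative of the reciprocal is a product in which the reciprocal itself
    recurs, so the induction hypothesis applies to it.\<close>
  proof (rule C_k_SucI[OF U, where f' = "\<lambda>i x. (-1) * (inverse (f x) * (partial_deriv i f x * inverse (f x)))"])
    fix i x assume ix: "i < n" "x \<in> U"
    show "((\<lambda>t. inverse (f (x(i := t)))) has_real_derivative
        (-1) * (inverse (f x) * (partial_deriv i f x * inverse (f x)))) (at (x i))"
      using DERIV_inverse'[OF has_partial_deriv[OF Suc.prems ix(2,1)]] nz[OF ix(2)]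
      unfolding fun_upd_triv by (simp only: mult_minus1 mult.assoc not_False_eq_True simp_thms)
  next
    fix i assume "i < n"
    then show "C_k k n U (\<lambda>x. (-1) * (inverse (f x) * (partial_deriv i f x * inverse (f x))))"
      using Suc.prems by (intro C_k_mult[OF U] C_k_const Suc.IH f) auto
  qed (use Suc nz U in \<open>auto intro!: continuous_map_real_inverse simp: topspace_subtopology_openin\<close>)
qed

lemma continuous_map_into_Rn:
  assumes "\<And>j. j < m \<Longrightarrow> continuous_map X euclideanreal (\<lambda>x. f x j)" "f \<in> topspace X \<rightarrow> Rn m"
  shows "continuous_map X (Euclidean_space m) f"
proof -
  have "continuous_map X (Euclidean_space m) (\<lambda>x i. if i < m then f x i else 0)"
    using assms(1) by (simp add: continuous_map_componentwise_Euclidean_space)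
  then show ?thesis
    by (rule continuous_map_eq) (use assms(2) in \<open>auto simp: topspace_Euclidean_space Pi_iff\<close>)
qed

lemma partial_deriv_chain:
  assumes U: "openin (Euclidean_space n) U" and V: "openin (Euclidean_space m) V"
    and h: "C_k (Suc k) m V h" and f: "\<And>j. j < m \<Longrightarrow> C_k (Suc k) n U (\<lambda>x. f x j)"
    and fV: "f \<in> U \<rightarrow> V" and x: "x \<in> U" and i: "i < n"
  shows "((\<lambda>t. h (f (x(i := t)))) has_real_derivative
     (\<Sum>j<m. partial_deriv i (\<lambda>x. f x j) x * partial_deriv j h (f x))) (at (x i))"
proof -
  \<comment> \<open>\<open>f\<close> is unconstrained outside \<open>U\<close>, so the values along
    the coordinate line lie in \<open>Rn m\<close> only for \<open>t\<close> near
    \<open>x i\<close>.\<close>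
  have ev: "\<forall>\<^sub>F t in at (x i). f (x(i := t)) \<in> Rn m"
  proof -
    obtain e where e: "e > 0" "cube n x e \<subseteq> U" using cube_in_openin[OF U x] .
    have xR: "x \<in> Rn n" using x U openin_subset by blast
    have "f (x(i := t)) \<in> Rn m" if "dist t (x i) < e" for t
    proof -
      have "x(i := t) \<in> U" using that e cube_upd[OF cube_self[OF xR e(1)] i, of t] by (auto simp: dist_real_def)
      then show ?thesis using fV V openin_subset by blast
    qed
    then show ?thesis using e(1) by (auto simp: eventually_at)
  qed
  have "((\<lambda>t. h ((\<lambda>t. f (x(i := t))) t)) has_real_derivative
     (\<Sum>j<m. partial_deriv i (\<lambda>x. f x j) x * partial_deriv j h ((\<lambda>t. f (x(i := t))) (x i)))) (at (x i))"
    by (rule has_derivative_along_curve[OF V h _ ev]) (use fV x i in \<open>auto intro!: has_partial_deriv[OF f]\<close>)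
  then show ?thesis by simp
qed

text \<open>By the chain rule the derivatives are sums of products of partial derivatives of
  \<open>f\<close> with partial derivatives of \<open>h\<close> composed with \<open>f\<close>. The
  induction is over all \<open>h\<close> with \<open>f\<close> fixed, so it applies to the
  latter.\<close>

lemma C_k_compose:
  assumes U: "openin (Euclidean_space n) U" and V: "openin (Euclidean_space m) V" and fV: "f \<in> U \<rightarrow> V"
  shows "C_k k m V h \<Longrightarrow> (\<And>j. j < m \<Longrightarrow> C_k k n U (\<lambda>x. f x j)) \<Longrightarrow> C_k k n U (\<lambda>x. h (f x))"
proof (induction k arbitrary: h)
  have c: "continuous_map (subtopology (Euclidean_space n) U) euclideanreal (\<lambda>x. h (f x))"
    if h: "C_k k m V h" and f: "\<And>j. j < m \<Longrightarrow> C_k k n U (\<lambda>x. f x j)" for h k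
  proof -
    have "continuous_map (subtopology (Euclidean_space n) U) (Euclidean_space m) f"
      using f fV U V openin_subset[OF V]
      by (intro continuous_map_into_Rn) (auto intro: C_k_continuous simp: topspace_subtopology_openin)
    then have "continuous_map (subtopology (Euclidean_space n) U) (subtopology (Euclidean_space m) V) f"
      using fV U by (auto simp: continuous_map_in_subtopology topspace_subtopology_openin)
    then show ?thesis
      using continuous_map_compose[OF _ C_k_continuous[OF h]] by (simp add: o_def)
  qed
  {
    case 0
    then show ?case using c[of 0 h] by simp
  next
    case (Suc k)
    have f: "C_k k n U (\<lambda>x. f x j)" if "j < m" for j using Suc.prems(2)[OF that] C_k_mono by blast
    show ?case
    proof (rule C_k_SucI[OF U c[OF Suc.prems] partial_deriv_chain[OF U V Suc.prems fV]])
      fix i assume i: "i < n"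
      show "C_k k n U (\<lambda>x. \<Sum>j<m. partial_deriv i (\<lambda>x. f x j) x * partial_deriv j h (f x))"
      proof (intro C_k_sum[OF U] C_k_mult[OF U])
        fix j assume "j \<in> {..<m}"
        then have j: "j < m" by simp
        show "C_k k n U (\<lambda>x. partial_deriv i (\<lambda>x. f x j) x)"
          using Suc.prems(2)[OF j] i unfolding C_k.simps by blast
        have "C_k k m V (partial_deriv j h)"
          using Suc.prems(1) j unfolding C_k.simps by blast
        then show "C_k k n U (\<lambda>x. partial_deriv j h (f x))"
          by (rule Suc.IH[OF _ f])
      qed
    qed auto
  }
qed

lemma smooth_map_compose:
  assumes "openin (Euclidean_space n) U" "openin (Euclidean_space m) V"
    "smooth_map n U m V f" "smooth_map m V l W g"
  shows "smooth_map n U l W (g \<circ> f)"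
  unfolding smooth_map_def smooth_fun_def
proof (intro conjI allI impI)
  show "U \<subseteq> Rn n" using assms(3) by (simp add: smooth_map_def)
  show "W \<subseteq> Rn l" using assms(4) by (simp add: smooth_map_def)
  have "f \<in> U \<rightarrow> V" "g \<in> V \<rightarrow> W" using assms(3,4) unfolding smooth_map_def by blast+
  then show "g \<circ> f \<in> U \<rightarrow> W" by auto
  show "C_k k n U (\<lambda>x. (g \<circ> f) x j)" if "j < l" for j k
    using assms that unfolding smooth_map_def smooth_fun_def o_def
    by (intro C_k_compose[OF assms(1,2), where h = "\<lambda>y. g y j"]) blast+
qed

text \<open>The conclusion equates whole sequences, so all components of \<open>g\<close> must be
  smooth, also those beyond the dimension of its target; \<open>smooth_fun_component\<close>
  supplies these.\<close>

lemma jacobian_compose: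
  assumes U: "openin (Euclidean_space n) U" and V: "openin (Euclidean_space m) V"
    and f: "smooth_map n U m V f" and g: "\<And>j. smooth_fun m V (\<lambda>y. g y j)" and r: "r \<in> U"
  shows "jacobian n (g \<circ> f) r v = jacobian m g (f r) (jacobian n f r v)"
proof
  fix l
  have "partial_deriv i (\<lambda>x. (g \<circ> f) x l) r =
      (\<Sum>j<m. partial_deriv i (\<lambda>x. f x j) r * partial_deriv j (\<lambda>y. g y l) (f r))" if "i < n" for i
  proof -
    have "((\<lambda>t. g (f (r(i := t))) l) has_real_derivative
      (\<Sum>j<m. partial_deriv i (\<lambda>x. f x j) r * partial_deriv j (\<lambda>y. g y l) (f r))) (at (r i))"
      using f g r that unfolding smooth_map_def smooth_fun_def
      by (intro partial_deriv_chain[OF U V, where h = "\<lambda>y. g y l" and k = 0]) blast+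
    then show ?thesis unfolding partial_deriv_def[of i "\<lambda>x. (g \<circ> f) x l"] by (simp add: DERIV_imp_deriv)
  qed
  then have "jacobian n (g \<circ> f) r v l = (\<Sum>i<n. \<Sum>j<m. v i * (partial_deriv i (\<lambda>x. f x j) r * partial_deriv j (\<lambda>y. g y l) (f r)))"
    by (simp add: jacobian_def sum_distrib_left)
  also have "\<dots> = jacobian m g (f r) (jacobian n f r v) l"
    by (subst sum.swap) (simp add: jacobian_def sum_distrib_right mult.assoc)
  finally show "jacobian n (g \<circ> f) r v l = jacobian m g (f r) (jacobian n f r v) l" .
qed

lemma jacobian_id:
  assumes "v \<in> Rn n" shows "jacobian n id r v = v"
proof
  fix j
  have "partial_deriv i (\<lambda>x. x j) r = (if i = j then 1 else 0)" for i
    unfolding partial_deriv_def by (auto intro!: DERIV_imp_deriv derivative_eq_intros)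
  then have "jacobian n id r v j = (\<Sum>i<n. if i = j then v i else 0)"
    unfolding jacobian_def id_apply by (intro sum.cong) auto
  then show "jacobian n id r v j = v j"
    using assms by (simp add: topspace_Euclidean_space)
qed

lemma smooth_map_id: "openin (Euclidean_space n) V \<Longrightarrow> U \<subseteq> V \<Longrightarrow> smooth_map n U n V id"
  by (rule smooth_map_subset[where U = V and V = V])
     (use openin_subset in \<open>auto simp: smooth_map_def smooth_fun_def C_k_coord\<close>)

lemma smooth_map_const: "U \<subseteq> Rn n \<Longrightarrow> V \<subseteq> Rn m \<Longrightarrow> v \<in> V \<Longrightarrow> smooth_map n U m V (\<lambda>_. v)"
  by (auto simp: smooth_map_def smooth_fun_def C_k_const)

lemma smooth_map_image: "smooth_map n U m V f \<Longrightarrow> x \<in> U \<Longrightarrow> f x \<in> V"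
  unfolding smooth_map_def by blast

section \<open>The inverse function theorem\<close>

lemma C_k_det:
  assumes U: "openin (Euclidean_space n) U" and A: "\<And>x. A x \<in> carrier_mat m m"
    and C: "\<And>i j. i < m \<Longrightarrow> j < m \<Longrightarrow> C_k k n U (\<lambda>x. A x $$ (i, j))"
  shows "C_k k n U (\<lambda>x. det (A x))"
proof -
  have "(\<lambda>x. det (A x)) = (\<lambda>x. \<Sum>p\<in>{p. p permutes {0..<m}}. signof p * (\<Prod>i\<in>{0..<m}. A x $$ (i, p i)))"
    using det_def'[OF A] by simp
  moreover have "C_k k n U (\<lambda>x. \<Sum>p\<in>{p. p permutes {0..<m}}. signof p * (\<Prod>i\<in>{0..<m}. A x $$ (i, p i)))"
  proof (intro C_k_sum[OF U] C_k_mult[OF U] C_k_const C_k_prod[OF U])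
    fix p i assume "p \<in> {p. p permutes {0..<m}}" "i \<in> {0..<m}"
    then show "C_k k n U (\<lambda>x. A x $$ (i, p i))"
      using permutes_in_image[of p "{0..<m}" i] by (intro C) auto
  qed
  ultimately show ?thesis by simp
qed

text \<open>Surjectivity at \<open>x0\<close> gives a right inverse matrix, so the determinant is
  nonzero there by multiplicativity, and on a neighbourhood by continuity. On that neighbourhood
  Cramer's rule expresses the inverse by cofactors and the reciprocal determinant, which are smooth
  in the entries.\<close>

lemma smooth_matrix_inverse:
  fixes a :: "nat \<Rightarrow> nat \<Rightarrow> rvec \<Rightarrow> real"
  assumes U: "openin (Euclidean_space n) U" and x0: "x0 \<in> U"
    and a: "\<And>i j k. i < n \<Longrightarrow> j < n \<Longrightarrow> C_k k n U (a i j)"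
    and surj: "\<And>v. v \<in> Rn n \<Longrightarrow> \<exists>w. \<forall>i<n. (\<Sum>j<n. a i j x0 * w j) = v i"
  shows "\<exists>U' b. openin (Euclidean_space n) U' \<and> x0 \<in> U' \<and> U' \<subseteq> U \<and>
    (\<forall>i<n. \<forall>j<n. (\<forall>k. C_k k n U' (b i j)) \<and>
      (\<forall>x\<in>U'. (\<Sum>l<n. a i l x * b l j x) = (if i = j then 1 else 0) \<and>
             (\<Sum>l<n. b i l x * a l j x) = (if i = j then 1 else 0)))"
proof -
  define A where "A x = mat n n (\<lambda>(i, j). a i j x)" for x
  have Ac: "A x \<in> carrier_mat n n" for x by (simp add: A_def)
  have "\<exists>w. \<forall>i<n. (\<Sum>j<n. a i j x0 * w j) = (if i = l then 1 else 0)" if "l < n" for l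
    using surj[of "\<lambda>i. if i = l then 1 else 0"] that by (auto simp: topspace_Euclidean_space)
  then obtain w where w: "\<And>i l. l < n \<Longrightarrow> i < n \<Longrightarrow> (\<Sum>j<n. a i j x0 * w l j) = (if i = l then 1 else 0)"
    by metis
  define C where "C = mat n n (\<lambda>(j, l). w l j)"
  have Cc: "C \<in> carrier_mat n n" by (simp add: C_def)
  have "A x0 * C = 1\<^sub>m n"
    by (rule eq_matI) (use w in \<open>auto simp: A_def C_def scalar_prod_def lessThan_atLeast0\<close>)
  then have "det (A x0) * det C = 1"
    using det_mult[OF Ac Cc, of x0] by simp
  then have d0: "det (A x0) \<noteq> 0" by auto
  have entry: "C_k k n U (\<lambda>x. A x $$ (i, j))" if "i < n" "j < n" for i j k
    using a[OF that] that by (simp add: A_def)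
  have det: "C_k k n U (\<lambda>x. det (A x))" for k
    by (rule C_k_det[OF U Ac entry])
  define U' where "U' = {x \<in> U. det (A x) \<in> - {0}}"
  have U': "openin (Euclidean_space n) U'"
    unfolding U'_def by (rule openin_preimage_open[OF U C_k_continuous[OF det[of 0]]]) auto
  have sub: "U' \<subseteq> U" by (auto simp: U'_def)
  define b where "b i j x = inverse (det (A x)) * cofactor (A x) j i" for i j x
  have res: "C_k k n U f \<Longrightarrow> C_k k n U' f" for k f
    using sub by (induction k arbitrary: f) (auto intro: continuous_map_from_subtopology_mono)
  have "C_k k n U' (b i j)" if ij: "i < n" "j < n" for i j k
  proof -
    have "C_k k n U (\<lambda>x. det (mat_delete (A x) j i))"
    proof (rule C_k_det[OF U, where m = "n - 1"])
      show "mat_delete (A x) j i \<in> carrier_mat (n - 1) (n - 1)" for x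
        using Ac by (rule mat_delete_carrier)
      show "C_k k n U (\<lambda>x. mat_delete (A x) j i $$ (i', j'))" if "i' < n - 1" "j' < n - 1" for i' j'
      proof -
        have "(\<lambda>x. mat_delete (A x) j i $$ (i', j')) =
            (\<lambda>x. A x $$ (if i' < j then i' else Suc i', if j' < i then j' else Suc j'))"
          using that Ac by (auto simp: mat_delete_def A_def)
        then show ?thesis using entry that by simp
      qed
    qed
    then have "C_k k n U (\<lambda>x. (-1) ^ (j + i) * det (mat_delete (A x) j i))"
      by (rule C_k_mult[OF U C_k_const])
    then have "C_k k n U' (\<lambda>x. cofactor (A x) j i)"
      unfolding cofactor_def by (rule res)
    moreover have "C_k k n U' (\<lambda>x. inverse (det (A x)))"
      by (rule C_k_inverse[OF U' _ res[OF det]]) (simp add: U'_def)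
    ultimately show ?thesis
      unfolding b_def[abs_def] by (intro C_k_mult[OF U'])
  qed
  moreover have "(\<Sum>l<n. a i l x * b l j x) = (if i = j then 1 else 0)"
    if x: "x \<in> U'" and ij: "i < n" "j < n" for x i j
  proof -
    have "(A x * adj_mat (A x)) $$ (i, j) = (det (A x) \<cdot>\<^sub>m 1\<^sub>m n) $$ (i, j)"
      using adj_mat(2)[OF Ac] by simp
    then have "(\<Sum>l<n. a i l x * cofactor (A x) j l) = (if i = j then det (A x) else 0)"
      using ij Ac[of x] by (simp add: scalar_prod_def adj_mat_def A_def lessThan_atLeast0)
    then have "inverse (det (A x)) * (\<Sum>l<n. a i l x * cofactor (A x) j l) = (if i = j then 1 else 0)"
      using x by (simp add: U'_def)
    then show ?thesis by (simp add: b_def sum_distrib_left mult_ac)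
  qed
  moreover have "(\<Sum>l<n. b i l x * a l j x) = (if i = j then 1 else 0)"
    if x: "x \<in> U'" and ij: "i < n" "j < n" for x i j
  proof -
    have "(adj_mat (A x) * A x) $$ (i, j) = (det (A x) \<cdot>\<^sub>m 1\<^sub>m n) $$ (i, j)"
      using adj_mat(3)[OF Ac] by simp
    then have "(\<Sum>l<n. cofactor (A x) l i * a l j x) = (if i = j then det (A x) else 0)"
      using ij Ac[of x] by (simp add: scalar_prod_def adj_mat_def A_def lessThan_atLeast0)
    then have "inverse (det (A x)) * (\<Sum>l<n. cofactor (A x) l i * a l j x) = (if i = j then 1 else 0)"
      using x by (simp add: U'_def)
    then show ?thesis by (simp add: b_def sum_distrib_left mult_ac)
  qed
  ultimately show ?thesis
    using U' x0 d0 sub by (intro exI[of _ U'] exI[of _ b]) (auto simp: U'_def)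
qed

lemma strict_differentiability_vec:
  fixes f :: "rvec \<Rightarrow> rvec"
  assumes U: "openin (Euclidean_space n) U" and f: "\<forall>j<m. C_k (Suc k) n U (\<lambda>x. f x j)"
    and x: "x \<in> U" and e: "e > 0"
  shows "\<exists>d>0. cube n x d \<subseteq> U \<and> (\<forall>j<m. \<forall>y \<in> cube n x d. \<forall>z \<in> cube n x d.
       \<bar>f y j - f z j - (\<Sum>i<n. (y i - z i) * partial_deriv i (\<lambda>x. f x j) x)\<bar> \<le> e * (\<Sum>i<n. \<bar>y i - z i\<bar>))"
proof -
  define P where "P j d \<longleftrightarrow> cube n x d \<subseteq> U \<and> (\<forall>y \<in> cube n x d. \<forall>z \<in> cube n x d.
       \<bar>f y j - f z j - (\<Sum>i<n. (y i - z i) * partial_deriv i (\<lambda>x. f x j) x)\<bar> \<le> e * (\<Sum>i<n. \<bar>y i - z i\<bar>))" for j d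
  have "\<exists>d>0. P j d" if "j < m" for j
    unfolding P_def by (rule strict_differentiability[OF U f[rule_format, OF that] x e])
  then obtain D where D: "\<And>j. j < m \<Longrightarrow> D j > 0" "\<And>j. j < m \<Longrightarrow> P j (D j)" by metis
  obtain d0 where d0: "d0 > 0" "cube n x d0 \<subseteq> U" using cube_in_openin[OF U x] .
  define d where "d = Min (insert d0 (D ` {..<m}))"
  have d: "d > 0" "d \<le> d0" "\<And>j. j < m \<Longrightarrow> d \<le> D j"
    using D(1) d0(1) by (simp_all add: d_def)
  have "cube n x d \<subseteq> U" using d0 cube_mono[OF d(2)] by blast
  moreover have "\<bar>f y j - f z j - (\<Sum>i<n. (y i - z i) * partial_deriv i (\<lambda>x. f x j) x)\<bar> \<le> e * (\<Sum>i<n. \<bar>y i - z i\<bar>)"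
    if "j < m" "y \<in> cube n x d" "z \<in> cube n x d" for j y z
  proof -
    have "y \<in> cube n x (D j)" "z \<in> cube n x (D j)" using cube_mono[OF d(3)[OF that(1)]] that by blast+
    then show ?thesis using D(2)[OF that(1)] by (simp add: P_def)
  qed
  ultimately show ?thesis using d(1) by blast
qed

lemma compactin_closed_cube:
  assumes "x \<in> Rn n"
  shows "compactin (Euclidean_space n) {y \<in> Rn n. \<forall>i<n. \<bar>y i - x i\<bar> \<le> r}"
proof -
  \<comment> \<open>With the factor \<open>{0}\<close> from index \<open>n\<close> on, the closed
    cube is a full product of compact sets, and Tychonoff's theorem applies.\<close>
  have "{y \<in> Rn n. \<forall>i<n. \<bar>y i - x i\<bar> \<le> r} = PiE UNIV (\<lambda>i. if i < n then {x i - r..x i + r} else {0})"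
    by (auto simp: topspace_Euclidean_space PiE_iff abs_le_iff split: if_splits)
       (smt (verit) atLeastAtMost_iff singletonD)+
  moreover have "compactin (powertop_real UNIV) (PiE UNIV (\<lambda>i. if i < n then {x i - r..x i + r} else {0}))"
    by (simp add: compactin_PiE)
  ultimately show ?thesis
    by (auto simp: Euclidean_space_def compactin_subtopology)
qed

text \<open>Let \<open>L\<close> invert the derivative at \<open>x0\<close> and \<open>N\<close> be the \<open>l\<^sup>1\<close> norm. A preimage of \<open>y\<close> is found by
  minimising \<open>N (L (f z - y))\<close> over a closed cube: at a minimiser it must vanish, because moving \<open>z\<close>
  slightly in the direction \<open>- L (f z - y)\<close> decreases it.\<close>

theorem inverse_function:
  assumes U: "openin (Euclidean_space n) U" and f: "smooth_map n U n V f" and x0: "x0 \<in> U"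
    and surj: "\<And>v. v \<in> Rn n \<Longrightarrow> \<exists>w. jacobian n f x0 w = v"
  shows "\<exists>W S g. openin (Euclidean_space n) W \<and> x0 \<in> W \<and> W \<subseteq> U \<and> openin (Euclidean_space n) S \<and>
    f \<in> W \<rightarrow> S \<and> smooth_map n S n W g \<and> (\<forall>x\<in>W. g (f x) = x) \<and> (\<forall>y\<in>S. f (g y) = y)"
proof -
  have fC: "C_k k n U (\<lambda>x. f x j)" if "j < n" for j k
    using f that unfolding smooth_map_def smooth_fun_def by blast
  have fR: "f x \<in> Rn n" if "x \<in> U" for x
    using f that unfolding smooth_map_def by blast
  have UR: "U \<subseteq> Rn n" using U openin_subset by blast
  define a where "a j i x = partial_deriv i (\<lambda>x. f x j) x" for j i x
  have aC: "C_k k n U (a j i)" if "j < n" "i < n" for j i k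
    using fC[OF that(1), of "Suc k"] that(2) unfolding a_def[abs_def] C_k.simps by blast
  have surj': "\<exists>w. \<forall>i<n. (\<Sum>j<n. a i j x0 * w j) = v i" if v: "v \<in> Rn n" for v
  proof -
    obtain w where "jacobian n f x0 w = v" using surj[OF v] ..
    then have "\<forall>i. (\<Sum>j<n. a i j x0 * w j) = v i" by (auto simp: jacobian_def a_def mult.commute)
    then show ?thesis by blast
  qed
  have ex: "\<exists>U1 b. openin (Euclidean_space n) U1 \<and> x0 \<in> U1 \<and> U1 \<subseteq> U \<and>
    (\<forall>i<n. \<forall>j<n. (\<forall>k. C_k k n U1 (b i j)) \<and>
      (\<forall>x\<in>U1. (\<Sum>l<n. a i l x * b l j x) = (if i = j then 1 else 0) \<and>
             (\<Sum>l<n. b i l x * a l j x) = (if i = j then 1 else 0)))"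
    by (rule smooth_matrix_inverse[OF U x0 aC surj'])
  obtain U1 b where U1: "openin (Euclidean_space n) U1" "x0 \<in> U1" "U1 \<subseteq> U"
    and b: "\<forall>i<n. \<forall>j<n. (\<forall>k. C_k k n U1 (b i j)) \<and>
      (\<forall>x\<in>U1. (\<Sum>l<n. a i l x * b l j x) = (if i = j then 1 else 0) \<and>
             (\<Sum>l<n. b i l x * a l j x) = (if i = j then 1 else 0))"
    using ex by (elim exE conjE)
  have bC: "C_k k n U1 (b i j)" if "i < n" "j < n" for i j k
    using b that by blast
  have ab: "(\<Sum>l<n. a i l x * b l j x) = (if i = j then 1 else 0)"
    and ba: "(\<Sum>l<n. b i l x * a l j x) = (if i = j then 1 else 0)"
    if "x \<in> U1" "i < n" "j < n" for x i j
    using b that by blast+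
  have fC1: "C_k k n U1 (\<lambda>x. f x j)" if "j < n" for j k
  proof -
    have "smooth_map n U1 n V f"
      by (rule smooth_map_subset[OF f]) (use f U1(3) in \<open>auto simp: smooth_map_def\<close>)
    then show ?thesis using that unfolding smooth_map_def smooth_fun_def by blast
  qed
  then have fC1': "\<forall>j<n. C_k (Suc 0) n U1 (\<lambda>x. f x j)" by blast
  define N where "N v = (\<Sum>i<n. \<bar>v i\<bar>)" for v :: rvec
  have N0: "N v \<ge> 0" for v by (simp add: N_def sum_nonneg)
  have Ncomp: "\<bar>v i\<bar> \<le> N v" if "i < n" for v i
    unfolding N_def using that by (intro member_le_sum[of i "{..<n}" "\<lambda>i. \<bar>v i\<bar>"]) auto
  have Ntri: "N (\<lambda>i. u i + v i) \<le> N u + N v" for u v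
    unfolding N_def sum.distrib[symmetric] by (intro sum_mono) auto
  have Ncong: "(\<And>i. i < n \<Longrightarrow> u i = v i) \<Longrightarrow> N u = N v" for u v
    unfolding N_def by (intro sum.cong) auto
  have Nscale: "N (\<lambda>i. s * v i) = \<bar>s\<bar> * N v" for s v
    by (simp add: N_def sum_distrib_left abs_mult)
  define L where "L v = (\<lambda>i. \<Sum>j<n. b i j x0 * v j)" for v
  define B where "B = (\<Sum>i<n. \<Sum>j<n. \<bar>b i j x0\<bar>)"
  have B0: "B \<ge> 0" by (auto simp: B_def intro: sum_nonneg)
  have LB: "N (L v) \<le> B * M" if "\<And>j. j < n \<Longrightarrow> \<bar>v j\<bar> \<le> M" for v M
  proof -
    have "\<bar>L v i\<bar> \<le> (\<Sum>j<n. \<bar>b i j x0\<bar> * M)" for i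
      unfolding L_def by (rule order_trans[OF sum_abs sum_mono]) (use that in \<open>auto simp: abs_mult mult_left_mono\<close>)
    then have "N (L v) \<le> (\<Sum>i<n. \<Sum>j<n. \<bar>b i j x0\<bar> * M)"
      unfolding N_def by (intro sum_mono)
    then show ?thesis by (simp add: B_def sum_distrib_right)
  qed
  have Ladd: "L (\<lambda>j. u j + v j) i = L u i + L v i" for u v i
    by (simp add: L_def sum.distrib distrib_left)
  \<comment> \<open>\<open>B\<close> bounds \<open>L\<close> from the maximum norm to
    \<open>N\<close>. This tolerance gives \<open>B * \<epsilon> \<le> 1/2\<close>; the summand 1
    avoids division by zero.\<close>
  define \<epsilon> where "\<epsilon> = 1 / (2 * (B + 1))"
  have \<epsilon>: "\<epsilon> > 0" "B * \<epsilon> \<le> 1/2" using B0 by (auto simp: \<epsilon>_def field_simps)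
  obtain d where d: "d > 0" "cube n x0 d \<subseteq> U1"
    and strict: "\<forall>j<n. \<forall>y \<in> cube n x0 d. \<forall>z \<in> cube n x0 d.
       \<bar>f y j - f z j - (\<Sum>i<n. (y i - z i) * partial_deriv i (\<lambda>x. f x j) x0)\<bar> \<le> \<epsilon> * (\<Sum>i<n. \<bar>y i - z i\<bar>)"
    using strict_differentiability_vec[OF U1(1) fC1' U1(2) \<epsilon>(1)] by (elim exE conjE)
  \<comment> \<open>On the cube, \<open>L \<circ> f\<close> minus the identity is Lipschitz with
    constant one half for \<open>N\<close>.\<close>
  have near: "N (\<lambda>i. L (\<lambda>j. f y j - f z j) i - (y i - z i)) \<le> 1/2 * N (\<lambda>i. y i - z i)"
    if y: "y \<in> cube n x0 d" and z: "z \<in> cube n x0 d" for y z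
  proof -
    define R where "R j = f y j - f z j - (\<Sum>l<n. a j l x0 * (y l - z l))" for j
    have "L (\<lambda>j. f y j - f z j) i - (y i - z i) = L R i" if i: "i < n" for i
    proof -
      have "(\<Sum>j<n. b i j x0 * (\<Sum>l<n. a j l x0 * (y l - z l))) = (\<Sum>l<n. (\<Sum>j<n. b i j x0 * a j l x0) * (y l - z l))"
        unfolding sum_distrib_left sum_distrib_right by (subst sum.swap) (simp add: mult.assoc)
      also have "\<dots> = (\<Sum>l<n. if i = l then y l - z l else 0)"
        using ba[OF U1(2) i] by (intro sum.cong) auto
      also have "\<dots> = y i - z i" using i by simp
      finally have e: "(\<Sum>j<n. b i j x0 * (\<Sum>l<n. a j l x0 * (y l - z l))) = y i - z i" .
      have "L R i = (\<Sum>j<n. b i j x0 * (f y j - f z j) - b i j x0 * (\<Sum>l<n. a j l x0 * (y l - z l)))"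
        unfolding L_def R_def by (intro sum.cong refl right_diff_distrib)
      then show ?thesis by (simp only: sum_subtractf e) (simp only: L_def)
    qed
    then have "N (\<lambda>i. L (\<lambda>j. f y j - f z j) i - (y i - z i)) = N (L R)" by (intro Ncong)
    also have "\<dots> \<le> B * (\<epsilon> * N (\<lambda>i. y i - z i))"
      using strict y z by (intro LB) (simp add: R_def N_def a_def mult.commute)
    also have "\<dots> \<le> 1/2 * N (\<lambda>i. y i - z i)"
      using mult_right_mono[OF \<epsilon>(2) N0[of "\<lambda>i. y i - z i"]] by (simp add: mult.assoc)
    finally show ?thesis .
  qed
  \<comment> \<open>The reverse triangle inequality applied to \<open>near\<close>. It yields
    injectivity on the cube and, with \<open>LB\<close>, the Lipschitz bound for the
    inverse.\<close>
  have low: "N (\<lambda>i. y i - z i) \<le> 2 * N (L (\<lambda>j. f y j - f z j))"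
    if y: "y \<in> cube n x0 d" and z: "z \<in> cube n x0 d" for y z
  proof -
    have "N (\<lambda>i. y i - z i) = N (\<lambda>i. L (\<lambda>j. f y j - f z j) i + (-1) * (L (\<lambda>j. f y j - f z j) i - (y i - z i)))"
      by (intro Ncong) simp
    also have "\<dots> \<le> N (L (\<lambda>j. f y j - f z j)) + \<bar>-1\<bar> * N (\<lambda>i. L (\<lambda>j. f y j - f z j) i - (y i - z i))"
      by (rule order_trans[OF Ntri]) (simp only: Nscale order_refl)
    also have "\<dots> \<le> N (L (\<lambda>j. f y j - f z j)) + 1/2 * N (\<lambda>i. y i - z i)" using near[OF y z] by simp
    finally show ?thesis by simp
  qed
  have low': "N (\<lambda>i. y i - z i) \<le> 2 * B * N (\<lambda>j. f y j - f z j)"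
    if y: "y \<in> cube n x0 d" and z: "z \<in> cube n x0 d" for y z
    using low[OF y z] LB[of "\<lambda>j. f y j - f z j" "N (\<lambda>j. f y j - f z j)", OF Ncomp] by simp
  have inj: "y = z" if y: "y \<in> cube n x0 d" and z: "z \<in> cube n x0 d" and eq: "f y = f z" for y z
  proof
    have "N (\<lambda>i. y i - z i) \<le> 0" using low'[OF y z] eq by (simp add: N_def)
    then have "\<bar>y i - z i\<bar> \<le> 0" if "i < n" for i using Ncomp[OF that, of "\<lambda>i. y i - z i"] by simp
    then show "y i = z i" for i
      using y z by (cases "i < n") (auto simp: cube_def topspace_Euclidean_space)
  qed
  have contN: "continuous_map (subtopology (Euclidean_space n) U') euclideanreal (\<lambda>y. N (L (\<lambda>j. h y j - c j)))"
    if U': "openin (Euclidean_space n) U'" and h: "\<And>j. j < n \<Longrightarrow> C_k 0 n U' (\<lambda>y. h y j)" for h c U'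
  proof -
    have "C_k 0 n U' (\<lambda>y. L (\<lambda>j. h y j - c j) i)" for i
      unfolding L_def diff_conv_add_uminus
      by (intro C_k_sum[OF U'] C_k_mult[OF U'] C_k_const C_k_add[OF U'] h) simp
    then show ?thesis unfolding N_def by (intro continuous_map_sum continuous_map_real_abs) auto
  qed
  \<comment> \<open>The threshold \<open>d/8\<close> forces minimisers into the interior: at a
    minimiser \<open>m\<close> the value is below \<open>d/8\<close> too, so
    \<open>N (L (\<lambda>j. f m j - f x0 j)) < d/4\<close>, and \<open>low\<close> gives distance
    below \<open>d/2\<close> from \<open>x0\<close>.\<close>
  define S where "S = {y \<in> Rn n. N (L (\<lambda>j. y j - f x0 j)) \<in> {..<d/8}}"
  have Sop: "openin (Euclidean_space n) S"
    unfolding S_def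
    by (rule openin_preimage_open[OF openin_topspace contN[OF openin_topspace]]) (auto simp: continuous_map_coord)
  define W where "W = {x \<in> cube n x0 d. f x \<in> S}"
  have fcont: "continuous_map (subtopology (Euclidean_space n) (cube n x0 d)) (Euclidean_space n) f"
    using smooth_map_continuous[OF f] d(2) U1(3) by (meson continuous_map_from_subtopology_mono subset_trans)
  have Wop: "openin (Euclidean_space n) W"
    unfolding W_def by (rule openin_preimage_open[OF openin_cube fcont Sop])
  have L0: "L (\<lambda>j. 0) i = 0" for i by (simp add: L_def)
  have x0c: "x0 \<in> cube n x0 d" using d(1) x0 UR by (intro cube_self) auto
  have x0W: "x0 \<in> W"
    using x0c d(1) fR[OF x0] by (simp add: W_def S_def L0 N_def)
  have WU: "W \<subseteq> U1" using d(2) by (auto simp: W_def)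
  have onto: "\<exists>x\<in>W. f x = y" if y: "y \<in> S" for y
  proof -
    define Q where "Q = {z \<in> Rn n. \<forall>i<n. \<bar>z i - x0 i\<bar> \<le> d/2}"
    have Qc: "Q \<subseteq> cube n x0 d" using d(1) by (auto simp: Q_def cube_def)
    define \<phi> where "\<phi> z = N (L (\<lambda>j. f z j - y j))" for z
    have "compactin (Euclidean_space n) Q"
      unfolding Q_def using x0 UR by (intro compactin_closed_cube) auto
    then have "compactin (subtopology (Euclidean_space n) U) Q"
      using Qc d(2) U1(3) by (auto simp: compactin_subtopology)
    moreover have "continuous_map (subtopology (Euclidean_space n) U) euclideanreal \<phi>"
      unfolding \<phi>_def[abs_def] by (rule contN[OF U fC])
    ultimately have "compact (\<phi> ` Q)"
      using image_compactin[of _ Q euclideanreal \<phi>] by simp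
    moreover have x0Q: "x0 \<in> Q" using x0 UR d(1) by (auto simp: Q_def)
    ultimately obtain m where m: "m \<in> Q" "\<And>z. z \<in> Q \<Longrightarrow> \<phi> m \<le> \<phi> z"
      using compact_attains_inf[of "\<phi> ` Q"] by (auto simp: image_iff)
    have mc: "m \<in> cube n x0 d" using m Qc by blast
    have yR: "y \<in> Rn n" using y by (simp add: S_def)
    have yx0: "N (L (\<lambda>j. y j - f x0 j)) < d/8" using y by (simp add: S_def)
    have Lneg: "L (\<lambda>j. u j - v j) i = (-1) * L (\<lambda>j. v j - u j) i" for u v i
      by (simp add: L_def sum_negf[symmetric] algebra_simps)
    have "\<phi> x0 = N (L (\<lambda>j. y j - f x0 j))"
      unfolding \<phi>_def N_def by (simp add: Lneg[of "f x0" y])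
    then have m8: "\<phi> m < d/8" using m(2)[OF x0Q] yx0 by simp
    have "L (\<lambda>j. f m j - f x0 j) i = L (\<lambda>j. f m j - y j) i + L (\<lambda>j. y j - f x0 j) i" for i
      using Ladd[of "\<lambda>j. f m j - y j" "\<lambda>j. y j - f x0 j" i] by simp
    then have "N (L (\<lambda>j. f m j - f x0 j)) = N (\<lambda>i. L (\<lambda>j. f m j - y j) i + L (\<lambda>j. y j - f x0 j) i)"
      by (intro Ncong) simp
    then have "N (L (\<lambda>j. f m j - f x0 j)) \<le> \<phi> m + N (L (\<lambda>j. y j - f x0 j))"
      using Ntri by (simp add: \<phi>_def)
    then have mx0: "N (\<lambda>i. m i - x0 i) < d/2" using low[OF mc x0c] m8 yx0 by simp
    have "\<phi> m = 0"
    proof (rule ccontr)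
      assume "\<phi> m \<noteq> 0"
      then have pos: "\<phi> m > 0" using N0 by (simp add: \<phi>_def order_less_le)
      \<comment> \<open>This is a Newton step with the derivative frozen at \<open>x0\<close>, cut
        off at \<open>n\<close> so that the moved point stays in \<open>Rn n\<close>.\<close>
      define u where "u i = (if i < n then - L (\<lambda>j. f m j - y j) i else 0)" for i
      have Nu: "N u = \<phi> m" unfolding \<phi>_def N_def u_def by (intro sum.cong) auto
      \<comment> \<open>The largest fraction, at most 1, of the step for which the triangle
        inequality still keeps the point in \<open>Q\<close>. It is positive because
        \<open>mx0\<close> is strict.\<close>
      define s where "s = min 1 ((d/2 - N (\<lambda>i. m i - x0 i)) / \<phi> m)"
      have s: "s > 0" "s \<le> 1" using pos mx0 by (auto simp: s_def)
      have s\<phi>: "s * \<phi> m \<le> d/2 - N (\<lambda>i. m i - x0 i)"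
        using pos by (simp add: s_def min_def field_simps)
      define m' where "m' = (\<lambda>i. m i + s * u i)"
      have "N (\<lambda>i. m' i - x0 i) = N (\<lambda>i. (m i - x0 i) + s * u i)" by (simp add: m'_def algebra_simps)
      also have "\<dots> \<le> N (\<lambda>i. m i - x0 i) + \<bar>s\<bar> * N u" by (rule order_trans[OF Ntri]) (simp only: Nscale order_refl)
      also have "\<dots> \<le> d/2" using s\<phi> s Nu by simp
      finally have "\<bar>m' i - x0 i\<bar> \<le> d/2" if "i < n" for i
        using Ncomp[OF that, of "\<lambda>i. m' i - x0 i"] by simp
      moreover have "m' \<in> Rn n" using m(1) by (auto simp: m'_def u_def Q_def topspace_Euclidean_space)
      ultimately have m'Q: "m' \<in> Q" by (simp add: Q_def)
      then have m'c: "m' \<in> cube n x0 d" using Qc by blast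
      \<comment> \<open>The step removes the fraction \<open>s\<close> of the residual, up to an
        error that \<open>near\<close> bounds by half the length of the step. The residual thus
        shrinks at least by the factor \<open>1 - s/2\<close>.\<close>
      have "L (\<lambda>j. f m' j - y j) i = (L (\<lambda>j. f m' j - f m j) i - (m' i - m i)) + (1 - s) * (- u i)"
        if "i < n" for i
        using Ladd[of "\<lambda>j. f m' j - f m j" "\<lambda>j. f m j - y j" i] that by (simp add: m'_def u_def algebra_simps)
      then have "\<phi> m' = N (\<lambda>i. (L (\<lambda>j. f m' j - f m j) i - (m' i - m i)) + (1 - s) * (- u i))"
        unfolding \<phi>_def by (intro Ncong)
      also have "\<dots> \<le> N (\<lambda>i. L (\<lambda>j. f m' j - f m j) i - (m' i - m i)) + \<bar>1 - s\<bar> * N (\<lambda>i. - u i)"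
        by (rule order_trans[OF Ntri]) (simp only: Nscale order_refl)
      also have "\<dots> \<le> 1/2 * N (\<lambda>i. m' i - m i) + (1 - s) * N u"
        using near[OF m'c mc] s by (simp add: N_def)
      also have "N (\<lambda>i. m' i - m i) = s * N u" using Nscale[of s u] s by (simp add: m'_def)
      also have "1/2 * (s * N u) + (1 - s) * N u = (1 - s/2) * \<phi> m" by (simp add: Nu algebra_simps)
      also have "\<dots> < \<phi> m" using s pos by simp
      finally show False using m(2)[OF m'Q] by simp
    qed
    then have L0: "L (\<lambda>j. f m j - y j) i = 0" if "i < n" for i
      using Ncomp[OF that, of "L (\<lambda>j. f m j - y j)"] by (simp add: \<phi>_def)
    have "f m = y"
    proof
      fix i
      show "f m i = y i"
      proof (cases "i < n")
        case True
        have "f m i - y i = (\<Sum>j<n. if i = j then f m j - y j else 0)" using True by simp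
        \<comment> \<open>The identity matrix is written as the Jacobian times its inverse, which
          exposes the vanishing vector \<open>L (\<lambda>j. f m j - y j)\<close>.\<close>
        also have "\<dots> = (\<Sum>j<n. (\<Sum>l<n. a i l x0 * b l j x0) * (f m j - y j))"
          using ab[OF U1(2) True] by (intro sum.cong) auto
        also have "\<dots> = (\<Sum>l<n. a i l x0 * L (\<lambda>j. f m j - y j) l)"
          unfolding L_def sum_distrib_left sum_distrib_right by (subst sum.swap) (simp add: mult.assoc)
        also have "\<dots> = 0" using L0 by simp
        finally show ?thesis by simp
      next
        case False
        then show ?thesis using fR[of m] yR mc d(2) U1(3) by (auto simp: topspace_Euclidean_space)
      qed
    qed
    then show ?thesis using mc y by (intro bexI[of _ m]) (auto simp: W_def)
  qed
  define g where "g = inv_into W f"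
  have fWS: "f ` W = S" using onto by (auto simp: W_def image_iff)
  have injW: "inj_on f W" using inj by (auto simp: inj_on_def W_def)
  have gW: "g y \<in> W" and fg: "f (g y) = y" if "y \<in> S" for y
    using that fWS by (auto simp: g_def inv_into_into f_inv_into_f)
  have gf: "g (f x) = x" if "x \<in> W" for x using that injW by (simp add: g_def)
  have Lip: "N (\<lambda>i. g y i - g z i) \<le> 2 * B * N (\<lambda>j. y j - z j)" if "y \<in> S" "z \<in> S" for y z
    using low'[of "g y" "g z"] gW[OF that(1)] gW[OF that(2)] fg that by (simp add: W_def)
  have gcont: "continuous_map (subtopology (Euclidean_space n) S) euclideanreal (\<lambda>y. g y j)" if j: "j < n" for j
  proof (rule continuous_map_cubeI[OF Sop])
    fix y and e :: real assume y: "y \<in> S" and e: "e > 0"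
    define r where "r = e / (2 * B * n + 1)"
    have r: "r > 0" using e B0 by (auto simp: r_def intro!: divide_pos_pos add_nonneg_pos)
    have "\<bar>g z j - g y j\<bar> < e" if z: "z \<in> cube n y r \<inter> S" for z
    proof -
      have "N (\<lambda>j. z j - y j) \<le> (\<Sum>i<n. r)"
        unfolding N_def using z by (intro sum_mono) (auto simp: cube_def less_imp_le)
      then have "2 * B * N (\<lambda>j. z j - y j) \<le> 2 * B * (n * r)" using B0 by (intro mult_left_mono) auto
      then have "\<bar>g z j - g y j\<bar> \<le> 2 * B * n * r"
        using Lip[of z y] z y Ncomp[OF j, of "\<lambda>i. g z i - g y i"] by (simp add: mult.assoc)
      also have "\<dots> < (2 * B * n + 1) * r" using r by simp
      also have "\<dots> = e" using B0 by (simp add: r_def add_nonneg_eq_0_iff)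
      finally show ?thesis .
    qed
    then show "\<exists>d>0. \<forall>z\<in>cube n y d \<inter> S. \<bar>g z j - g y j\<bar> < e" using r by blast
  qed
  have gder: "((\<lambda>t. g (y(i := t)) j) has_real_derivative b j i (g y)) (at (y i))"
    if i: "i < n" and j: "j < n" and y: "y \<in> S" for i j y
  proof -
    \<comment> \<open>With \<open>q = g (y(i := t))\<close>, the increment \<open>f q - f p\<close>
      is \<open>t - y i\<close> in direction \<open>i\<close>. Applying the inverse matrix at
      \<open>p\<close> to the expansion of \<open>f\<close> turns it into an expansion of
      \<open>q - p\<close>, and \<open>Lip\<close> converts the error, small relative to
      \<open>N (\<lambda>l. q l - p l)\<close>, into one small relative to
      \<open>\<bar>t - y i\<bar>\<close>.\<close>
    define p where "p = g y"
    have pW: "p \<in> W" and pU: "p \<in> U1" using gW[OF y] WU by (auto simp: p_def)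
    define K where "K = (\<Sum>l<n. \<bar>b j l p\<bar>)"
    have K0: "K \<ge> 0" by (simp add: K_def sum_nonneg)
    have "\<exists>r>0. \<forall>t. t \<noteq> y i \<and> \<bar>t - y i\<bar> < r \<longrightarrow> \<bar>(g (y(i := t)) j - g y j) / (t - y i) - b j i p\<bar> < e"
      if e: "e > 0" for e :: real
    proof -
      define e' where "e' = e / (2 * B * K + 1)"
      have e': "e' > 0" using e B0 K0 by (auto simp: e'_def intro!: divide_pos_pos add_nonneg_pos)
      obtain r1 where r1: "r1 > 0" "cube n p r1 \<subseteq> U1"
        and sd: "\<forall>l<n. \<forall>u \<in> cube n p r1. \<forall>z \<in> cube n p r1.
          \<bar>f u l - f z l - (\<Sum>i<n. (u i - z i) * partial_deriv i (\<lambda>x. f x l) p)\<bar> \<le> e' * (\<Sum>i<n. \<bar>u i - z i\<bar>)"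
        using strict_differentiability_vec[OF U1(1) fC1' pU e'] by (elim exE conjE)
      obtain r2 where r2: "r2 > 0" "cube n y r2 \<subseteq> S" using cube_in_openin[OF Sop y] .
      \<comment> \<open>The second bound puts \<open>q\<close> within \<open>r1\<close> of
        \<open>p\<close> by \<open>Lip\<close>; the first keeps \<open>y(i := t)\<close> in
        \<open>S\<close>.\<close>
      define r where "r = min r2 (r1 / (2 * B + 1))"
      have r: "r > 0" using r1 r2 B0 by (simp add: r_def)
      have "\<bar>(g (y(i := t)) j - g y j) / (t - y i) - b j i p\<bar> < e" if t: "t \<noteq> y i" "\<bar>t - y i\<bar> < r" for t
      proof -
        define q where "q = g (y(i := t))"
        have yR: "y \<in> Rn n" using y by (simp add: S_def)
        have tS: "y(i := t) \<in> S"
          using cube_upd[OF cube_self[OF yR r2(1)] i, of t] t r2(2) by (auto simp: r_def)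
        have fq: "f q = y(i := t)" "f p = y" using fg tS y by (auto simp: q_def p_def)
        have "N (\<lambda>l. (y(i := t)) l - y l) = (\<Sum>l<n. if l = i then \<bar>t - y i\<bar> else 0)"
          unfolding N_def by (intro sum.cong) auto
        then have "N (\<lambda>l. (y(i := t)) l - y l) = \<bar>t - y i\<bar>" using i by simp
        then have qp: "N (\<lambda>l. q l - p l) \<le> 2 * B * \<bar>t - y i\<bar>"
          using Lip[OF tS y] by (simp add: q_def p_def)
        have "2 * B * \<bar>t - y i\<bar> \<le> (2 * B) * (r1 / (2 * B + 1))"
          using t B0 by (intro mult_left_mono) (auto simp: r_def)
        also have "\<dots> < r1" using r1 B0 by (simp add: field_simps)
        finally have "N (\<lambda>l. q l - p l) < r1" using qp by simp
        then have "\<bar>q l - p l\<bar> < r1" if "l < n" for l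
          using Ncomp[OF that, of "\<lambda>l. q l - p l"] by simp
        moreover have "q \<in> Rn n" "p \<in> Rn n" using gW[OF tS] pW by (auto simp: q_def W_def cube_def)
        ultimately have qc: "q \<in> cube n p r1" "p \<in> cube n p r1" using r1 by (auto simp: cube_def)
        define E where "E l = f q l - f p l - (\<Sum>k<n. a l k p * (q k - p k))" for l
        have E: "\<bar>E l\<bar> \<le> e' * N (\<lambda>l. q l - p l)" if "l < n" for l
          using sd qc that by (simp add: E_def N_def a_def mult.commute)
        have "(\<Sum>l<n. b j l p * (\<Sum>k<n. a l k p * (q k - p k))) = (\<Sum>k<n. (\<Sum>l<n. b j l p * a l k p) * (q k - p k))"
          unfolding sum_distrib_left sum_distrib_right by (subst sum.swap) (simp add: mult.assoc)
        also have "\<dots> = (\<Sum>k<n. if j = k then q k - p k else 0)"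
          using ba[OF pU j] by (intro sum.cong) auto
        also have "\<dots> = q j - p j" using j by simp
        finally have 1: "(\<Sum>l<n. b j l p * (\<Sum>k<n. a l k p * (q k - p k))) = q j - p j" .
        have "(\<Sum>l<n. b j l p * (f q l - f p l)) = (\<Sum>l<n. if l = i then b j i p * (t - y i) else 0)"
          unfolding fq by (intro sum.cong) auto
        then have 2: "(\<Sum>l<n. b j l p * (f q l - f p l)) = b j i p * (t - y i)" using i by simp
        have "(\<Sum>l<n. b j l p * E l) =
            (\<Sum>l<n. b j l p * (f q l - f p l) - b j l p * (\<Sum>k<n. a l k p * (q k - p k)))"
          unfolding E_def by (intro sum.cong refl right_diff_distrib)
        then have "(\<Sum>l<n. b j l p * E l) = b j i p * (t - y i) - (q j - p j)"
          by (simp only: sum_subtractf 1 2)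
        moreover have "\<bar>\<Sum>l<n. b j l p * E l\<bar> \<le> (\<Sum>l<n. \<bar>b j l p\<bar> * (e' * N (\<lambda>l. q l - p l)))"
          by (rule order_trans[OF sum_abs sum_mono]) (use E in \<open>auto simp: abs_mult intro: mult_left_mono\<close>)
        ultimately have "\<bar>b j i p * (t - y i) - (q j - p j)\<bar> \<le> K * (e' * N (\<lambda>l. q l - p l))"
          by (simp add: K_def sum_distrib_right)
        also have "\<dots> \<le> K * (e' * (2 * B * \<bar>t - y i\<bar>))"
          using qp K0 e' by (intro mult_left_mono) auto
        also have "\<dots> = (2 * B * K) * e' * \<bar>t - y i\<bar>" by simp
        also have "\<dots> < (2 * B * K + 1) * e' * \<bar>t - y i\<bar>" using e' t by simp
        also have "(2 * B * K + 1) * e' = e" using B0 K0 by (simp add: e'_def add_nonneg_eq_0_iff)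
        finally have "\<bar>b j i p * (t - y i) - (q j - p j)\<bar> < e * \<bar>t - y i\<bar>" .
        then have "\<bar>(q j - p j) - b j i p * (t - y i)\<bar> / \<bar>t - y i\<bar> < e"
          using t by (simp add: pos_divide_less_eq abs_minus_commute)
        moreover have "(q j - p j) / (t - y i) - b j i p = ((q j - p j) - b j i p * (t - y i)) / (t - y i)"
          using t by (simp add: field_simps)
        ultimately have "\<bar>(q j - p j) / (t - y i) - b j i p\<bar> < e" by (simp add: abs_divide)
        then show ?thesis unfolding q_def p_def .
      qed
      with r show ?thesis by blast
    qed
    then have "((\<lambda>t. (g (y(i := t)) j - g y j) / (t - y i)) \<longlongrightarrow> b j i p) (at (y i))"
      unfolding LIM_eq real_norm_def by blast
    then show ?thesis unfolding has_field_derivative_iff p_def fun_upd_triv .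
  qed
  \<comment> \<open>Bootstrapping: the derivatives of \<open>g\<close> are the smooth functions
    \<open>b j i\<close> composed with \<open>g\<close>, so each order of differentiability of
    \<open>g\<close> gives the next.\<close>
  have gC: "\<forall>j<n. C_k k n S (\<lambda>y. g y j)" for k
  proof (induction k)
    case 0
    then show ?case using gcont by simp
  next
    case (Suc k)
    have gU1: "g \<in> S \<rightarrow> U1" using gW WU by blast
    show ?case
    proof (intro allI impI)
      fix j assume j: "j < n"
      show "C_k (Suc k) n S (\<lambda>y. g y j)"
      proof (rule C_k_SucI[OF Sop gcont[OF j] gder[OF _ j]])
        fix i assume i: "i < n"
        show "C_k k n S (\<lambda>y. b j i (g y))"
          by (rule C_k_compose[OF Sop U1(1) gU1 bC[OF j i]]) (use Suc in blast)
      qed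
    qed
  qed
  have "smooth_map n S n W g"
    unfolding smooth_map_def smooth_fun_def using gC gW Sop Wop openin_subset by blast
  moreover have "f \<in> W \<rightarrow> S" using fWS by blast
  ultimately show ?thesis
    using Wop x0W subset_trans[OF WU U1(3)] Sop gf fg
    by (intro exI[of _ W] exI[of _ S] exI[of _ g] conjI) simp_all
qed

section \<open>Plots and smooth maps\<close>

lemma diffeological_spaceI:
  assumes "\<And>n U p. (n, U, p) \<in> Plots X \<Longrightarrow> openin (Euclidean_space n) U \<and> p \<in> U \<rightarrow>\<^sub>E Pts X"
    and "\<And>n U x. x \<in> Pts X \<Longrightarrow> openin (Euclidean_space n) U \<Longrightarrow> (n, U, \<lambda>_\<in>U. x) \<in> Plots X"
    and "\<And>n U m V q f. openin (Euclidean_space n) U \<Longrightarrow> (m, V, q) \<in> Plots X \<Longrightarrow> smooth_map n U m V f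
        \<Longrightarrow> (n, U, restrict (q \<circ> f) U) \<in> Plots X"
    and "\<And>n U p. openin (Euclidean_space n) U \<Longrightarrow> p \<in> U \<rightarrow>\<^sub>E Pts X \<Longrightarrow>
        (\<And>r. r \<in> U \<Longrightarrow> \<exists>V. openin (Euclidean_space n) V \<and> r \<in> V \<and> V \<subseteq> U \<and> (n, V, restrict p V) \<in> Plots X)
        \<Longrightarrow> (n, U, p) \<in> Plots X"
  shows "diffeological_space X"
  unfolding diffeological_space_def
proof (intro conjI allI ballI impI)
  fix P assume "P \<in> Plots X"
  then show "case P of (n, U, p) \<Rightarrow> openin (Euclidean_space n) U \<and> p \<in> U \<rightarrow>\<^sub>E Pts X"
    using assms(1) by (cases P) auto
next
  show "(n, U, \<lambda>_\<in>U. x) \<in> Plots X" if "x \<in> Pts X" "openin (Euclidean_space n) U" for n U x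
    by (rule assms(2)[OF that])
next
  show "(n, U, restrict (q \<circ> f) U) \<in> Plots X"
    if "openin (Euclidean_space n) U \<and> (m, V, q) \<in> Plots X \<and> smooth_map n U m V f" for n U m V q f
    using that assms(3)[of n U m V q f] by (elim conjE)
next
  show "(n, U, p) \<in> Plots X" if "openin (Euclidean_space n) U \<and> p \<in> U \<rightarrow>\<^sub>E Pts X \<and>
        (\<forall>r\<in>U. \<exists>V. openin (Euclidean_space n) V \<and> r \<in> V \<and> V \<subseteq> U \<and> (n, V, restrict p V) \<in> Plots X)" for n U p
    by (rule assms(4)) (use that in blast)+
qed

lemma plotD:
  assumes "diffeological_space X" "(n, U, p) \<in> Plots X"
  shows plot_domain_open: "openin (Euclidean_space n) U" and plot_funcset: "p \<in> U \<rightarrow>\<^sub>E Pts X"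
  using assms unfolding diffeological_space_def by fast+

lemma plot_in: "diffeological_space X \<Longrightarrow> (n, U, p) \<in> Plots X \<Longrightarrow> r \<in> U \<Longrightarrow> p r \<in> Pts X"
  using plot_funcset by (metis PiE_mem)

lemma plot_extensional: "diffeological_space X \<Longrightarrow> (n, U, p) \<in> Plots X \<Longrightarrow> restrict p U = p"
  using plot_funcset by (metis PiE_restrict)

lemma plot_compose:
  assumes "diffeological_space X" "(m, V, q) \<in> Plots X" "openin (Euclidean_space n) U" "smooth_map n U m V f"
  shows "(n, U, restrict (q \<circ> f) U) \<in> Plots X"
proof -
  have "\<forall>n U m V q f. openin (Euclidean_space n) U \<and> (m, V, q) \<in> Plots X \<and> smooth_map n U m V f
        \<longrightarrow> (n, U, restrict (q \<circ> f) U) \<in> Plots X"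
    using assms(1) unfolding diffeological_space_def by (elim conjE)
  then show ?thesis using assms(2-4) by blast
qed

lemma plot_const:
  assumes "diffeological_space X" "x \<in> Pts X" "openin (Euclidean_space n) U"
  shows "(n, U, \<lambda>_\<in>U. x) \<in> Plots X"
proof -
  have "\<forall>n U. \<forall>x \<in> Pts X. openin (Euclidean_space n) U \<longrightarrow> (n, U, \<lambda>_\<in>U. x) \<in> Plots X"
    using assms(1) unfolding diffeological_space_def by (elim conjE)
  then show ?thesis using assms(2,3) by blast
qed

lemma plot_local:
  assumes "diffeological_space X" "openin (Euclidean_space n) U" "p \<in> U \<rightarrow>\<^sub>E Pts X"
    "\<And>r. r \<in> U \<Longrightarrow> \<exists>V. openin (Euclidean_space n) V \<and> r \<in> V \<and> V \<subseteq> U \<and> (n, V, restrict p V) \<in> Plots X"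
  shows "(n, U, p) \<in> Plots X"
proof -
  have "\<forall>n U p. openin (Euclidean_space n) U \<and> p \<in> U \<rightarrow>\<^sub>E Pts X \<and>
        (\<forall>r\<in>U. \<exists>V. openin (Euclidean_space n) V \<and> r \<in> V \<and> V \<subseteq> U \<and> (n, V, restrict p V) \<in> Plots X)
        \<longrightarrow> (n, U, p) \<in> Plots X"
    using assms(1) unfolding diffeological_space_def by (elim conjE)
  then show ?thesis using assms(2-4) by blast
qed

lemma plot_restrict:
  assumes "diffeological_space X" "(n, U, p) \<in> Plots X" "openin (Euclidean_space n) W" "W \<subseteq> U"
  shows "(n, W, restrict p W) \<in> Plots X"
  using plot_compose[OF assms(1,2,3) smooth_map_id[OF plot_domain_open[OF assms(1,2)] assms(4)]] by simp

lemma restrict_comp_restrict [simp]: "restrict (h \<circ> restrict f U) U = restrict (h \<circ> f) U"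
  by (auto simp: restrict_def)

lemma
  assumes "smooth_between X Y h"
  shows smooth_between_in: "x \<in> Pts X \<Longrightarrow> h x \<in> Pts Y"
    and smooth_between_plot: "(n, U, p) \<in> Plots X \<Longrightarrow> (n, U, restrict (h \<circ> p) U) \<in> Plots Y"
  using assms unfolding smooth_between_def by auto

lemma smooth_between_compose:
  assumes f: "smooth_between X Y f" and g: "smooth_between Y Z g"
  shows "smooth_between X Z (g \<circ> f)"
  unfolding smooth_between_def
proof (intro conjI ballI)
  show "g \<circ> f \<in> Pts X \<rightarrow> Pts Z" using smooth_between_in[OF f] smooth_between_in[OF g] by auto
  fix P assume P: "P \<in> Plots X"
  obtain n U p where [simp]: "P = (n, U, p)" by (cases P)
  have "(n, U, restrict (g \<circ> (f \<circ> p)) U) \<in> Plots Z"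
    using smooth_between_plot[OF g smooth_between_plot[OF f]] P by simp
  then show "case P of (n, U, p) \<Rightarrow> (n, U, restrict (g \<circ> f \<circ> p) U) \<in> Plots Z"
    by (simp add: comp_assoc)
qed

lemma topspace_D_topology:
  assumes X: "diffeological_space X"
  shows "topspace (D_topology X) = Pts X"
proof
  show "topspace (D_topology X) \<subseteq> Pts X"
    using openin_topspace[of "D_topology X"] unfolding openin_D_topology by blast
  have "openin (D_topology X) (Pts X)"
    unfolding openin_D_topology
  proof (intro conjI ballI subset_refl)
    fix P assume P: "P \<in> Plots X"
    obtain m V q where [simp]: "P = (m, V, q)" by (cases P)
    have "{r\<in>V. q r \<in> Pts X} = V" using plot_in[OF X] P by auto
    then show "case P of (n, U, p) \<Rightarrow> openin (Euclidean_space n) {r \<in> U. p r \<in> Pts X}"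
      using plot_domain_open[OF X] P by simp
  qed
  then show "Pts X \<subseteq> topspace (D_topology X)" by (rule openin_subset)
qed

lemma continuous_map_plot:
  assumes "diffeological_space X" "(n, U, p) \<in> Plots X"
  shows "continuous_map (subtopology (Euclidean_space n) U) (D_topology X) p"
proof -
  have U: "openin (Euclidean_space n) U" by (rule plot_domain_open[OF assms])
  have "openin (Euclidean_space n) {r\<in>U. p r \<in> S}" if "openin (D_topology X) S" for S
    using that assms(2) unfolding openin_D_topology by fast
  moreover have "p \<in> U \<rightarrow> topspace (D_topology X)"
    using plot_in[OF assms] by (simp add: topspace_D_topology[OF assms(1)])
  ultimately show ?thesis
    unfolding continuous_map_def
    using U by (auto simp: topspace_subtopology_openin openin_open_subtopology simp del: topspace_subtopology)
qed

lemma openin_plot_preimage: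
  assumes "diffeological_space X" "(n, U, p) \<in> Plots X" "openin (D_topology X) S"
  shows "openin (Euclidean_space n) {r\<in>U. p r \<in> S}"
  by (rule openin_preimage_open[OF plot_domain_open[OF assms(1,2)] continuous_map_plot[OF assms(1,2)] assms(3)])

lemma C_k_local:
  assumes W: "openin (Euclidean_space n) W"
  shows "(\<And>z. z \<in> W \<Longrightarrow> \<exists>V. openin (Euclidean_space n) V \<and> z \<in> V \<and> V \<subseteq> W \<and> C_k k n V f) \<Longrightarrow> C_k k n W f"
proof (induction k arbitrary: f)
  have c: "continuous_map (subtopology (Euclidean_space n) W) euclideanreal f"
    if loc: "\<And>z. z \<in> W \<Longrightarrow> \<exists>V. openin (Euclidean_space n) V \<and> z \<in> V \<and> V \<subseteq> W \<and> C_k k n V f" for k f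
  proof (rule continuous_map_cubeI[OF W])
    fix x e assume x: "x \<in> W" and e: "(e::real) > 0"
    obtain V where V: "openin (Euclidean_space n) V" "x \<in> V" "V \<subseteq> W" "C_k k n V f" using loc[OF x] by blast
    obtain d where "d > 0" "cube n x d \<subseteq> V" "\<And>y. y \<in> cube n x d \<Longrightarrow> \<bar>f y - f x\<bar> < e"
      using continuous_map_cubeD[OF V(1) C_k_continuous[OF V(4)] V(2) e] by blast
    then show "\<exists>d>0. \<forall>y\<in>cube n x d \<inter> W. \<bar>f y - f x\<bar> < e" by blast
  qed
  {
    case 0
    show ?case using c[OF 0] by simp
  next
    case (Suc k)
    show ?case
    proof (rule C_k_SucI[OF W c[OF Suc.prems]])
      show "((\<lambda>t. f (x(i := t))) has_real_derivative partial_deriv i f x) (at (x i))"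
        if "i < n" "x \<in> W" for i x
        using Suc.prems[OF that(2)] has_partial_deriv that(1) by blast
      show "C_k k n W (partial_deriv i f)" if i: "i < n" for i
      proof (rule Suc.IH)
        fix z assume "z \<in> W"
        then obtain V where "openin (Euclidean_space n) V" "z \<in> V" "V \<subseteq> W" "C_k (Suc k) n V f"
          using Suc.prems by blast
        then show "\<exists>V. openin (Euclidean_space n) V \<and> z \<in> V \<and> V \<subseteq> W \<and> C_k k n V (partial_deriv i f)"
          using i unfolding C_k.simps by blast
      qed
    qed
  }
qed

lemma smooth_fun_local:
  assumes "openin (Euclidean_space n) W"
    "\<And>z. z \<in> W \<Longrightarrow> \<exists>V. openin (Euclidean_space n) V \<and> z \<in> V \<and> V \<subseteq> W \<and> smooth_fun n V f"
  shows "smooth_fun n W f"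
  unfolding smooth_fun_def
proof
  fix k show "C_k k n W f"
  proof (rule C_k_local[OF assms(1)])
    fix z assume "z \<in> W"
    then obtain V where "openin (Euclidean_space n) V" "z \<in> V" "V \<subseteq> W" "smooth_fun n V f"
      using assms(2) by blast
    then show "\<exists>V. openin (Euclidean_space n) V \<and> z \<in> V \<and> V \<subseteq> W \<and> C_k k n V f"
      unfolding smooth_fun_def by blast
  qed
qed

lemma smooth_fun_cong:
  assumes "openin (Euclidean_space n) W" "\<And>z. z \<in> W \<Longrightarrow> f z = g z"
  shows "smooth_fun n W f \<longleftrightarrow> smooth_fun n W g"
proof -
  have "C_k k n W f \<longleftrightarrow> C_k k n W g" for k
  proof
    show "C_k k n W g" if "C_k k n W f" by (rule C_k_cong[OF assms(1) that]) (rule assms(2))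
    show "C_k k n W f" if "C_k k n W g" by (rule C_k_cong[OF assms(1) that]) (rule assms(2)[symmetric])
  qed
  then show ?thesis by (simp add: smooth_fun_def)
qed

lemma smooth_fun_component:
  assumes U: "openin (Euclidean_space n) U" and f: "smooth_map n U m V f"
  shows "smooth_fun n U (\<lambda>x. f x j)"
proof (cases "j < m")
  case True
  then show ?thesis using f unfolding smooth_map_def by blast
next
  case False
  have "smooth_fun n U (\<lambda>x. f x j) \<longleftrightarrow> smooth_fun n U (\<lambda>_. 0)"
    by (rule smooth_fun_cong[OF U]) (use f False in \<open>auto simp: smooth_map_def topspace_Euclidean_space\<close>)
  then show ?thesis by (simp add: smooth_fun_def C_k_const)
qed

lemma smooth_map_codomain: "smooth_map n U m V f \<Longrightarrow> V \<subseteq> W \<Longrightarrow> W \<subseteq> Rn m \<Longrightarrow> smooth_map n U m W f"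
  unfolding smooth_map_def by blast

lemma jacobian_cong:
  assumes U: "openin (Euclidean_space n) U" and eq: "\<And>x. x \<in> U \<Longrightarrow> f x = g x" and r: "r \<in> U"
  shows "jacobian n f r v = jacobian n g r v"
proof
  fix j
  have "partial_deriv i (\<lambda>x. f x j) r = partial_deriv i (\<lambda>x. g x j) r" if "i < n" for i
    by (rule partial_deriv_cong(2)[OF U _ r that]) (simp add: eq)
  then show "jacobian n f r v j = jacobian n g r v j" by (simp add: jacobian_def)
qed

lemma jacobian_in_Rn:
  assumes U: "openin (Euclidean_space n) U" and f: "smooth_map n U m V f" and r: "r \<in> U"
  shows "jacobian n f r v \<in> Rn m"
proof -
  have "partial_deriv i (\<lambda>x. f x j) r = 0" if j: "j \<ge> m" and i: "i < n" for i j
  proof -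
    have "partial_deriv i (\<lambda>x. f x j) r = partial_deriv i (\<lambda>x. 0) r"
      by (rule partial_deriv_cong(2)[OF U _ r i]) (use f j in \<open>auto simp: smooth_map_def topspace_Euclidean_space\<close>)
    then show ?thesis by (simp add: partial_deriv_def)
  qed
  then show ?thesis by (simp add: jacobian_def topspace_Euclidean_space)
qed

section \<open>Tangent classes\<close>

lemma mem_pre_tangent_set:
  "((n, U, p), r, vs) \<in> pre_tangent_set k X \<longleftrightarrow>
     (n, U, p) \<in> Plots X \<and> r \<in> U \<and> length vs = k \<and> set vs \<subseteq> Rn n"
  unfolding pre_tangent_set_def by auto

text \<open>The equivalence closure ranges over the whole type of representatives and
  \<open>tangent_step\<close> does not mention \<open>k\<close>. As both directions hold, a chain
  that begins in \<open>pre_tangent_set k X\<close> never leaves it.\<close>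

lemma tangent_step_pre_tangent_set:
  assumes X: "diffeological_space X" and s: "tangent_step X a b"
  shows "a \<in> pre_tangent_set k X \<longleftrightarrow> b \<in> pre_tangent_set k X"
proof -
  obtain n U p m V q f r vs where *: "(n, U, p) \<in> Plots X" "(m, V, q) \<in> Plots X" "smooth_map n U m V f"
    "r \<in> U" "set vs \<subseteq> Rn n" "a = ((n, U, p), r, vs)" "b = ((m, V, q), f r, map (jacobian n f r) vs)"
    using s unfolding tangent_step_def by blast
  have "f r \<in> V" using *(3,4) unfolding smooth_map_def by blast
  moreover have "jacobian n f r v \<in> Rn m" for v
    by (rule jacobian_in_Rn[OF plot_domain_open[OF X *(1)] *(3,4)])
  ultimately show ?thesis using * by (auto simp: mem_pre_tangent_set)
qed

lemma equiv_tangent_rel: "equiv (pre_tangent_set k X) (tangent_rel k X)"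
proof (rule equivI)
  show "tangent_rel k X \<subseteq> pre_tangent_set k X \<times> pre_tangent_set k X" by (auto simp: tangent_rel_def)
  show "refl_on (pre_tangent_set k X) (tangent_rel k X)" by (auto simp: refl_on_def tangent_rel_def)
  show "sym (tangent_rel k X)" by (auto simp: sym_def tangent_rel_def intro: equivclp_sym)
  show "trans (tangent_rel k X)" by (auto simp: trans_def tangent_rel_def intro: equivclp_trans)
qed

text \<open>The source of the well-definedness arguments on tangent classes: a quantity preserved by
  single steps is constant along chains, whatever plots the chain passes through.\<close>

lemma tangent_rel_invariant:
  assumes X: "diffeological_space X" and ab: "(a, b) \<in> tangent_rel k X"
    and F: "\<And>a b. a \<in> pre_tangent_set k X \<Longrightarrow> b \<in> pre_tangent_set k X \<Longrightarrow> tangent_step X a b \<Longrightarrow> F a = F b"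
  shows "F a = F b"
proof -
  have a: "a \<in> pre_tangent_set k X" and "equivclp (tangent_step X) a b"
    using ab by (auto simp: tangent_rel_def)
  from this(2) have "b \<in> pre_tangent_set k X \<and> F a = F b"
  proof (induction rule: equivclp_induct)
    case base
    then show ?case using a by simp
  next
    case (step y z)
    then show ?case using tangent_step_pre_tangent_set[OF X] F by metis
  qed
  then show ?thesis ..
qed

lemma tangent_class_eq_iff:
  assumes "(P, r, vs) \<in> pre_tangent_set k X" "(Q, s, ws) \<in> pre_tangent_set k X"
  shows "tangent_class k X P r vs = tangent_class k X Q s ws \<longleftrightarrow> ((P, r, vs), (Q, s, ws)) \<in> tangent_rel k X"
  unfolding tangent_class_def by (rule eq_equiv_class_iff[OF equiv_tangent_rel assms])

lemma tangent_class_step: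
  assumes X: "diffeological_space X" and a: "(P, r, vs) \<in> pre_tangent_set k X"
    and s: "tangent_step X (P, r, vs) (Q, s, ws)"
  shows "tangent_class k X P r vs = tangent_class k X Q s ws"
proof -
  have b: "(Q, s, ws) \<in> pre_tangent_set k X" using tangent_step_pre_tangent_set[OF X s] a by simp
  show ?thesis unfolding tangent_class_eq_iff[OF a b] using a b s by (auto simp: tangent_rel_def)
qed

lemma tangent_class_invariant:
  assumes "diffeological_space X" "tangent_class k X P r vs = tangent_class k X Q s ws"
    "(P, r, vs) \<in> pre_tangent_set k X" "(Q, s, ws) \<in> pre_tangent_set k X"
    "\<And>a b. a \<in> pre_tangent_set k X \<Longrightarrow> b \<in> pre_tangent_set k X \<Longrightarrow> tangent_step X a b \<Longrightarrow> F a = F b"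
  shows "F (P, r, vs) = F (Q, s, ws)"
  using tangent_rel_invariant[of X "(P, r, vs)" "(Q, s, ws)" k F] assms tangent_class_eq_iff by metis

lemma mem_tangent_class:
  assumes "(P, r, vs) \<in> pre_tangent_set k X"
  shows "x \<in> tangent_class k X P r vs \<longleftrightarrow> ((P, r, vs), x) \<in> tangent_rel k X"
  by (simp add: tangent_class_def)

lemma tangent_class_self:
  "(P, r, vs) \<in> pre_tangent_set k X \<Longrightarrow> (P, r, vs) \<in> tangent_class k X P r vs"
  using equiv_class_self[OF equiv_tangent_rel] by (simp add: tangent_class_def)

lemma tangent_class_compose:
  assumes X: "diffeological_space X" and q: "(m, V, q) \<in> Plots X" and U: "openin (Euclidean_space n) U"
    and f: "smooth_map n U m V f" and r: "r \<in> U" and vs: "set vs \<subseteq> Rn n" "length vs = k"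
  shows "tangent_class k X (n, U, restrict (q \<circ> f) U) r vs =
    tangent_class k X (m, V, q) (f r) (map (jacobian n f r) vs)"
proof (rule tangent_class_step[OF X])
  have p: "(n, U, restrict (q \<circ> f) U) \<in> Plots X" by (rule plot_compose[OF X q U f])
  show "((n, U, restrict (q \<circ> f) U), r, vs) \<in> pre_tangent_set k X"
    using p r vs by (simp add: mem_pre_tangent_set)
  show "tangent_step X ((n, U, restrict (q \<circ> f) U), r, vs) ((m, V, q), f r, map (jacobian n f r) vs)"
    unfolding tangent_step_def using p q f r vs
    by (intro exI[of _ n] exI[of _ U] exI[of _ "restrict (q \<circ> f) U"] exI[of _ m] exI[of _ V] exI[of _ q]
        exI[of _ f] exI[of _ r] exI[of _ vs]) auto
qed

lemma tangent_class_restrict: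
  assumes X: "diffeological_space X" and p: "(n, U, p) \<in> Plots X" and W: "openin (Euclidean_space n) W" "W \<subseteq> U"
    and r: "r \<in> W" and vs: "set vs \<subseteq> Rn n" "length vs = k"
  shows "tangent_class k X (n, W, restrict p W) r vs = tangent_class k X (n, U, p) r vs"
proof -
  have "map (jacobian n id r) vs = vs" using vs jacobian_id by (intro map_idI) blast
  then show ?thesis
    using tangent_class_compose[OF X p W(1) smooth_map_id[OF plot_domain_open[OF X p] W(2)] r vs] by simp
qed

text \<open>Tangent classes depend only on the germ of the plot: both plots restrict to the same
  plot on \<open>W\<close>, and the inclusion of \<open>W\<close> is a step with identity
  Jacobian.\<close>

lemma tangent_class_local_eq:
  assumes X: "diffeological_space X" and p: "(n, U, p) \<in> Plots X" "(n, U', p') \<in> Plots X"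
    and W: "openin (Euclidean_space n) W" "W \<subseteq> U" "W \<subseteq> U'" "\<And>z. z \<in> W \<Longrightarrow> p z = p' z"
    and r: "r \<in> W" and vs: "set vs \<subseteq> Rn n" "length vs = k"
  shows "tangent_class k X (n, U, p) r vs = tangent_class k X (n, U', p') r vs"
proof -
  have "restrict p W = restrict p' W" using W(4) by (auto simp: restrict_def)
  then show ?thesis
    using tangent_class_restrict[OF X p(1) W(1,2) r vs] tangent_class_restrict[OF X p(2) W(1,3) r vs] by simp
qed

lemma Pts_tangent:
  "\<tau> \<in> Pts (tangent k X) \<longleftrightarrow> (\<exists>n U p r vs. (n, U, p) \<in> Plots X \<and> r \<in> U \<and> length vs = k \<and> set vs \<subseteq> Rn n \<and>
     \<tau> = tangent_class k X (n, U, p) r vs)"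
  unfolding tangent_def quotient_diffeology_def pre_tangent_def tangent_class_def
  by (auto simp: quotient_def pre_tangent_set_def)

lemma Pts_T2:
  assumes "\<tau> \<in> Pts (T2 X)"
  obtains n U p r v w where "(n, U, p) \<in> Plots X" "r \<in> U" "v \<in> Rn n" "w \<in> Rn n"
    "\<tau> = tangent_class 2 X (n, U, p) r [v, w]"
proof -
  obtain n U p r vs where *: "(n, U, p) \<in> Plots X" "r \<in> U" "length vs = 2" "set vs \<subseteq> Rn n"
     "\<tau> = tangent_class 2 X (n, U, p) r vs"
    using assms unfolding Pts_tangent by blast
  then obtain v w where "vs = [v, w]"
    by (metis (no_types, opaque_lifting) One_nat_def Suc_1 length_0_conv length_Suc_conv)
  then show ?thesis using * that[of n U p r v w] by auto
qed

lemma tangent_class_in_Pts: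
  "(n, U, p) \<in> Plots X \<Longrightarrow> r \<in> U \<Longrightarrow> length vs = k \<Longrightarrow> set vs \<subseteq> Rn n \<Longrightarrow>
    tangent_class k X (n, U, p) r vs \<in> Pts (tangent k X)"
  unfolding Pts_tangent by blast

lemma tangent_class_2_in_Pts:
  "(n, U, p) \<in> Plots X \<Longrightarrow> r \<in> U \<Longrightarrow> v \<in> Rn n \<Longrightarrow> w \<in> Rn n \<Longrightarrow>
    tangent_class 2 X (n, U, p) r [v, w] \<in> Pts (T2 X)"
  by (intro tangent_class_in_Pts) auto

text \<open>Evaluates the unions by which \<open>tangent_map\<close> and \<open>tangent_proj\<close>
  are defined: all their members coincide, so any representative gives the value.\<close>

lemma UN_tangent_class:
  assumes X: "diffeological_space X" and a: "(P, r, vs) \<in> pre_tangent_set k X"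
    and F: "\<And>a b. a \<in> pre_tangent_set k X \<Longrightarrow> b \<in> pre_tangent_set k X \<Longrightarrow> tangent_step X a b \<Longrightarrow> F a = F b"
  shows "(\<Union>x \<in> tangent_class k X P r vs. F x) = F (P, r, vs)"
proof -
  have "F x = F (P, r, vs)" if "x \<in> tangent_class k X P r vs" for x
  proof -
    have "((P, r, vs), x) \<in> tangent_rel k X" using that mem_tangent_class[OF a] by blast
    then show ?thesis using tangent_rel_invariant[of X "(P, r, vs)" x k F] X F by metis
  qed
  then show ?thesis using tangent_class_self[OF a] by blast
qed

lemma tangent_map_class:
  assumes X: "diffeological_space X" and Y: "diffeological_space Y" and h: "smooth_between X Y h"
    and a: "(n, U, p) \<in> Plots X" "r \<in> U" "set vs \<subseteq> Rn n" "length vs = k"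
  shows "tangent_map k Y h (tangent_class k X (n, U, p) r vs) = tangent_class k Y (n, U, restrict (h \<circ> p) U) r vs"
proof -
  \<comment> \<open>A step through \<open>f\<close> from \<open>p\<close> to \<open>q\<close>
    becomes a step through the same \<open>f\<close> from \<open>h \<circ> p\<close> to
    \<open>h \<circ> q\<close>.\<close>
  define F where "F = (\<lambda>((n, U, p), r, vs). tangent_class k Y (n, U, restrict (h \<circ> p) U) r vs)"
  have "F a = F b" if ab: "a \<in> pre_tangent_set k X" "b \<in> pre_tangent_set k X" "tangent_step X a b" for a b
  proof -
    obtain n U p m V q f r vs where *: "(n, U, p) \<in> Plots X" "(m, V, q) \<in> Plots X" "smooth_map n U m V f"
      "\<forall>x\<in>U. q (f x) = p x"
      "r \<in> U" "set vs \<subseteq> Rn n" "a = ((n, U, p), r, vs)" "b = ((m, V, q), f r, map (jacobian n f r) vs)"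
      using ab(3) unfolding tangent_step_def by blast
    have k: "length vs = k" using ab(1) *(7) by (simp add: mem_pre_tangent_set)
    have fV: "f x \<in> V" if "x \<in> U" for x using *(3) that unfolding smooth_map_def by blast
    have "restrict (restrict (h \<circ> q) V \<circ> f) U = restrict (h \<circ> p) U"
      using *(4) fV by (auto simp: restrict_def)
    then show ?thesis
      using tangent_class_compose[OF Y smooth_between_plot[OF h *(2)] plot_domain_open[OF X *(1)] *(3,5,6) k]
      by (simp add: F_def *(7,8))
  qed
  moreover have "((n, U, p), r, vs) \<in> pre_tangent_set k X" using a by (simp add: mem_pre_tangent_set)
  ultimately have "(\<Union>x \<in> tangent_class k X (n, U, p) r vs. F x) = F ((n, U, p), r, vs)"
    by (intro UN_tangent_class[OF X]) auto
  then show ?thesis by (simp add: tangent_map_def F_def split_def)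
qed

lemma T2_map_class:
  assumes "diffeological_space X" "diffeological_space Y" "smooth_between X Y h"
    "(n, U, p) \<in> Plots X" "r \<in> U" "v \<in> Rn n" "w \<in> Rn n"
  shows "T2_map Y h (tangent_class 2 X (n, U, p) r [v, w]) = tangent_class 2 Y (n, U, restrict (h \<circ> p) U) r [v, w]"
  by (rule tangent_map_class[OF assms(1-5)]) (use assms in auto)

lemma tangent_map_Pts:
  assumes "diffeological_space X" "diffeological_space Y" "smooth_between X Y h" "\<tau> \<in> Pts (tangent k X)"
  shows "tangent_map k Y h \<tau> \<in> Pts (tangent k Y)"
  using assms(4) tangent_map_class[OF assms(1-3)] smooth_between_plot[OF assms(3)] unfolding Pts_tangent by metis

lemma tangent_map_compose:
  assumes "diffeological_space X" "diffeological_space Y" "diffeological_space Z"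
    and h: "smooth_between X Y h" and k: "smooth_between Y Z l" and t: "\<tau> \<in> Pts (tangent k X)"
  shows "tangent_map k Z l (tangent_map k Y h \<tau>) = tangent_map k Z (l \<circ> h) \<tau>"
proof -
  obtain n U p r vs where *: "(n, U, p) \<in> Plots X" "r \<in> U" "length vs = k" "set vs \<subseteq> Rn n"
     "\<tau> = tangent_class k X (n, U, p) r vs"
    using t unfolding Pts_tangent by blast
  show ?thesis
    unfolding *(5) tangent_map_class[OF assms(1,2) h *(1,2,4,3)]
      tangent_map_class[OF assms(2,3) k smooth_between_plot[OF h *(1)] *(2,4,3)]
      tangent_map_class[OF assms(1,3) smooth_between_compose[OF h k] *(1,2,4,3)]
    by (simp add: comp_assoc)
qed

lemma tangent_map_cong:
  assumes "diffeological_space X" "diffeological_space Y"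
    and h: "smooth_between X Y h" and l: "smooth_between X Y l" and eq: "\<And>x. x \<in> Pts X \<Longrightarrow> h x = l x"
    and t: "\<tau> \<in> Pts (tangent k X)"
  shows "tangent_map k Y h \<tau> = tangent_map k Y l \<tau>"
proof -
  obtain n U p r vs where *: "(n, U, p) \<in> Plots X" "r \<in> U" "length vs = k" "set vs \<subseteq> Rn n"
     "\<tau> = tangent_class k X (n, U, p) r vs"
    using t unfolding Pts_tangent by blast
  have "restrict (h \<circ> p) U = restrict (l \<circ> p) U"
    using eq plot_in[OF assms(1) *(1)] by (auto simp: restrict_def)
  then show ?thesis
    unfolding *(5) tangent_map_class[OF assms(1,2) h *(1,2,4,3)] tangent_map_class[OF assms(1,2) l *(1,2,4,3)]
    by simp
qed

lemma tangent_map_ident: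
  assumes "diffeological_space X" and h: "smooth_between X X h" and eq: "\<And>x. x \<in> Pts X \<Longrightarrow> h x = x"
    and t: "\<tau> \<in> Pts (tangent k X)"
  shows "tangent_map k X h \<tau> = \<tau>"
proof -
  obtain n U p r vs where *: "(n, U, p) \<in> Plots X" "r \<in> U" "length vs = k" "set vs \<subseteq> Rn n"
     "\<tau> = tangent_class k X (n, U, p) r vs"
    using t unfolding Pts_tangent by blast
  have "restrict (h \<circ> p) U = restrict p U"
    using eq plot_in[OF assms(1) *(1)] by (auto simp: restrict_def)
  then show ?thesis
    unfolding *(5) tangent_map_class[OF assms(1,1) h *(1,2,4,3)]
    using plot_extensional[OF assms(1) *(1)] by simp
qed

lemma tangent_map_left_inverse:
  assumes X: "diffeological_space X" and Y: "diffeological_space Y"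
    and e: "smooth_between X Y e" and f: "smooth_between Y X f" and fe: "\<And>x. x \<in> Pts X \<Longrightarrow> f (e x) = x"
    and t: "\<tau> \<in> Pts (tangent k X)"
  shows "tangent_map k X f (tangent_map k Y e \<tau>) = \<tau>"
  using tangent_map_compose[OF X Y X e f t] tangent_map_ident[OF X smooth_between_compose[OF e f] _ t] fe by simp

lemma tangent_proj_class:
  assumes X: "diffeological_space X" and a: "(n, U, p) \<in> Plots X" "r \<in> U" "v \<in> Rn n" "w \<in> Rn n"
  shows "tangent_proj X 0 (tangent_class 2 X (n, U, p) r [v, w]) = tangent_class 1 X (n, U, p) r [v]"
    and "tangent_proj X 1 (tangent_class 2 X (n, U, p) r [v, w]) = tangent_class 1 X (n, U, p) r [w]"
proof -
  have main: "tangent_proj X i (tangent_class 2 X (n, U, p) r [v, w]) = tangent_class 1 X (n, U, p) r [[v, w] ! i]"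
    if i: "i < 2" for i
  proof -
    define F where "F = (\<lambda>(P, r, vs). tangent_class 1 X P r [vs ! i])"
    have "F a = F b" if ab: "a \<in> pre_tangent_set 2 X" "b \<in> pre_tangent_set 2 X" "tangent_step X a b" for a b
    proof -
      obtain n U p m V q f r vs where *: "(n, U, p) \<in> Plots X" "(m, V, q) \<in> Plots X" "smooth_map n U m V f"
        "\<forall>x\<in>U. q (f x) = p x"
        "r \<in> U" "set vs \<subseteq> Rn n" "a = ((n, U, p), r, vs)" "b = ((m, V, q), f r, map (jacobian n f r) vs)"
        using ab(3) unfolding tangent_step_def by blast
      have il: "i < length vs" using ab(1) *(7) i by (simp add: mem_pre_tangent_set)
      then have v: "vs ! i \<in> Rn n" using *(6) nth_mem by blast
      have "tangent_step X ((n, U, p), r, [vs ! i]) ((m, V, q), f r, map (jacobian n f r) [vs ! i])"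
        unfolding tangent_step_def using * v by (metis empty_subsetI insert_subset list.set)
      then have "tangent_class 1 X (n, U, p) r [vs ! i] = tangent_class 1 X (m, V, q) (f r) (map (jacobian n f r) [vs ! i])"
        using * v by (intro tangent_class_step[OF X]) (auto simp: mem_pre_tangent_set)
      then show ?thesis using il by (simp add: F_def *(7,8))
    qed
    then have "(\<Union>x \<in> tangent_class 2 X (n, U, p) r [v, w]. F x) = F ((n, U, p), r, [v, w])"
      using a by (intro UN_tangent_class[OF X]) (auto simp: mem_pre_tangent_set)
    then show ?thesis by (simp add: tangent_proj_def F_def split_def)
  qed
  show "tangent_proj X 0 (tangent_class 2 X (n, U, p) r [v, w]) = tangent_class 1 X (n, U, p) r [v]"
    using main[of 0] by simp
  show "tangent_proj X 1 (tangent_class 2 X (n, U, p) r [v, w]) = tangent_class 1 X (n, U, p) r [w]"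
    using main[of 1] by simp
qed

text \<open>The definition has two nested localisations, one from the quotient and one from the
  coproduct; near each point they merge into a single plot of \<open>X\<close> with a smooth base
  point and smooth vectors. \<open>tangent_plotI\<close> is the converse.\<close>

lemma tangent_plotD:
  assumes "(l, W, \<sigma>) \<in> Plots (tangent k X)"
  shows "openin (Euclidean_space l) W" "\<sigma> \<in> extensional W"
    "z \<in> W \<Longrightarrow> \<exists>W' n U p \<rho> \<nu>. openin (Euclidean_space l) W' \<and> z \<in> W' \<and> W' \<subseteq> W \<and> (n, U, p) \<in> Plots X \<and>
       smooth_map l W' n U \<rho> \<and> length \<nu> = k \<and> (\<forall>v \<in> set \<nu>. smooth_map l W' n (Rn n) v) \<and>
       (\<forall>y\<in>W'. \<sigma> y = tangent_class k X (n, U, p) (\<rho> y) (map (\<lambda>v. v y) \<nu>))"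
proof -
  have a: "openin (Euclidean_space l) W" "\<sigma> \<in> W \<rightarrow>\<^sub>E pre_tangent_set k X // tangent_rel k X"
    and loc: "\<forall>z\<in>W. \<exists>V q. openin (Euclidean_space l) V \<and> z \<in> V \<and> V \<subseteq> W \<and> (l, V, q) \<in> Plots (pre_tangent k X) \<and>
          (\<forall>y\<in>V. \<sigma> y = tangent_rel k X `` {q y})"
    using assms by (simp_all add: tangent_def quotient_diffeology_def pre_tangent_def)
  show "openin (Euclidean_space l) W" "\<sigma> \<in> extensional W" using a by (auto simp: PiE_def)
  assume z: "z \<in> W"
  obtain V q where V: "z \<in> V" "V \<subseteq> W" "(l, V, q) \<in> Plots (pre_tangent k X)"
      "\<forall>y\<in>V. \<sigma> y = tangent_rel k X `` {q y}" using bspec[OF loc z] by (elim exE conjE) (rule that)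
  have "\<forall>z\<in>V. \<exists>W'. openin (Euclidean_space l) W' \<and> z \<in> W' \<and> W' \<subseteq> V \<and>
          (\<exists>n U p \<rho> \<nu>. (n, U, p) \<in> Plots X \<and> smooth_map l W' n U \<rho> \<and>
             length \<nu> = k \<and> (\<forall>v \<in> set \<nu>. smooth_map l W' n (Rn n) v) \<and>
             (\<forall>y\<in>W'. q y = ((n, U, p), \<rho> y, map (\<lambda>v. v y) \<nu>)))"
    using V(3) by (simp add: pre_tangent_def)
  then obtain W' n U p \<rho> \<nu> where W': "openin (Euclidean_space l) W'" "z \<in> W'" "W' \<subseteq> V"
    "(n, U, p) \<in> Plots X" "smooth_map l W' n U \<rho>" "length \<nu> = k" "\<forall>v \<in> set \<nu>. smooth_map l W' n (Rn n) v"
    "\<forall>y\<in>W'. q y = ((n, U, p), \<rho> y, map (\<lambda>v. v y) \<nu>)"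
    using V(1) by meson
  have "\<sigma> y = tangent_class k X (n, U, p) (\<rho> y) (map (\<lambda>v. v y) \<nu>)" if "y \<in> W'" for y
    using that W'(3,8) V(4) by (auto simp: tangent_class_def)
  then show "\<exists>W' n U p \<rho> \<nu>. openin (Euclidean_space l) W' \<and> z \<in> W' \<and> W' \<subseteq> W \<and> (n, U, p) \<in> Plots X \<and>
       smooth_map l W' n U \<rho> \<and> length \<nu> = k \<and> (\<forall>v \<in> set \<nu>. smooth_map l W' n (Rn n) v) \<and>
       (\<forall>y\<in>W'. \<sigma> y = tangent_class k X (n, U, p) (\<rho> y) (map (\<lambda>v. v y) \<nu>))"
    using W' subset_trans[OF W'(3) V(2)] by (intro exI[of _ W'] exI[of _ n] exI[of _ U] exI[of _ p] exI[of _ \<rho>] exI[of _ \<nu>] conjI) simp_all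
qed

lemma tangent_plotI:
  assumes W: "openin (Euclidean_space l) W" and ext: "\<sigma> \<in> extensional W"
    and loc: "\<And>z. z \<in> W \<Longrightarrow> \<exists>W' n U p \<rho> \<nu>. openin (Euclidean_space l) W' \<and> z \<in> W' \<and> W' \<subseteq> W \<and> (n, U, p) \<in> Plots X \<and>
       smooth_map l W' n U \<rho> \<and> length \<nu> = k \<and> (\<forall>v \<in> set \<nu>. smooth_map l W' n (Rn n) v) \<and>
       (\<forall>y\<in>W'. \<sigma> y = tangent_class k X (n, U, p) (\<rho> y) (map (\<lambda>v. v y) \<nu>))"
  shows "(l, W, \<sigma>) \<in> Plots (tangent k X)"
proof -
  have *: "\<sigma> z \<in> pre_tangent_set k X // tangent_rel k X \<and>
    (\<exists>V q. openin (Euclidean_space l) V \<and> z \<in> V \<and> V \<subseteq> W \<and> (l, V, q) \<in> Plots (pre_tangent k X) \<and>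
          (\<forall>y\<in>V. \<sigma> y = tangent_rel k X `` {q y}))" if z: "z \<in> W" for z
  proof -
    obtain W' n U p \<rho> \<nu> where W': "openin (Euclidean_space l) W'" "z \<in> W'" "W' \<subseteq> W" "(n, U, p) \<in> Plots X"
       "smooth_map l W' n U \<rho>" "length \<nu> = k" "\<forall>v \<in> set \<nu>. smooth_map l W' n (Rn n) v"
       "\<forall>y\<in>W'. \<sigma> y = tangent_class k X (n, U, p) (\<rho> y) (map (\<lambda>v. v y) \<nu>)"
      using loc[OF z] by blast
    define q where "q = (\<lambda>y\<in>W'. ((n, U, p), \<rho> y, map (\<lambda>v. v y) \<nu>))"
    have pre: "((n, U, p), \<rho> y, map (\<lambda>v. v y) \<nu>) \<in> pre_tangent_set k X" if "y \<in> W'" for y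
      unfolding mem_pre_tangent_set using W'(4-7) that unfolding smooth_map_def by auto
    have "q \<in> W' \<rightarrow>\<^sub>E pre_tangent_set k X" using pre by (auto simp: q_def)
    moreover have "\<exists>n U p \<rho> \<nu>. (n, U, p) \<in> Plots X \<and> smooth_map l W' n U \<rho> \<and>
             length \<nu> = k \<and> (\<forall>v \<in> set \<nu>. smooth_map l W' n (Rn n) v) \<and>
             (\<forall>y\<in>W'. q y = ((n, U, p), \<rho> y, map (\<lambda>v. v y) \<nu>))"
      by (intro exI[of _ n] exI[of _ U] exI[of _ p] exI[of _ \<rho>] exI[of _ \<nu>] conjI)
         (use W' in \<open>simp_all add: q_def\<close>)
    then have "\<forall>z\<in>W'. \<exists>W''. openin (Euclidean_space l) W'' \<and> z \<in> W'' \<and> W'' \<subseteq> W' \<and>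
          (\<exists>n U p \<rho> \<nu>. (n, U, p) \<in> Plots X \<and> smooth_map l W'' n U \<rho> \<and>
             length \<nu> = k \<and> (\<forall>v \<in> set \<nu>. smooth_map l W'' n (Rn n) v) \<and>
             (\<forall>y\<in>W''. q y = ((n, U, p), \<rho> y, map (\<lambda>v. v y) \<nu>)))"
      using W'(1) by (intro ballI exI[of _ W'] conjI subset_refl)
    ultimately have "(l, W', q) \<in> Plots (pre_tangent k X)"
      using W'(1) by (simp add: pre_tangent_def)
    moreover have "\<forall>y\<in>W'. \<sigma> y = tangent_rel k X `` {q y}"
      using W'(8) by (simp add: q_def tangent_class_def)
    moreover have "\<sigma> z \<in> pre_tangent_set k X // tangent_rel k X"
      using W'(2,8) pre[OF W'(2)] by (auto simp: tangent_class_def intro: quotientI)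
    ultimately show ?thesis using W'(1-3) by blast
  qed
  show ?thesis
    unfolding tangent_def quotient_diffeology_def using W ext * by (auto simp: PiE_iff pre_tangent_def)
qed

lemma tangent_map_smooth:
  assumes X: "diffeological_space X" and Y: "diffeological_space Y" and h: "smooth_between X Y h"
  shows "smooth_between (tangent k X) (tangent k Y) (tangent_map k Y h)"
  unfolding smooth_between_def
proof (intro conjI ballI)
  show "tangent_map k Y h \<in> Pts (tangent k X) \<rightarrow> Pts (tangent k Y)"
    using tangent_map_Pts[OF assms] by blast
  fix P assume P: "P \<in> Plots (tangent k X)"
  obtain l W \<sigma> where [simp]: "P = (l, W, \<sigma>)" by (cases P)
  have "(l, W, restrict (tangent_map k Y h \<circ> \<sigma>) W) \<in> Plots (tangent k Y)"
  proof (rule tangent_plotI)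
    show "openin (Euclidean_space l) W" using P tangent_plotD(1) by auto
    fix z assume "z \<in> W"
    then obtain W' n U p \<rho> \<nu> where W': "openin (Euclidean_space l) W'" "z \<in> W'" "W' \<subseteq> W" "(n, U, p) \<in> Plots X"
       "smooth_map l W' n U \<rho>" "length \<nu> = k" "\<forall>v \<in> set \<nu>. smooth_map l W' n (Rn n) v"
       "\<forall>y\<in>W'. \<sigma> y = tangent_class k X (n, U, p) (\<rho> y) (map (\<lambda>v. v y) \<nu>)"
      using tangent_plotD(3)[of l W \<sigma> k X z] P by auto
    have "restrict (tangent_map k Y h \<circ> \<sigma>) W y =
      tangent_class k Y (n, U, restrict (h \<circ> p) U) (\<rho> y) (map (\<lambda>v. v y) \<nu>)" if y: "y \<in> W'" for y
    proof -
      have "\<rho> y \<in> U" "set (map (\<lambda>v. v y) \<nu>) \<subseteq> Rn n" using W'(5,7) y unfolding smooth_map_def by auto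
      then show ?thesis
        using tangent_map_class[OF X Y h W'(4), of "\<rho> y" "map (\<lambda>v. v y) \<nu>" k] W'(3,6,8) y by auto
    qed
    then show "\<exists>W' n U p \<rho> \<nu>. openin (Euclidean_space l) W' \<and> z \<in> W' \<and> W' \<subseteq> W \<and> (n, U, p) \<in> Plots Y \<and>
       smooth_map l W' n U \<rho> \<and> length \<nu> = k \<and> (\<forall>v \<in> set \<nu>. smooth_map l W' n (Rn n) v) \<and>
       (\<forall>y\<in>W'. restrict (tangent_map k Y h \<circ> \<sigma>) W y = tangent_class k Y (n, U, p) (\<rho> y) (map (\<lambda>v. v y) \<nu>))"
      using W'(1-3,5-7) smooth_between_plot[OF h W'(4)] by blast
  qed simp
  then show "case P of (n, U, p) \<Rightarrow> (n, U, restrict (tangent_map k Y h \<circ> p) U) \<in> Plots (tangent k Y)" by simp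
qed

lemma smooth_between_real:
  "smooth_between X real_diffeology h \<longleftrightarrow>
     (\<forall>(n, U, p) \<in> Plots X. openin (Euclidean_space n) U \<and> smooth_fun n U (h \<circ> p))"
proof -
  have "smooth_fun n U (restrict (h \<circ> p) U) \<longleftrightarrow> smooth_fun n U (h \<circ> p)" if "openin (Euclidean_space n) U" for n U p
    by (rule smooth_fun_cong[OF that]) simp
  then show ?thesis by (auto simp: smooth_between_def real_diffeology_def split_def)
qed

section \<open>Submersions of manifolds of equal dimension\<close>

lemma zero_in_Rn [simp]: "(\<lambda>_. 0) \<in> Rn n"
  by (simp add: topspace_Euclidean_space)

lemma combination_in_Rn: "u \<in> Rn n \<Longrightarrow> v \<in> Rn n \<Longrightarrow> (\<lambda>i. a * u i + b * v i) \<in> Rn n"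
  by (simp add: topspace_Euclidean_space)

lemma manifold_diffeological: "manifold n X \<Longrightarrow> diffeological_space X"
  by (simp add: manifold_def)

text \<open>A chart in purely diffeological terms: the inverse \<open>\<kappa>\<close> is itself a
  plot, and \<open>\<phi>\<close> is smooth along every plot where it is defined. This removes
  topology and atlas from the arguments that follow.\<close>

definition smooth_chart :: "nat \<Rightarrow> 'a diffeology \<Rightarrow> 'a set \<Rightarrow> ('a \<Rightarrow> rvec) \<Rightarrow> (rvec \<Rightarrow> 'a) \<Rightarrow> bool" where
  "smooth_chart n X V \<phi> \<kappa> \<longleftrightarrow> openin (D_topology X) V \<and> V \<subseteq> Pts X \<and> (n, \<phi> ` V, \<kappa>) \<in> Plots X \<and>
     (\<forall>y\<in>V. \<kappa> (\<phi> y) = y) \<and> (\<forall>(k, U, q) \<in> Plots X. smooth_map k {r\<in>U. q r \<in> V} n (\<phi> ` V) (\<phi> \<circ> q))"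

lemma smooth_chartD:
  assumes "smooth_chart n X V \<phi> \<kappa>"
  shows "openin (D_topology X) V" "V \<subseteq> Pts X" "(n, \<phi> ` V, \<kappa>) \<in> Plots X"
    "\<And>y. y \<in> V \<Longrightarrow> \<kappa> (\<phi> y) = y" "\<And>z. z \<in> \<phi> ` V \<Longrightarrow> \<kappa> z \<in> V \<and> \<phi> (\<kappa> z) = z"
    "\<And>k U q. (k, U, q) \<in> Plots X \<Longrightarrow> smooth_map k {r\<in>U. q r \<in> V} n (\<phi> ` V) (\<phi> \<circ> q)"
  using assms unfolding smooth_chart_def by (auto 0 3)

lemma manifold_chart:
  assumes X: "manifold n X" and x: "x \<in> Pts X"
  shows "\<exists>V \<phi> \<kappa>. x \<in> V \<and> smooth_chart n X V \<phi> \<kappa>"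
proof -
  obtain T A where A: "smooth_atlas n T A" and XA: "X = atlas_diffeology n T A"
    using X by (auto simp: manifold_def)
  have T: "D_topology X = T" unfolding XA by (rule D_topology_atlas_diffeology[OF A])
  have cover: "(\<Union>(V, \<phi>) \<in> A. V) = topspace T" using A unfolding smooth_atlas_def by blast
  have "x \<in> topspace T" using x by (simp add: XA atlas_diffeology_def)
  then obtain V \<phi> where VA: "(V, \<phi>) \<in> A" and xV: "x \<in> V" using cover by fast
  have chart: "openin T V \<and> openin (Euclidean_space n) (\<phi> ` V) \<and>
      homeomorphic_map (subtopology T V) (subtopology (Euclidean_space n) (\<phi> ` V)) \<phi>"
    using A VA unfolding smooth_atlas_def by fast
  then have V: "openin T V" "openin (Euclidean_space n) (\<phi> ` V)"
    and hom: "homeomorphic_map (subtopology T V) (subtopology (Euclidean_space n) (\<phi> ` V)) \<phi>" by auto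
  have VT: "V \<subseteq> topspace T" using V openin_subset by blast
  have inj: "inj_on \<phi> V"
    using homeomorphic_imp_injective_map[OF hom] topspace_subtopology_openin[OF V(1)] by simp
  obtain \<psi> where \<psi>: "homeomorphic_maps (subtopology T V) (subtopology (Euclidean_space n) (\<phi> ` V)) \<phi> \<psi>"
    using hom homeomorphic_map_maps by blast
  define \<kappa> where "\<kappa> = restrict (inv_into V \<phi>) (\<phi> ` V)"
  have \<kappa>\<phi>: "\<kappa> (\<phi> y) = y" if "y \<in> V" for y using that inj by (simp add: \<kappa>_def)
  have \<kappa>V: "\<kappa> z \<in> V \<and> \<phi> (\<kappa> z) = z" if "z \<in> \<phi> ` V" for z using that \<kappa>\<phi> by auto
  have "continuous_map (subtopology (Euclidean_space n) (\<phi> ` V)) (subtopology T V) \<kappa>"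
  proof (rule continuous_map_eq)
    show "continuous_map (subtopology (Euclidean_space n) (\<phi> ` V)) (subtopology T V) \<psi>"
      using \<psi> by (simp add: homeomorphic_maps_def)
    fix z assume "z \<in> topspace (subtopology (Euclidean_space n) (\<phi> ` V))"
    then obtain y where y: "y \<in> V" "z = \<phi> y" by auto
    moreover have "\<psi> (\<phi> y) = y"
      using \<psi> y(1) topspace_subtopology_openin[OF V(1)] by (simp add: homeomorphic_maps_def)
    ultimately show "\<psi> z = \<kappa> z" using \<kappa>\<phi> by simp
  qed
  then have cont: "continuous_map (subtopology (Euclidean_space n) (\<phi> ` V)) T \<kappa>"
    by (simp add: continuous_map_in_subtopology)
  have sm: "smooth_map n {r \<in> \<phi> ` V. \<kappa> r \<in> W} n (\<omega> ` W) (\<omega> \<circ> \<kappa>)" if W: "(W, \<omega>) \<in> A" for W \<omega>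
  proof -
    have "openin T W" using A W unfolding smooth_atlas_def by fast
    then have op: "openin (Euclidean_space n) {r \<in> \<phi> ` V. \<kappa> r \<in> W}"
      by (rule openin_preimage_open[OF V(2) cont])
    \<comment> \<open>Compatibility of the two charts in the atlas is precisely the smoothness of
      \<open>\<kappa>\<close> read in the chart \<open>\<omega>\<close>.\<close>
    have sm0: "smooth_map n (\<phi> ` (V \<inter> W)) n (\<omega> ` W) (\<omega> \<circ> inv_into V \<phi>)"
      using A VA W unfolding smooth_atlas_def by fast
    have eq: "\<phi> ` (V \<inter> W) = {r \<in> \<phi> ` V. \<kappa> r \<in> W}"
    proof
      show "\<phi> ` (V \<inter> W) \<subseteq> {r \<in> \<phi> ` V. \<kappa> r \<in> W}" using \<kappa>\<phi> by auto
      show "{r \<in> \<phi> ` V. \<kappa> r \<in> W} \<subseteq> \<phi> ` (V \<inter> W)" using \<kappa>\<phi> by auto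
    qed
    show ?thesis by (rule smooth_map_cong[OF sm0[unfolded eq] op]) (simp add: \<kappa>_def)
  qed
  have pl: "(n, \<phi> ` V, \<kappa>) \<in> Plots X"
  proof -
    have "\<kappa> \<in> \<phi> ` V \<rightarrow>\<^sub>E topspace T" using \<kappa>V VT by (auto simp: \<kappa>_def inv_into_into)
    then show ?thesis using V(2) cont sm by (auto simp: XA atlas_diffeology_def)
  qed
  have "smooth_map k {r\<in>U. q r \<in> V} n (\<phi> ` V) (\<phi> \<circ> q)" if "(k, U, q) \<in> Plots X" for k U q
  proof -
    have "\<forall>(V, \<phi>) \<in> A. smooth_map k {r\<in>U. q r \<in> V} n (\<phi> ` V) (\<phi> \<circ> q)"
      using that by (simp add: XA atlas_diffeology_def)
    then show ?thesis using VA by fast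
  qed
  moreover have "V \<subseteq> Pts X" using VT by (simp add: XA atlas_diffeology_def)
  ultimately show ?thesis
    using V(1) xV pl \<kappa>\<phi> T unfolding smooth_chart_def
    by (intro exI[of _ V] exI[of _ \<phi>] exI[of _ \<kappa>]) auto
qed

lemma tangent_atI:
  "(n, U, p) \<in> Plots X \<Longrightarrow> r \<in> U \<Longrightarrow> v \<in> Rn n \<Longrightarrow> tangent_class 1 X (n, U, p) r [v] \<in> tangent_at X (p r)"
  unfolding tangent_at_def by blast

text \<open>The coordinates of a tangent vector in a chart do not depend on the representing plot,
  by the chain rule at each step.\<close>

lemma jacobian_chart_invariant:
  assumes B: "diffeological_space B" and V: "openin (D_topology B) V" and \<Phi>: "openin (Euclidean_space n) \<Phi>"
    and \<phi>: "\<And>k U q. (k, U, q) \<in> Plots B \<Longrightarrow> smooth_map k {r\<in>U. q r \<in> V} n \<Phi> (\<phi> \<circ> q)"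
    and p: "(k1, U1, p1) \<in> Plots B" "r1 \<in> U1" "v1 \<in> Rn k1" "p1 r1 \<in> V"
    and q: "(k2, U2, p2) \<in> Plots B" "r2 \<in> U2" "v2 \<in> Rn k2" "p2 r2 \<in> V"
    and eq: "tangent_class 1 B (k1, U1, p1) r1 [v1] = tangent_class 1 B (k2, U2, p2) r2 [v2]"
  shows "jacobian k1 (\<phi> \<circ> p1) r1 v1 = jacobian k2 (\<phi> \<circ> p2) r2 v2"
proof -
  \<comment> \<open>Steps preserve the base point, so both ends lie over \<open>V\<close> or neither
    does; the default value only makes \<open>F\<close> total.\<close>
  define F where "F = (\<lambda>((k, U::rvec set, q), r, vs). if q r \<in> V then jacobian k (\<phi> \<circ> q) r (hd vs) else (\<lambda>_. 0))"
  have "F a = F b" if ab: "a \<in> pre_tangent_set 1 B" "b \<in> pre_tangent_set 1 B" "tangent_step B a b" for a b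
  proof -
    obtain n' U p m W q f r vs where *: "(n', U, p) \<in> Plots B" "(m, W, q) \<in> Plots B" "smooth_map n' U m W f"
      "\<forall>x\<in>U. q (f x) = p x"
      "r \<in> U" "set vs \<subseteq> Rn n'" "a = ((n', U, p), r, vs)" "b = ((m, W, q), f r, map (jacobian n' f r) vs)"
      using ab(3) unfolding tangent_step_def by blast
    have vs: "vs \<noteq> []" using ab(1) *(7) by (auto simp: mem_pre_tangent_set)
    show ?thesis
    proof (cases "p r \<in> V")
      case True
      define U' where "U' = {x\<in>U. p x \<in> V}"
      define W' where "W' = {x\<in>W. q x \<in> V}"
      have U': "openin (Euclidean_space n') U'" and W': "openin (Euclidean_space m) W'"
        using openin_plot_preimage[OF B *(1) V] openin_plot_preimage[OF B *(2) V] by (simp_all add: U'_def W'_def)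
      have fW: "f ` U \<subseteq> W" using *(3) unfolding smooth_map_def by blast
      have f: "smooth_map n' U' m W' f"
        by (rule smooth_map_subset[OF *(3)]) (use fW *(4) in \<open>auto simp: U'_def W'_def\<close>)
      have r: "r \<in> U'" using True *(5) by (simp add: U'_def)
      have "smooth_fun m W' (\<lambda>y. (\<phi> \<circ> q) y j)" for j
        using smooth_fun_component[OF W' \<phi>[OF *(2), folded W'_def]] .
      then have "jacobian n' ((\<phi> \<circ> q) \<circ> f) r (hd vs) = jacobian m (\<phi> \<circ> q) (f r) (jacobian n' f r (hd vs))"
        by (rule jacobian_compose[OF U' W' f _ r])
      moreover have "jacobian n' ((\<phi> \<circ> q) \<circ> f) r (hd vs) = jacobian n' (\<phi> \<circ> p) r (hd vs)"
        by (rule jacobian_cong[OF U' _ r]) (use *(4) in \<open>simp add: U'_def\<close>)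
      ultimately show ?thesis using True vs *(4,5) by (simp add: F_def *(7,8) hd_map)
    next
      case False
      then show ?thesis using *(4,5) by (simp add: F_def *(7,8))
    qed
  qed
  then have "F ((k1, U1, p1), r1, [v1]) = F ((k2, U2, p2), r2, [v2])"
    using p q by (intro tangent_class_invariant[OF B eq]) (auto simp: mem_pre_tangent_set)
  then show ?thesis using p q by (simp add: F_def)
qed

text \<open>In charts \<open>p\<close> becomes a map between open subsets of the same
  \<open>Rn n\<close>. Surjectivity on tangent spaces makes its Jacobian surjective, and
  \<open>inverse_function\<close> applies because the dimensions agree. Both inverse identities are
  recorded: one yields immersivity, the other parametrises arrows by their source.\<close>

lemma etale_local_section:
  assumes E: "manifold n E" and B: "manifold n B" and sub: "submersion E B p" and e: "e \<in> Pts E"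
  shows "\<exists>W S \<sigma>. openin (D_topology E) W \<and> e \<in> W \<and> openin (D_topology B) S \<and> p ` W \<subseteq> S \<and>
    smooth_between (sub_diffeology B S) E \<sigma> \<and> (\<forall>g\<in>W. \<sigma> (p g) = g) \<and> (\<forall>x\<in>S. p (\<sigma> x) = x \<and> \<sigma> x \<in> W)"
proof -
  have DE: "diffeological_space E" and DB: "diffeological_space B"
    using E B by (simp_all add: manifold_diffeological)
  have p: "smooth_between E B p" using sub by (simp add: submersion_def)
  obtain V \<phi> \<kappa> where eV: "e \<in> V" and chart: "smooth_chart n E V \<phi> \<kappa>"
    using manifold_chart[OF E e] by blast
  note V = smooth_chartD(1,2)[OF chart] eV smooth_chartD(3)[OF chart]
  note \<kappa>\<phi> = smooth_chartD(4)[OF chart] and \<phi>\<kappa> = smooth_chartD(5)[OF chart] and \<phi> = smooth_chartD(6)[OF chart]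
  have peB: "p e \<in> Pts B" by (rule smooth_between_in[OF p e])
  obtain V' \<phi>' \<kappa>' where eV': "p e \<in> V'" and chart': "smooth_chart n B V' \<phi>' \<kappa>'"
    using manifold_chart[OF B peB] by blast
  note V' = smooth_chartD(1,2)[OF chart'] eV' smooth_chartD(3)[OF chart']
  note \<kappa>\<phi>' = smooth_chartD(4)[OF chart'] and \<phi>\<kappa>' = smooth_chartD(5)[OF chart'] and \<phi>' = smooth_chartD(6)[OF chart']
  define \<Phi> where "\<Phi> = \<phi> ` V"
  define \<Phi>' where "\<Phi>' = \<phi>' ` V'"
  have \<Phi>: "openin (Euclidean_space n) \<Phi>" and \<Phi>': "openin (Euclidean_space n) \<Phi>'"
    using plot_domain_open[OF DE V(4)] plot_domain_open[OF DB V'(4)] by (simp_all add: \<Phi>_def \<Phi>'_def)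
  define q where "q = restrict (p \<circ> \<kappa>) \<Phi>"
  have q: "(n, \<Phi>, q) \<in> Plots B" unfolding q_def \<Phi>_def by (rule smooth_between_plot[OF p V(4)])
  define U where "U = {r\<in>\<Phi>. q r \<in> V'}"
  have U: "openin (Euclidean_space n) U"
    unfolding U_def by (rule openin_plot_preimage[OF DB q V'(1)])
  define f where "f = \<phi>' \<circ> q"
  have f: "smooth_map n U n \<Phi>' f" unfolding U_def \<Phi>'_def f_def by (rule \<phi>'[OF q])
  define x0 where "x0 = \<phi> e"
  have x0\<Phi>: "x0 \<in> \<Phi>" using V(3) by (simp add: x0_def \<Phi>_def)
  have qx0: "q x0 = p e" using x0\<Phi> \<kappa>\<phi>[OF V(3)] by (simp add: q_def x0_def)
  have x0: "x0 \<in> U" using x0\<Phi> qx0 V'(3) by (simp add: U_def)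
  \<comment> \<open>The vector \<open>v\<close> is represented by the chart plot
    \<open>\<kappa>'\<close> at the image point. The submersion property gives a plot
    \<open>a\<close> of \<open>E\<close> whose image represents the same class, and the vector of
    \<open>a\<close> read in the chart \<open>\<phi>\<close> is the preimage of
    \<open>v\<close>.\<close>
  have surj: "\<exists>w. jacobian n f x0 w = v" if v: "v \<in> Rn n" for v
  proof -
    define y0 where "y0 = \<phi>' (p e)"
    have y0: "y0 \<in> \<Phi>'" "\<kappa>' y0 = p e" using V'(3) \<kappa>\<phi>' by (simp_all add: y0_def \<Phi>'_def)
    have "tangent_class 1 B (n, \<Phi>', \<kappa>') y0 [v] \<in> tangent_at B (p e)"
      using tangent_atI[OF V'(4)[folded \<Phi>'_def] y0(1) v] y0(2) by simp
    then have "tangent_class 1 B (n, \<Phi>', \<kappa>') y0 [v] \<in> tangent_map 1 B p ` tangent_at E e"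
      using sub e by (simp add: submersion_def)
    then obtain k Q a r w where a: "(k, Q, a) \<in> Plots E" "r \<in> Q" "w \<in> Rn k" "a r = e"
      and eq0: "tangent_class 1 B (n, \<Phi>', \<kappa>') y0 [v] = tangent_map 1 B p (tangent_class 1 E (k, Q, a) r [w])"
      unfolding tangent_at_def by blast
    have eq: "tangent_class 1 B (n, \<Phi>', \<kappa>') y0 [v] = tangent_class 1 B (k, Q, restrict (p \<circ> a) Q) r [w]"
      unfolding eq0 by (rule tangent_map_class[OF DE DB p]) (use a in auto)
    have pa: "(k, Q, restrict (p \<circ> a) Q) \<in> Plots B" by (rule smooth_between_plot[OF p a(1)])
    have "jacobian n (\<phi>' \<circ> \<kappa>') y0 v = jacobian k (\<phi>' \<circ> restrict (p \<circ> a) Q) r w"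
      by (rule jacobian_chart_invariant[OF DB V'(1) \<Phi>' \<phi>'[folded \<Phi>'_def] V'(4)[folded \<Phi>'_def] y0(1) v _ pa a(2,3) _ eq])
         (use y0(2) V'(3) a in auto)
    moreover have "jacobian n (\<phi>' \<circ> \<kappa>') y0 v = jacobian n id y0 v"
      by (rule jacobian_cong[OF \<Phi>' _ y0(1)]) (use \<phi>\<kappa>' in \<open>simp add: \<Phi>'_def\<close>)
    ultimately have v_eq: "v = jacobian k (\<phi>' \<circ> restrict (p \<circ> a) Q) r w" using jacobian_id[OF v] by simp
    define Q1 where "Q1 = {z \<in> Q. a z \<in> V}"
    have Q1: "openin (Euclidean_space k) Q1" unfolding Q1_def by (rule openin_plot_preimage[OF DE a(1) V(1)])
    have \<phi>a: "smooth_map k Q1 n \<Phi> (\<phi> \<circ> a)" unfolding Q1_def \<Phi>_def by (rule \<phi>[OF a(1)])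
    \<comment> \<open>Shrinks the domain until \<open>\<phi> \<circ> a\<close> lands in the domain
      \<open>U\<close> of \<open>f\<close>, as the chain rule requires.\<close>
    define Q2 where "Q2 = {z \<in> Q1. (\<phi> \<circ> a) z \<in> U}"
    have Q2: "openin (Euclidean_space k) Q2"
      unfolding Q2_def by (rule openin_preimage_open[OF Q1 smooth_map_continuous[OF \<phi>a] U])
    have \<phi>a2: "smooth_map k Q2 n U (\<phi> \<circ> a)"
      by (rule smooth_map_subset[OF \<phi>a]) (auto simp: Q2_def U_def)
    have r: "r \<in> Q2" using a(2,4) V(3) x0 by (simp add: Q2_def Q1_def x0_def)
    have "jacobian k (f \<circ> (\<phi> \<circ> a)) r w = jacobian n f ((\<phi> \<circ> a) r) (jacobian k (\<phi> \<circ> a) r w)"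
      by (rule jacobian_compose[OF Q2 U \<phi>a2 smooth_fun_component[OF U f] r])
    moreover have "jacobian k (f \<circ> (\<phi> \<circ> a)) r w = jacobian k (\<phi>' \<circ> restrict (p \<circ> a) Q) r w"
    proof (rule jacobian_cong[OF Q2 _ r])
      fix z assume "z \<in> Q2"
      then have "a z \<in> V" "z \<in> Q" by (auto simp: Q2_def Q1_def)
      then show "(f \<circ> (\<phi> \<circ> a)) z = (\<phi>' \<circ> restrict (p \<circ> a) Q) z"
        using \<kappa>\<phi> by (simp add: f_def q_def \<Phi>_def)
    qed
    ultimately have "jacobian n f x0 (jacobian k (\<phi> \<circ> a) r w) = v"
      using v_eq a(4) by (simp add: x0_def)
    then show ?thesis by blast
  qed
  have inverse_function_x0: "\<exists>W S g. openin (Euclidean_space n) W \<and> x0 \<in> W \<and> W \<subseteq> U \<and>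
    openin (Euclidean_space n) S \<and> f \<in> W \<rightarrow> S \<and> smooth_map n S n W g \<and>
    (\<forall>x\<in>W. g (f x) = x) \<and> (\<forall>y\<in>S. f (g y) = y)"
    by (rule inverse_function[OF U f x0 surj])
  obtain W0 S0 g where W0: "openin (Euclidean_space n) W0" "x0 \<in> W0" "W0 \<subseteq> U"
    and S0: "openin (Euclidean_space n) S0" "f \<in> W0 \<rightarrow> S0" "smooth_map n S0 n W0 g"
    and gf': "\<forall>x\<in>W0. g (f x) = x" and fg': "\<forall>y\<in>S0. f (g y) = y"
    using inverse_function_x0 by (elim exE conjE)
  have gf: "g (f x) = x" if "x \<in> W0" for x using gf' that by blast
  have fg: "f (g y) = y" if "y \<in> S0" for y using fg' that by blast
  have gW0: "g y \<in> W0" if "y \<in> S0" for y using S0(3) that unfolding smooth_map_def by blast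
  define W where "W = {x\<in>V. \<phi> x \<in> W0}"
  define S where "S = {y\<in>V'. \<phi>' y \<in> S0}"
  define \<sigma> where "\<sigma> y = \<kappa> (g (\<phi>' y))" for y
  have Wop: "openin (D_topology E) W"
    unfolding openin_D_topology
  proof (intro conjI ballI)
    show "W \<subseteq> Pts E" using V(2) by (auto simp: W_def)
    fix P assume P: "P \<in> Plots E"
    obtain k Q a where [simp]: "P = (k, Q, a)" by (cases P)
    have a: "(k, Q, a) \<in> Plots E" using P by simp
    have "openin (Euclidean_space k) {r \<in> {r\<in>Q. a r \<in> V}. (\<phi> \<circ> a) r \<in> W0}"
      by (rule openin_preimage_open[OF openin_plot_preimage[OF DE a V(1)] smooth_map_continuous[OF \<phi>[OF a]] W0(1)])
    moreover have "{r \<in> {r\<in>Q. a r \<in> V}. (\<phi> \<circ> a) r \<in> W0} = {r\<in>Q. a r \<in> W}" by (auto simp: W_def)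
    ultimately show "case P of (n, U, p) \<Rightarrow> openin (Euclidean_space n) {r \<in> U. p r \<in> W}" by simp
  qed
  have Sop: "openin (D_topology B) S"
    unfolding openin_D_topology
  proof (intro conjI ballI)
    show "S \<subseteq> Pts B" using V'(2) by (auto simp: S_def)
    fix P assume P: "P \<in> Plots B"
    obtain k Q a where [simp]: "P = (k, Q, a)" by (cases P)
    have a: "(k, Q, a) \<in> Plots B" using P by simp
    have "openin (Euclidean_space k) {r \<in> {r\<in>Q. a r \<in> V'}. (\<phi>' \<circ> a) r \<in> S0}"
      by (rule openin_preimage_open[OF openin_plot_preimage[OF DB a V'(1)] smooth_map_continuous[OF \<phi>'[OF a]] S0(1)])
    moreover have "{r \<in> {r\<in>Q. a r \<in> V'}. (\<phi>' \<circ> a) r \<in> S0} = {r\<in>Q. a r \<in> S}" by (auto simp: S_def)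
    ultimately show "case P of (n, U, p) \<Rightarrow> openin (Euclidean_space n) {r \<in> U. p r \<in> S}" by simp
  qed
  have eW: "e \<in> W" using V(3) W0(2) by (simp add: W_def x0_def)
  have qW: "q (\<phi> x) = p x" "p x \<in> V'" if "x \<in> W" for x
  proof -
    have "x \<in> V" "\<phi> x \<in> U" using that W0(3) by (auto simp: W_def)
    then show "q (\<phi> x) = p x" "p x \<in> V'" using \<kappa>\<phi> by (auto simp: q_def U_def \<Phi>_def)
  qed
  have pW: "p ` W \<subseteq> S"
  proof
    fix y assume "y \<in> p ` W"
    then obtain x where x: "x \<in> W" "y = p x" by blast
    have "\<phi>' (p x) = f (\<phi> x)" using qW[OF x(1)] by (simp add: f_def)
    moreover have "f (\<phi> x) \<in> S0" using x(1) S0(2) by (auto simp: W_def)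
    ultimately show "y \<in> S" using qW[OF x(1)] x(2) by (simp add: S_def)
  qed
  have \<sigma>p: "\<sigma> (p x) = x" if x: "x \<in> W" for x
  proof -
    have "\<phi>' (p x) = f (\<phi> x)" using qW[OF x] by (simp add: f_def)
    then show ?thesis using gf[of "\<phi> x"] x \<kappa>\<phi> by (simp add: \<sigma>_def W_def)
  qed
  have p\<sigma>: "p (\<sigma> y) = y \<and> \<sigma> y \<in> W" if y: "y \<in> S" for y
  proof -
    have z: "\<phi>' y \<in> S0" "y \<in> V'" using y by (auto simp: S_def)
    define x where "x = g (\<phi>' y)"
    have x: "x \<in> W0" "f x = \<phi>' y" using gW0 fg z by (auto simp: x_def)
    have xU: "x \<in> \<Phi>" "q x \<in> V'" using x(1) W0(3) by (auto simp: U_def)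
    have \<sigma>x: "\<sigma> y = \<kappa> x" by (simp add: \<sigma>_def x_def)
    have "\<sigma> y \<in> W" unfolding \<sigma>x W_def using \<phi>\<kappa>[of x] xU x by (simp add: \<Phi>_def)
    moreover have "p (\<sigma> y) = q x" using xU by (simp add: q_def \<sigma>x)
    moreover have "q x = y"
    proof -
      have "\<kappa>' (\<phi>' (q x)) = \<kappa>' (\<phi>' y)" using x(2) by (simp add: f_def)
      then show ?thesis unfolding \<kappa>\<phi>'[OF xU(2)] \<kappa>\<phi>'[OF z(2)] .
    qed
    ultimately show ?thesis by simp
  qed
  have "smooth_between (sub_diffeology B S) E \<sigma>"
    unfolding smooth_between_def
  proof (intro conjI ballI)
    have "W \<subseteq> Pts E" using V(2) by (auto simp: W_def)
    then show "\<sigma> \<in> Pts (sub_diffeology B S) \<rightarrow> Pts E" using p\<sigma> by (auto simp: sub_diffeology_def)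
    fix P assume P: "P \<in> Plots (sub_diffeology B S)"
    obtain k Q a where Pa [simp]: "P = (k, Q, a)" by (cases P)
    have a: "(k, Q, a) \<in> Plots B" "a \<in> Q \<rightarrow> S" using P by (auto simp: sub_diffeology_def)
    have Q: "openin (Euclidean_space k) Q" by (rule plot_domain_open[OF DB a(1)])
    have "{r\<in>Q. a r \<in> V'} = Q" using a(2) by (auto simp: S_def)
    then have "smooth_map k Q n \<Phi>' (\<phi>' \<circ> a)" using \<phi>'[OF a(1)] by (simp add: \<Phi>'_def)
    then have "smooth_map k Q n S0 (\<phi>' \<circ> a)"
    proof (rule smooth_map_subset)
      show "(\<phi>' \<circ> a) ` Q \<subseteq> S0" using a(2) by (auto simp: S_def)
      show "S0 \<subseteq> \<Phi>'"
      proof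
        fix y assume y: "y \<in> S0"
        then have "g y \<in> U" using gW0 W0(3) by blast
        then have "f (g y) \<in> \<Phi>'" using f unfolding smooth_map_def by blast
        then show "y \<in> \<Phi>'" using fg[OF y] by simp
      qed
    qed simp
    then have "smooth_map k Q n W0 (g \<circ> (\<phi>' \<circ> a))"
      by (rule smooth_map_compose[OF Q S0(1) _ S0(3)])
    then have "smooth_map k Q n (\<phi> ` V) (g \<circ> (\<phi>' \<circ> a))"
      by (rule smooth_map_codomain) (use W0(3) openin_subset[OF \<Phi>] in \<open>auto simp: U_def \<Phi>_def\<close>)
    then have "(k, Q, restrict (\<kappa> \<circ> (g \<circ> (\<phi>' \<circ> a))) Q) \<in> Plots E"
      by (rule plot_compose[OF DE V(4) Q])
    moreover have "restrict (\<kappa> \<circ> (g \<circ> (\<phi>' \<circ> a))) Q = restrict (\<sigma> \<circ> a) Q" by (auto simp: \<sigma>_def)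
    ultimately show "case P of (n, U, p) \<Rightarrow> (n, U, restrict (\<sigma> \<circ> p) U) \<in> Plots E" by simp
  qed
  then show ?thesis using Wop eW Sop pW \<sigma>p p\<sigma> by blast
qed

text \<open>Injectivity of the tangent map on fibres, phrased without the linear structure of the fibres.\<close>

definition immersive :: "'a diffeology \<Rightarrow> 'b diffeology \<Rightarrow> ('a \<Rightarrow> 'b) \<Rightarrow> bool" where
  "immersive E B p \<longleftrightarrow> (\<forall>(n, U, q) \<in> Plots E. \<forall>r\<in>U. \<forall>v\<in>Rn n.
     tangent_class 1 B (n, U, restrict (p \<circ> q) U) r [v] \<in> zero_vectors B \<longrightarrow>
     tangent_class 1 E (n, U, q) r [v] \<in> zero_vectors E)"

lemma immersiveD:
  "immersive E B p \<Longrightarrow> (n, U, q) \<in> Plots E \<Longrightarrow> r \<in> U \<Longrightarrow> v \<in> Rn n \<Longrightarrow>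
    tangent_class 1 B (n, U, restrict (p \<circ> q) U) r [v] \<in> zero_vectors B \<Longrightarrow>
     tangent_class 1 E (n, U, q) r [v] \<in> zero_vectors E"
  unfolding immersive_def by fast

text \<open>A tangent map changes only the plot of a representative, so a representative with zero
  vector is sent to another such representative.\<close>

lemma zero_vectors_map:
  assumes X: "diffeological_space X" and Y: "diffeological_space Y" and h: "smooth_between X Y h"
    and a: "(n, U, p) \<in> Plots X" "r \<in> U" "v \<in> Rn n" and z: "tangent_class 1 X (n, U, p) r [v] \<in> zero_vectors X"
  shows "tangent_class 1 Y (n, U, restrict (h \<circ> p) U) r [v] \<in> zero_vectors Y"
proof -
  obtain m V q s where q: "(m, V, q) \<in> Plots X" "s \<in> V"
    and eq: "tangent_class 1 X (n, U, p) r [v] = tangent_class 1 X (m, V, q) s [\<lambda>_. 0]"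
    using z unfolding zero_vectors_def by blast
  have "tangent_class 1 Y (n, U, restrict (h \<circ> p) U) r [v] = tangent_map 1 Y h (tangent_class 1 X (n, U, p) r [v])"
    by (rule tangent_map_class[OF X Y h, symmetric]) (use a in auto)
  also have "\<dots> = tangent_class 1 Y (m, V, restrict (h \<circ> q) V) s [\<lambda>_. 0]"
    unfolding eq by (rule tangent_map_class[OF X Y h]) (use q in auto)
  finally show ?thesis
    using smooth_between_plot[OF h q(1)] q(2) unfolding zero_vectors_def by blast
qed

lemma immersive_left_inverse:
  assumes X: "diffeological_space X" and Y: "diffeological_space Y"
    and e: "smooth_between X Y e" and f: "smooth_between Y X f" and fe: "\<And>x. x \<in> Pts X \<Longrightarrow> f (e x) = x"
  shows "immersive X Y e"
  unfolding immersive_def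
proof (clarify)
  fix n U q r v
  assume q: "(n, U, q) \<in> Plots X" "r \<in> U" "v \<in> Rn n"
    and z: "tangent_class 1 Y (n, U, restrict (e \<circ> q) U) r [v] \<in> zero_vectors Y"
  have "restrict (f \<circ> (e \<circ> q)) U = restrict q U" using fe plot_in[OF X q(1)] by (auto simp: restrict_def)
  then show "tangent_class 1 X (n, U, q) r [v] \<in> zero_vectors X"
    using zero_vectors_map[OF Y X f smooth_between_plot[OF e q(1)] q(2,3) z] plot_extensional[OF X q(1)] by simp
qed

lemma sub_diffeology_plot_restrict:
  assumes "diffeological_space B" "openin (D_topology B) S" "(n, U, q) \<in> Plots B"
  shows "(n, {z\<in>U. q z \<in> S}, restrict q {z\<in>U. q z \<in> S}) \<in> Plots (sub_diffeology B S)"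
  using plot_restrict[OF assms(1,3) openin_plot_preimage[OF assms(1,3,2)]]
  by (auto simp: sub_diffeology_def)

text \<open>A chain in \<open>B\<close> from the image of a vector to a zero vector is lifted to
  \<open>E\<close> by composing its plots with the section. The section lives only over
  \<open>S\<close>, but the base point is constant along the chain, so each plot can be restricted
  to the preimage of \<open>S\<close>.\<close>

lemma immersive_local_sections:
  assumes E: "diffeological_space E" and B: "diffeological_space B" and p: "smooth_between E B p"
    and loc: "\<And>e. e \<in> Pts E \<Longrightarrow> \<exists>W S \<sigma>. openin (D_topology E) W \<and> e \<in> W \<and> openin (D_topology B) S \<and>
      p ` W \<subseteq> S \<and> smooth_between (sub_diffeology B S) E \<sigma> \<and> (\<forall>g\<in>W. \<sigma> (p g) = g)"
  shows "immersive E B p"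
  unfolding immersive_def
proof (clarify)
  fix n U P r v
  assume P: "(n, U, P) \<in> Plots E" and r: "r \<in> U" and v: "v \<in> Rn n"
    and z: "tangent_class 1 B (n, U, restrict (p \<circ> P) U) r [v] \<in> zero_vectors B"
  obtain m V Q s where Q: "(m, V, Q) \<in> Plots B" "s \<in> V"
    and eq: "tangent_class 1 B (n, U, restrict (p \<circ> P) U) r [v] = tangent_class 1 B (m, V, Q) s [\<lambda>_. 0]"
    using z unfolding zero_vectors_def by blast
  obtain W S \<sigma> where W: "openin (D_topology E) W" "P r \<in> W" and S: "openin (D_topology B) S" "p ` W \<subseteq> S"
    and \<sigma>: "smooth_between (sub_diffeology B S) E \<sigma>" "\<forall>g\<in>W. \<sigma> (p g) = g"
    using loc[OF plot_in[OF E P r]] by blast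
  define res where "res U q = {z\<in>U. q z \<in> S}" for U :: "rvec set" and q :: "rvec \<Rightarrow> 'b"
  have \<sigma>q: "(k, res U q, restrict (\<sigma> \<circ> q) (res U q)) \<in> Plots E" if "(k, U, q) \<in> Plots B" for k U q
    using smooth_between_plot[OF \<sigma>(1) sub_diffeology_plot_restrict[OF B S(1) that]] by (simp add: res_def)
  have op: "openin (Euclidean_space k) (res U q)" if "(k, U, q) \<in> Plots B" for k U q
    unfolding res_def by (rule openin_plot_preimage[OF B that S(1)])
  \<comment> \<open>The default \<open>{}\<close> is not a class of a genuine representative. This
    is used below to conclude that the far end \<open>Q s\<close> of the chain also lies in
    \<open>S\<close>.\<close>
  define F where "F = (\<lambda>((k, U, q), r, vs).
     if q r \<in> S then tangent_class 1 E (k, res U q, restrict (\<sigma> \<circ> q) (res U q)) r vs else {})"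
  have "F a = F b" if ab: "a \<in> pre_tangent_set 1 B" "b \<in> pre_tangent_set 1 B" "tangent_step B a b" for a b
  proof -
    obtain n U p m V q f r vs where *: "(n, U, p) \<in> Plots B" "(m, V, q) \<in> Plots B" "smooth_map n U m V f"
      "\<forall>x\<in>U. q (f x) = p x"
      "r \<in> U" "set vs \<subseteq> Rn n" "a = ((n, U, p), r, vs)" "b = ((m, V, q), f r, map (jacobian n f r) vs)"
      using ab(3) unfolding tangent_step_def by blast
    have len: "length vs = 1" using ab(1) *(7) by (auto simp: mem_pre_tangent_set)
    show ?thesis
    proof (cases "p r \<in> S")
      case True
      have fV: "f ` U \<subseteq> V" using *(3) unfolding smooth_map_def by blast
      have f: "smooth_map n (res U p) m (res V q) f"
        by (rule smooth_map_subset[OF *(3)]) (use fV *(4) in \<open>auto simp: res_def\<close>)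
      have "restrict (restrict (\<sigma> \<circ> q) (res V q) \<circ> f) (res U p) = restrict (\<sigma> \<circ> p) (res U p)"
        by (rule restrict_ext) (use fV *(4) in \<open>auto simp: res_def\<close>)
      moreover have "r \<in> res U p" using True *(5) by (simp add: res_def)
      ultimately show ?thesis
        using tangent_class_compose[OF E \<sigma>q[OF *(2)] op[OF *(1)] f _ *(6) len] True *(4,5)
        by (simp add: F_def *(7,8))
    next
      case False
      then show ?thesis using *(4,5) by (simp add: F_def *(7,8))
    qed
  qed
  moreover have pP: "(n, U, restrict (p \<circ> P) U) \<in> Plots B" by (rule smooth_between_plot[OF p P])
  ultimately have Feq: "F ((n, U, restrict (p \<circ> P) U), r, [v]) = F ((m, V, Q), s, [\<lambda>_. 0])"
    using r v Q by (intro tangent_class_invariant[OF B eq]) (auto simp: mem_pre_tangent_set)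
  define U' where "U' = res U (restrict (p \<circ> P) U)"
  define Z where "Z = {z\<in>U. P z \<in> W}"
  have Zop: "openin (Euclidean_space n) Z" unfolding Z_def by (rule openin_plot_preimage[OF E P W(1)])
  have rZ: "r \<in> Z" using r W(2) by (simp add: Z_def)
  have ZU': "Z \<subseteq> U'" using S(2) by (auto simp: Z_def U'_def res_def)
  have c1: "tangent_class 1 E (n, U, P) r [v] = tangent_class 1 E (n, U', restrict (\<sigma> \<circ> restrict (p \<circ> P) U) U') r [v]"
  proof (rule tangent_class_local_eq[OF E P \<sigma>q[OF pP, folded U'_def] Zop _ ZU' _ rZ])
    show "P z = restrict (\<sigma> \<circ> restrict (p \<circ> P) U) U' z" if "z \<in> Z" for z
    proof -
      have "z \<in> U'" "z \<in> U" "P z \<in> W" using that ZU' by (auto simp: Z_def)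
      then show ?thesis using \<sigma>(2) by simp
    qed
  qed (use v in \<open>auto simp: Z_def\<close>)
  moreover have "F ((n, U, restrict (p \<circ> P) U), r, [v]) =
      tangent_class 1 E (n, U', restrict (\<sigma> \<circ> restrict (p \<circ> P) U) U') r [v]"
    using r rZ ZU' by (auto simp: F_def U'_def res_def)
  ultimately have c2: "tangent_class 1 E (n, U, P) r [v] = F ((m, V, Q), s, [\<lambda>_. 0])" using Feq by simp
  have "tangent_class 1 E (n, U, P) r [v] \<noteq> {}"
    using tangent_class_self[of "(n, U, P)" r "[v]" 1 E] P r v by (auto simp: mem_pre_tangent_set)
  then have Qs: "Q s \<in> S" using c2 by (auto simp: F_def split: if_splits)
  then have "tangent_class 1 E (n, U, P) r [v] =
      tangent_class 1 E (m, res V Q, restrict (\<sigma> \<circ> Q) (res V Q)) s [\<lambda>_. 0]"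
    using c2 by (simp add: F_def)
  then show "tangent_class 1 E (n, U, P) r [v] \<in> zero_vectors E"
    using \<sigma>q[OF Q(1)] Qs Q(2) unfolding zero_vectors_def by (auto simp: res_def)
qed

section \<open>Products, subspaces and open domains\<close>

lemma diffeological_space_sub:
  assumes X: "diffeological_space X"
  shows "diffeological_space (sub_diffeology X S)"
proof (rule diffeological_spaceI)
  fix n U p assume "(n, U, p) \<in> Plots (sub_diffeology X S)"
  then have p: "(n, U, p) \<in> Plots X" "p \<in> U \<rightarrow> S" by (auto simp: sub_diffeology_def)
  show "openin (Euclidean_space n) U \<and> p \<in> U \<rightarrow>\<^sub>E Pts (sub_diffeology X S)"
    using plotD[OF X p(1)] p(2) by (auto simp: sub_diffeology_def PiE_iff)
next
  fix n U x assume "x \<in> Pts (sub_diffeology X S)" "openin (Euclidean_space n) U"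
  then show "(n, U, \<lambda>_\<in>U. x) \<in> Plots (sub_diffeology X S)"
    using plot_const[OF X] by (auto simp: sub_diffeology_def)
next
  fix n U m V q f
  assume U: "openin (Euclidean_space n) U" and q: "(m, V, q) \<in> Plots (sub_diffeology X S)" and f: "smooth_map n U m V f"
  show "(n, U, restrict (q \<circ> f) U) \<in> Plots (sub_diffeology X S)"
    using q plot_compose[OF X _ U f] smooth_map_image[OF f] by (auto simp: sub_diffeology_def)
next
  fix n U p assume U: "openin (Euclidean_space n) U" and p: "p \<in> U \<rightarrow>\<^sub>E Pts (sub_diffeology X S)"
    and loc: "\<And>r. r \<in> U \<Longrightarrow> \<exists>V. openin (Euclidean_space n) V \<and> r \<in> V \<and> V \<subseteq> U \<and>
      (n, V, restrict p V) \<in> Plots (sub_diffeology X S)"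
  have "(n, U, p) \<in> Plots X"
  proof (rule plot_local[OF X U])
    show "p \<in> U \<rightarrow>\<^sub>E Pts X" using p by (auto simp: sub_diffeology_def PiE_iff)
    show "\<exists>V. openin (Euclidean_space n) V \<and> r \<in> V \<and> V \<subseteq> U \<and> (n, V, restrict p V) \<in> Plots X" if "r \<in> U" for r
      using loc[OF that] by (auto simp: sub_diffeology_def)
  qed
  then show "(n, U, p) \<in> Plots (sub_diffeology X S)"
    using p by (auto simp: sub_diffeology_def PiE_iff)
qed

lemma diffeological_space_prod:
  assumes X: "diffeological_space X" and Y: "diffeological_space Y"
  shows "diffeological_space (prod_diffeology X Y)"
proof (rule diffeological_spaceI)
  fix n U p assume "(n, U, p) \<in> Plots (prod_diffeology X Y)"
  then have p: "p \<in> extensional U" "(n, U, restrict (fst \<circ> p) U) \<in> Plots X" "(n, U, restrict (snd \<circ> p) U) \<in> Plots Y"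
    by (auto simp: prod_diffeology_def)
  have "fst (p r) \<in> Pts X" "snd (p r) \<in> Pts Y" if "r \<in> U" for r
    using plot_in[OF X p(2) that] plot_in[OF Y p(3) that] that by auto
  then show "openin (Euclidean_space n) U \<and> p \<in> U \<rightarrow>\<^sub>E Pts (prod_diffeology X Y)"
    using plot_domain_open[OF X p(2)] p(1) by (auto simp: prod_diffeology_def PiE_iff mem_Times_iff)
next
  fix n U x assume x: "x \<in> Pts (prod_diffeology X Y)" and U: "openin (Euclidean_space n) U"
  have "restrict (fst \<circ> (\<lambda>_\<in>U. x)) U = (\<lambda>_\<in>U. fst x)" "restrict (snd \<circ> (\<lambda>_\<in>U. x)) U = (\<lambda>_\<in>U. snd x)"
    by (auto simp: restrict_def)
  then show "(n, U, \<lambda>_\<in>U. x) \<in> Plots (prod_diffeology X Y)"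
    using plot_const[OF X _ U] plot_const[OF Y _ U] x by (auto simp: prod_diffeology_def)
next
  fix n U m V q f
  assume U: "openin (Euclidean_space n) U" and q: "(m, V, q) \<in> Plots (prod_diffeology X Y)" and f: "smooth_map n U m V f"
  have e: "restrict (restrict (fst \<circ> q) V \<circ> f) U = restrict (fst \<circ> (q \<circ> f)) U"
    "restrict (restrict (snd \<circ> q) V \<circ> f) U = restrict (snd \<circ> (q \<circ> f)) U"
    using smooth_map_image[OF f] by (auto intro!: restrict_ext)
  have "(n, U, restrict (restrict (fst \<circ> q) V \<circ> f) U) \<in> Plots X"
    by (rule plot_compose[OF X _ U f]) (use q in \<open>simp add: prod_diffeology_def\<close>)
  moreover have "(n, U, restrict (restrict (snd \<circ> q) V \<circ> f) U) \<in> Plots Y"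
    by (rule plot_compose[OF Y _ U f]) (use q in \<open>simp add: prod_diffeology_def\<close>)
  ultimately show "(n, U, restrict (q \<circ> f) U) \<in> Plots (prod_diffeology X Y)"
    unfolding e by (simp add: prod_diffeology_def)
next
  fix n U p assume U: "openin (Euclidean_space n) U" and p: "p \<in> U \<rightarrow>\<^sub>E Pts (prod_diffeology X Y)"
    and loc: "\<And>r. r \<in> U \<Longrightarrow> \<exists>V. openin (Euclidean_space n) V \<and> r \<in> V \<and> V \<subseteq> U \<and>
      (n, V, restrict p V) \<in> Plots (prod_diffeology X Y)"
  have r1: "restrict (restrict (fst \<circ> p) U) V = restrict (fst \<circ> p) V"
    and r2: "restrict (restrict (snd \<circ> p) U) V = restrict (snd \<circ> p) V" if "V \<subseteq> U" for V
    using that by (simp_all add: Int_absorb1)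
  have "(n, U, restrict (fst \<circ> p) U) \<in> Plots X"
  proof (rule plot_local[OF X U])
    show "restrict (fst \<circ> p) U \<in> U \<rightarrow>\<^sub>E Pts X" using p by (auto simp: prod_diffeology_def PiE_iff mem_Times_iff)
    fix r assume "r \<in> U"
    then obtain V where "openin (Euclidean_space n) V" "r \<in> V" "V \<subseteq> U" "(n, V, restrict p V) \<in> Plots (prod_diffeology X Y)"
      using loc by blast
    then show "\<exists>V. openin (Euclidean_space n) V \<and> r \<in> V \<and> V \<subseteq> U \<and> (n, V, restrict (restrict (fst \<circ> p) U) V) \<in> Plots X"
      using r1 by (intro exI[of _ V]) (simp add: prod_diffeology_def)
  qed
  moreover have "(n, U, restrict (snd \<circ> p) U) \<in> Plots Y"
  proof (rule plot_local[OF Y U])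
    show "restrict (snd \<circ> p) U \<in> U \<rightarrow>\<^sub>E Pts Y" using p by (auto simp: prod_diffeology_def PiE_iff mem_Times_iff)
    fix r assume "r \<in> U"
    then obtain V where "openin (Euclidean_space n) V" "r \<in> V" "V \<subseteq> U" "(n, V, restrict p V) \<in> Plots (prod_diffeology X Y)"
      using loc by blast
    then show "\<exists>V. openin (Euclidean_space n) V \<and> r \<in> V \<and> V \<subseteq> U \<and> (n, V, restrict (restrict (snd \<circ> p) U) V) \<in> Plots Y"
      using r2 by (intro exI[of _ V]) (simp add: prod_diffeology_def)
  qed
  ultimately show "(n, U, p) \<in> Plots (prod_diffeology X Y)"
    using p by (auto simp: prod_diffeology_def PiE_iff)
qed

lemma smooth_map_local:
  assumes U: "openin (Euclidean_space n) U" and V: "V \<subseteq> Rn m" and fV: "f \<in> U \<rightarrow> V"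
    and loc: "\<And>r. r \<in> U \<Longrightarrow> \<exists>W. openin (Euclidean_space n) W \<and> r \<in> W \<and> W \<subseteq> U \<and> smooth_map n W m V f"
  shows "smooth_map n U m V f"
  unfolding smooth_map_def
proof (intro conjI allI impI V fV)
  show "U \<subseteq> Rn n" using U openin_subset by blast
  fix j assume j: "j < m"
  show "smooth_fun n U (\<lambda>x. f x j)"
  proof (rule smooth_fun_local[OF U])
    fix z assume "z \<in> U"
    then obtain W where "openin (Euclidean_space n) W" "z \<in> W" "W \<subseteq> U" "smooth_map n W m V f" using loc by blast
    then show "\<exists>V. openin (Euclidean_space n) V \<and> z \<in> V \<and> V \<subseteq> U \<and> smooth_fun n V (\<lambda>x. f x j)"
      using j unfolding smooth_map_def by blast
  qed
qed

lemma mem_Plots_open_diffeology: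
  "(m, V, f) \<in> Plots (open_diffeology n U) \<longleftrightarrow>
     openin (Euclidean_space m) V \<and> f \<in> extensional V \<and> smooth_map m V n U f"
  by (simp add: open_diffeology_def)

lemma diffeological_space_open:
  assumes U: "openin (Euclidean_space n) U"
  shows "diffeological_space (open_diffeology n U)"
proof (rule diffeological_spaceI)
  fix m V f assume "(m, V, f) \<in> Plots (open_diffeology n U)"
  then show "openin (Euclidean_space m) V \<and> f \<in> V \<rightarrow>\<^sub>E Pts (open_diffeology n U)"
    unfolding mem_Plots_open_diffeology by (auto simp: open_diffeology_def PiE_iff smooth_map_image)
next
  fix m V x assume "x \<in> Pts (open_diffeology n U)" and V: "openin (Euclidean_space m) V"
  then have "smooth_map m V n U (\<lambda>_. x)"
    using openin_subset[OF U] openin_subset[OF V] by (intro smooth_map_const) (auto simp: open_diffeology_def)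
  then have "smooth_map m V n U (\<lambda>_\<in>V. x)" by (rule smooth_map_cong[OF _ V]) simp
  then show "(m, V, \<lambda>_\<in>V. x) \<in> Plots (open_diffeology n U)"
    unfolding mem_Plots_open_diffeology using V by simp
next
  fix m V k W q f
  assume V: "openin (Euclidean_space m) V" and q: "(k, W, q) \<in> Plots (open_diffeology n U)" and f: "smooth_map m V k W f"
  have "smooth_map m V n U (q \<circ> f)"
    using q smooth_map_compose[OF V _ f] unfolding mem_Plots_open_diffeology by blast
  then have "smooth_map m V n U (restrict (q \<circ> f) V)" by (rule smooth_map_cong[OF _ V]) simp
  then show "(m, V, restrict (q \<circ> f) V) \<in> Plots (open_diffeology n U)"
    unfolding mem_Plots_open_diffeology using V by simp
next
  fix m V p assume V: "openin (Euclidean_space m) V" and p: "p \<in> V \<rightarrow>\<^sub>E Pts (open_diffeology n U)"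
    and loc: "\<And>r. r \<in> V \<Longrightarrow> \<exists>W. openin (Euclidean_space m) W \<and> r \<in> W \<and> W \<subseteq> V \<and>
      (m, W, restrict p W) \<in> Plots (open_diffeology n U)"
  have "smooth_map m V n U p"
  proof (rule smooth_map_local[OF V openin_subset[OF U]])
    show "p \<in> V \<rightarrow> U" using p by (auto simp: open_diffeology_def)
    fix r assume "r \<in> V"
    then obtain W where W: "openin (Euclidean_space m) W" "r \<in> W" "W \<subseteq> V" "smooth_map m W n U (restrict p W)"
      using loc unfolding mem_Plots_open_diffeology by blast
    have "smooth_map m W n U p" by (rule smooth_map_cong[OF W(4,1)]) simp
    then show "\<exists>W. openin (Euclidean_space m) W \<and> r \<in> W \<and> W \<subseteq> V \<and> smooth_map m W n U p" using W by blast
  qed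
  then show "(m, V, p) \<in> Plots (open_diffeology n U)"
    unfolding mem_Plots_open_diffeology using V p by (auto simp: PiE_iff)
qed

lemma smooth_between_plot_map:
  assumes X: "diffeological_space X" and p: "(n, U, p) \<in> Plots X"
  shows "smooth_between (open_diffeology n U) X p"
  unfolding smooth_between_def
proof (intro conjI ballI)
  show "p \<in> Pts (open_diffeology n U) \<rightarrow> Pts X" using plot_in[OF X p] by (auto simp: open_diffeology_def)
  fix P assume P: "P \<in> Plots (open_diffeology n U)"
  obtain m V f where [simp]: "P = (m, V, f)" by (cases P)
  show "case P of (m, V, f) \<Rightarrow> (m, V, restrict (p \<circ> f) V) \<in> Plots X"
    using P plot_compose[OF X p] by (simp add: mem_Plots_open_diffeology)
qed

lemma tangent_plot_in_Pts:
  assumes "(l, W, \<sigma>) \<in> Plots (tangent k X)" "z \<in> W"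
  shows "\<sigma> z \<in> Pts (tangent k X)"
proof -
  obtain W' n U p \<rho> \<nu> where W': "openin (Euclidean_space l) W'" "z \<in> W'" "W' \<subseteq> W" "(n, U, p) \<in> Plots X"
       "smooth_map l W' n U \<rho>" "length \<nu> = k" "\<forall>v \<in> set \<nu>. smooth_map l W' n (Rn n) v"
       "\<forall>y\<in>W'. \<sigma> y = tangent_class k X (n, U, p) (\<rho> y) (map (\<lambda>v. v y) \<nu>)"
    using tangent_plotD(3)[OF assms] by blast
  have "tangent_class k X (n, U, p) (\<rho> z) (map (\<lambda>v. v z) \<nu>) \<in> Pts (tangent k X)"
    by (rule tangent_class_in_Pts[OF W'(4)]) (use W'(2,5,6,7) in \<open>auto intro: smooth_map_image\<close>)
  then show ?thesis using W'(2,8) by simp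
qed

lemma smooth_real_cong:
  assumes "smooth_between (tangent k X) real_diffeology h" "\<And>\<tau>. \<tau> \<in> Pts (tangent k X) \<Longrightarrow> h \<tau> = h' \<tau>"
  shows "smooth_between (tangent k X) real_diffeology h'"
  unfolding smooth_between_real
proof (clarify)
  fix n U p assume p: "(n, U, p) \<in> Plots (tangent k X)"
  have h: "openin (Euclidean_space n) U \<and> smooth_fun n U (h \<circ> p)"
    using assms(1) p unfolding smooth_between_real by fast
  then have U: "openin (Euclidean_space n) U" ..
  have "smooth_fun n U (h \<circ> p) \<longleftrightarrow> smooth_fun n U (h' \<circ> p)"
    by (rule smooth_fun_cong[OF U]) (simp add: assms(2) tangent_plot_in_Pts[OF p])
  then show "openin (Euclidean_space n) U \<and> smooth_fun n U (h' \<circ> p)" using h by simp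
qed

text \<open>A constant vector carried along a plot is a plot of the tangent space. This provides the
  continuity used when values on two lifts are compared on a dense set.\<close>

lemma smooth_real_tangent_const:
  assumes X: "diffeological_space X" and h: "smooth_between (tangent k X) real_diffeology h"
    and p: "(n, U, p) \<in> Plots X" and vs: "set vs \<subseteq> Rn n" "length vs = k"
  shows "smooth_fun n U (\<lambda>z. h (tangent_class k X (n, U, p) z vs))"
proof -
  have U: "openin (Euclidean_space n) U" by (rule plot_domain_open[OF X p])
  define \<sigma> where "\<sigma> = (\<lambda>z\<in>U. tangent_class k X (n, U, p) z vs)"
  have "(n, U, \<sigma>) \<in> Plots (tangent k X)"
  proof (rule tangent_plotI[OF U])
    show "\<sigma> \<in> extensional U" by (simp add: \<sigma>_def)
    have "smooth_map n U n U id" using smooth_map_id[OF U] by blast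
    moreover have "smooth_map n U n (Rn n) (\<lambda>_. v)" if "v \<in> set vs" for v
      by (rule smooth_map_const) (use vs that openin_subset[OF U] in auto)
    ultimately show "\<exists>W' n' U' p' \<rho> \<nu>. openin (Euclidean_space n) W' \<and> z \<in> W' \<and> W' \<subseteq> U \<and> (n', U', p') \<in> Plots X \<and>
       smooth_map n W' n' U' \<rho> \<and> length \<nu> = k \<and> (\<forall>v \<in> set \<nu>. smooth_map n W' n' (Rn n') v) \<and>
       (\<forall>y\<in>W'. \<sigma> y = tangent_class k X (n', U', p') (\<rho> y) (map (\<lambda>v. v y) \<nu>))" if "z \<in> U" for z
      using U that p vs
      by (intro exI[of _ U] exI[of _ n] exI[of _ p] exI[of _ id] exI[of _ "map (\<lambda>v _. v) vs"])
         (auto simp: \<sigma>_def o_def)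
  qed
  then have "smooth_fun n U (h \<circ> \<sigma>)" using h unfolding smooth_between_real by fast
  moreover have "smooth_fun n U (h \<circ> \<sigma>) \<longleftrightarrow> smooth_fun n U (\<lambda>z. h (tangent_class k X (n, U, p) z vs))"
    by (rule smooth_fun_cong[OF U]) (simp add: \<sigma>_def)
  ultimately show ?thesis by simp
qed

section \<open>Riemannian metrics\<close>

lemma covariant_2tensorD:
  assumes "covariant_2tensor X h" "(n, U, p) \<in> Plots X" "r \<in> U" "u \<in> Rn n" "v \<in> Rn n" "w \<in> Rn n"
  shows "h (tangent_class 2 X (n, U, p) r [\<lambda>i. a * u i + b * v i, w]) =
          a * h (tangent_class 2 X (n, U, p) r [u, w]) + b * h (tangent_class 2 X (n, U, p) r [v, w])"
    "h (tangent_class 2 X (n, U, p) r [w, \<lambda>i. a * u i + b * v i]) =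
          a * h (tangent_class 2 X (n, U, p) r [w, u]) + b * h (tangent_class 2 X (n, U, p) r [w, v])"
  using assms unfolding covariant_2tensor_def by fast+

text \<open>Metrics obtained by push-forward or descent are known only on actual tangent vectors, so
  they are replaced by explicit formulas there.\<close>

lemma riemannian_metric_cong:
  assumes X: "diffeological_space X" and h: "riemannian_metric X h" and eq: "\<And>\<tau>. \<tau> \<in> Pts (T2 X) \<Longrightarrow> h \<tau> = h' \<tau>"
  shows "riemannian_metric X h'"
proof -
  have e: "h' (tangent_class 2 X (n, U, p) r [v, w]) = h (tangent_class 2 X (n, U, p) r [v, w])"
    if "(n, U, p) \<in> Plots X" "r \<in> U" "v \<in> Rn n" "w \<in> Rn n" for n U p r v w
    using eq[OF tangent_class_2_in_Pts[OF that]] by simp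
  have c: "covariant_2tensor X h" and s: "symmetric_tensor X h" and d: "positive_definite_tensor X h"
    using h by (simp_all add: riemannian_metric_def)
  have "covariant_2tensor X h'"
    unfolding covariant_2tensor_def
  proof (intro conjI)
    show "smooth_between (T2 X) real_diffeology h'"
      by (rule smooth_real_cong[OF _ eq]) (use c in \<open>simp add: covariant_2tensor_def\<close>)
  qed (clarify, simp add: e combination_in_Rn covariant_2tensorD[OF c])
  moreover have "symmetric_tensor X h'"
    using s unfolding symmetric_tensor_def by (clarify, simp add: e) fast
  moreover have "positive_definite_tensor X h'"
    using d unfolding positive_definite_tensor_def by (clarify, simp add: e) fast
  ultimately show ?thesis by (simp add: riemannian_metric_def)
qed

lemma riemannian_metric_pullback:
  assumes X: "diffeological_space X" and Y: "diffeological_space Y" and f: "smooth_between Y X f"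
    and imm: "immersive Y X f" and h: "riemannian_metric X h"
  shows "riemannian_metric Y (h \<circ> T2_map X f)"
proof -
  have e: "(h \<circ> T2_map X f) (tangent_class 2 Y (n, U, p) r [v, w]) = h (tangent_class 2 X (n, U, restrict (f \<circ> p) U) r [v, w])"
    if "(n, U, p) \<in> Plots Y" "r \<in> U" "v \<in> Rn n" "w \<in> Rn n" for n U p r v w
    using T2_map_class[OF Y X f that] by simp
  have c: "covariant_2tensor X h" and s: "symmetric_tensor X h" and d: "positive_definite_tensor X h"
    using h by (simp_all add: riemannian_metric_def)
  have "covariant_2tensor Y (h \<circ> T2_map X f)"
    unfolding covariant_2tensor_def
  proof (intro conjI)
    show "smooth_between (T2 Y) real_diffeology (h \<circ> T2_map X f)"
      by (rule smooth_between_compose[OF tangent_map_smooth[OF Y X f]])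
         (use c in \<open>simp add: covariant_2tensor_def\<close>)
  qed (clarify, simp add: e combination_in_Rn covariant_2tensorD[OF c smooth_between_plot[OF f]] del: comp_apply)
  moreover have "symmetric_tensor Y (h \<circ> T2_map X f)"
    unfolding symmetric_tensor_def
  proof (clarify)
    fix n U p r v w assume *: "(n, U, p) \<in> Plots Y" "r \<in> U" "v \<in> Rn n" "w \<in> Rn n"
    show "(h \<circ> T2_map X f) (tangent_class 2 Y (n, U, p) r [v, w]) = (h \<circ> T2_map X f) (tangent_class 2 Y (n, U, p) r [w, v])"
      unfolding e[OF *] e[OF *(1,2,4,3)]
      using s smooth_between_plot[OF f *(1)] *(2-4) unfolding symmetric_tensor_def by fast
  qed
  moreover have "positive_definite_tensor Y (h \<circ> T2_map X f)"
    unfolding positive_definite_tensor_def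
  proof (clarify)
    fix n U p r v assume *: "(n, U, p) \<in> Plots Y" "r \<in> U" "v \<in> Rn n"
      and nz: "tangent_class 1 Y (n, U, p) r [v] \<notin> zero_vectors Y"
    have "tangent_class 1 X (n, U, restrict (f \<circ> p) U) r [v] \<notin> zero_vectors X"
      using immersiveD[OF imm *] nz by blast
    then show "0 < (h \<circ> T2_map X f) (tangent_class 2 Y (n, U, p) r [v, v])"
      unfolding e[OF * *(3)]
      using d smooth_between_plot[OF f *(1)] *(2,3) unfolding positive_definite_tensor_def by fast
  qed
  ultimately show ?thesis by (simp add: riemannian_metric_def)
qed

text \<open>A chain of steps relating \<open>[v]\<close> to a zero vector also relates \<open>[v, v]\<close> to the pair \<open>[0, 0]\<close>.\<close>

lemma zero_vector_square:
  assumes X: "diffeological_space X" and h: "covariant_2tensor X h"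
    and p: "(n, U, p) \<in> Plots X" "r \<in> U" "v \<in> Rn n" and z: "tangent_class 1 X (n, U, p) r [v] \<in> zero_vectors X"
  shows "h (tangent_class 2 X (n, U, p) r [v, v]) = 0"
proof -
  obtain m V q s where q: "(m, V, q) \<in> Plots X" "s \<in> V"
    and eq: "tangent_class 1 X (n, U, p) r [v] = tangent_class 1 X (m, V, q) s [\<lambda>_. 0]"
    using z unfolding zero_vectors_def by blast
  define F where "F = (\<lambda>(P, r, vs). tangent_class 2 X P r [hd vs, hd vs])"
  have "F a = F b" if ab: "a \<in> pre_tangent_set 1 X" "b \<in> pre_tangent_set 1 X" "tangent_step X a b" for a b
  proof -
    obtain n U p m V q f r vs where *: "(n, U, p) \<in> Plots X" "(m, V, q) \<in> Plots X" "smooth_map n U m V f"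
      "\<forall>x\<in>U. q (f x) = p x"
      "r \<in> U" "set vs \<subseteq> Rn n" "a = ((n, U, p), r, vs)" "b = ((m, V, q), f r, map (jacobian n f r) vs)"
      using ab(3) unfolding tangent_step_def by blast
    have vs: "vs \<noteq> []" using ab(1) *(7) by (auto simp: mem_pre_tangent_set)
    then have v: "hd vs \<in> Rn n" using *(6) by auto
    have "restrict (q \<circ> f) U = restrict p U" using *(4) by (auto intro!: restrict_ext)
    then have "restrict (q \<circ> f) U = p" using plot_extensional[OF X *(1)] by simp
    then show ?thesis
      using tangent_class_compose[OF X *(2) plot_domain_open[OF X *(1)] *(3,5), of "[hd vs, hd vs]" 2] v vs
      by (simp add: F_def *(7,8) hd_map)
  qed
  then have "F ((n, U, p), r, [v]) = F ((m, V, q), s, [\<lambda>_. 0])"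
    using p q by (intro tangent_class_invariant[OF X eq]) (auto simp: mem_pre_tangent_set)
  then have "tangent_class 2 X (n, U, p) r [v, v] = tangent_class 2 X (m, V, q) s [\<lambda>_. 0, \<lambda>_. 0]" by (simp add: F_def)
  moreover have "h (tangent_class 2 X (m, V, q) s [\<lambda>_. 0, \<lambda>_. 0]) = 0"
    using covariant_2tensorD(1)[OF h q, of "\<lambda>_. 0" "\<lambda>_. 0" "\<lambda>_. 0" 0 0] by simp
  ultimately show ?thesis by simp
qed

lemma riemannian_metric_nonneg:
  assumes X: "diffeological_space X" and h: "riemannian_metric X h" and p: "(n, U, p) \<in> Plots X" "r \<in> U" "v \<in> Rn n"
  shows "0 \<le> h (tangent_class 2 X (n, U, p) r [v, v])"
proof (cases "tangent_class 1 X (n, U, p) r [v] \<in> zero_vectors X")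
  case True
  then show ?thesis using zero_vector_square[OF X _ p True, of h] h by (simp add: riemannian_metric_def)
next
  case False
  then have "0 < h (tangent_class 2 X (n, U, p) r [v, v])"
    using h p unfolding riemannian_metric_def positive_definite_tensor_def by fast
  then show ?thesis by simp
qed

text \<open>A chain from \<open>[w]\<close> to a zero vector need not carry the second vector
  \<open>v\<close> along, so \<open>w\<close> cannot simply be replaced by 0 in the pair. Instead a
  Cauchy-Schwarz argument is used: the square of \<open>w\<close> vanishes, and a nonzero pairing
  with \<open>v\<close> would make the form negative somewhere.\<close>

lemma riemannian_metric_zero_vector:
  assumes X: "diffeological_space X" and h: "riemannian_metric X h"
    and p: "(n, U, p) \<in> Plots X" "r \<in> U" "v \<in> Rn n" "w \<in> Rn n"
    and z: "tangent_class 1 X (n, U, p) r [w] \<in> zero_vectors X"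
  shows "h (tangent_class 2 X (n, U, p) r [v, w]) = 0"
proof (rule ccontr)
  define A where "A v w = h (tangent_class 2 X (n, U, p) r [v, w])" for v w
  assume "h (tangent_class 2 X (n, U, p) r [v, w]) \<noteq> 0"
  then have B: "A v w \<noteq> 0" by (simp add: A_def)
  have c: "covariant_2tensor X h" and s: "symmetric_tensor X h" using h by (simp_all add: riemannian_metric_def)
  have "A w v = A v w" using s p unfolding symmetric_tensor_def A_def by fast
  have ww: "A w w = 0" unfolding A_def by (rule zero_vector_square[OF X c p(1,2,4) z])
  \<comment> \<open>The solution of \<open>A v v + 2 * b * A v w = -1\<close>, so that
    \<open>v + b w\<close> has square \<open>-1\<close>.\<close>
  define b where "b = - (A v v + 1) / (2 * A v w)"
  define x where "x = (\<lambda>i. 1 * v i + b * w i)"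
  have x: "x \<in> Rn n" unfolding x_def by (rule combination_in_Rn[OF p(3,4)])
  have l: "A x y = 1 * A v y + b * A w y" "A y x = 1 * A y v + b * A y w" if "y \<in> Rn n" for y
    using covariant_2tensorD[OF c p(1,2,3,4) that, of 1 b] by (simp_all add: A_def x_def)
  have "A x x = A v v + 2 * b * A v w"
    using l(1)[OF x] l(2)[OF p(3)] l(2)[OF p(4)] ww \<open>A w v = A v w\<close> by (simp add: algebra_simps)
  also have "\<dots> = - 1" using B by (simp add: b_def field_simps)
  finally show False using riemannian_metric_nonneg[OF X h p(1,2) x] by (simp add: A_def)
qed

text \<open>A vector killed by the tangent map is a zero vector by immersivity, and zero vectors
  pair to 0 with everything, so the orthogonality condition always holds.\<close>

lemma horizontal_pairs_immersive:
  assumes E: "diffeological_space E" and B: "diffeological_space B" and p: "smooth_between E B p"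
    and imm: "immersive E B p" and h: "riemannian_metric E h"
  shows "horizontal_pairs E B p h = Pts (T2 E)"
proof -
  have "h \<kappa> = 0" if \<kappa>: "\<kappa> \<in> Pts (T2 E)" "tangent_map 1 B p (tangent_proj E 1 \<kappa>) \<in> zero_vectors B" for \<kappa>
  proof -
    obtain n U q r v w where *: "(n, U, q) \<in> Plots E" "r \<in> U" "v \<in> Rn n" "w \<in> Rn n"
      and \<kappa>_eq: "\<kappa> = tangent_class 2 E (n, U, q) r [v, w]"
      by (rule Pts_T2[OF \<kappa>(1)])
    have "tangent_map 1 B p (tangent_proj E 1 \<kappa>) = tangent_class 1 B (n, U, restrict (p \<circ> q) U) r [w]"
      unfolding \<kappa>_eq tangent_proj_class(2)[OF E *] by (rule tangent_map_class[OF E B p *(1,2)]) (use * in auto)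
    then have "tangent_class 1 E (n, U, q) r [w] \<in> zero_vectors E"
      using immersiveD[OF imm *(1,2,4)] \<kappa>(2) by simp
    then show ?thesis unfolding \<kappa>_eq by (rule riemannian_metric_zero_vector[OF E h *])
  qed
  then show ?thesis unfolding horizontal_pairs_def horizontal_def by blast
qed

section \<open>Etale groupoids\<close>

locale etale_groupoid =
  fixes G :: "('m, 'g) groupoid" and n :: nat
  assumes lie: "lie_groupoid n n G"
begin

lemma laws: "groupoid_laws G"
  using lie by (simp add: lie_groupoid_def)

lemma manifolds: "manifold n (arr G)" "manifold n (base G)"
  using lie by (simp_all add: lie_groupoid_def hausdorff_sc_manifold_def)

lemma diff_arr: "diffeological_space (arr G)" and diff_base: "diffeological_space (base G)"
  using manifolds by (simp_all add: manifold_diffeological)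

lemma diff_arr2: "diffeological_space (arr2 G)"
  unfolding arr2_def by (intro diffeological_space_sub diffeological_space_prod diff_arr)

lemma diff_orbit: "diffeological_space (orbit_space G)"
  by (rule diffeological_space_orbit_space[OF lie])

lemma submersions: "submersion (arr G) (base G) (src G)" "submersion (arr G) (base G) (tgt G)"
  using lie by (simp_all add: lie_groupoid_def)

lemma smooth_src: "smooth_between (arr G) (base G) (src G)"
  and smooth_tgt: "smooth_between (arr G) (base G) (tgt G)"
  and smooth_idn: "smooth_between (base G) (arr G) (idn G)"
  and smooth_ginv: "smooth_between (arr G) (arr G) (ginv G)"
  and smooth_gmult: "smooth_between (arr2 G) (arr G) (\<lambda>(g, h). gmult G g h)"
  using lie by (simp_all add: lie_groupoid_def submersion_def)

lemma src_in: "g \<in> Pts (arr G) \<Longrightarrow> src G g \<in> Pts (base G)"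
  and tgt_in: "g \<in> Pts (arr G) \<Longrightarrow> tgt G g \<in> Pts (base G)"
  using laws unfolding groupoid_laws_def by blast+

lemma idn: "x \<in> Pts (base G) \<Longrightarrow> idn G x \<in> Pts (arr G) \<and> src G (idn G x) = x \<and> tgt G (idn G x) = x"
  using laws unfolding groupoid_laws_def by blast

lemma ginv: "g \<in> Pts (arr G) \<Longrightarrow> ginv G g \<in> Pts (arr G) \<and> src G (ginv G g) = tgt G g \<and> tgt G (ginv G g) = src G g \<and>
  gmult G g (ginv G g) = idn G (tgt G g) \<and> gmult G (ginv G g) g = idn G (src G g)"
  using laws unfolding groupoid_laws_def by blast

lemma gmult: "g \<in> Pts (arr G) \<Longrightarrow> h \<in> Pts (arr G) \<Longrightarrow> src G g = tgt G h \<Longrightarrow>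
  gmult G g h \<in> Pts (arr G) \<and> src G (gmult G g h) = src G h \<and> tgt G (gmult G g h) = tgt G g"
  using laws unfolding groupoid_laws_def by blast

lemma ginv_ginv:
  assumes g: "g \<in> Pts (arr G)"
  shows "ginv G (ginv G g) = g"
proof -
  have unit: "gmult G (idn G (tgt G k)) k = k" "gmult G k (idn G (src G k)) = k" if "k \<in> Pts (arr G)" for k
    using laws that unfolding groupoid_laws_def by blast+
  have assoc: "gmult G (gmult G a b) c = gmult G a (gmult G b c)"
    if "a \<in> Pts (arr G)" "b \<in> Pts (arr G)" "c \<in> Pts (arr G)" "src G a = tgt G b" "src G b = tgt G c" for a b c
    using laws that unfolding groupoid_laws_def by blast
  define i where "i = ginv G g"
  define j where "j = ginv G i"
  have i: "i \<in> Pts (arr G)" "src G i = tgt G g" "tgt G i = src G g" "gmult G i g = idn G (src G g)"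
    using ginv[OF g] by (simp_all add: i_def)
  have j: "j \<in> Pts (arr G)" "src G j = tgt G i" "tgt G j = src G i" "gmult G j i = idn G (src G i)"
    using ginv[OF i(1)] by (simp_all add: j_def)
  have "j = gmult G j (gmult G i g)" using unit(2)[OF j(1)] i(3,4) j(2) by simp
  also have "\<dots> = gmult G (gmult G j i) g" using assoc[OF j(1) i(1) g] i(2) j(2) by simp
  also have "\<dots> = g" using unit(1)[OF g] i(2) j(4) by simp
  finally show ?thesis by (simp add: i_def j_def)
qed

lemma Pts_arr2: "Pts (arr2 G) = {(g, h). g \<in> Pts (arr G) \<and> h \<in> Pts (arr G) \<and> src G g = tgt G h}"
  by (auto simp: arr2_def sub_diffeology_def prod_diffeology_def)

lemma smooth_fst: "smooth_between (arr2 G) (arr G) fst"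
  and smooth_snd: "smooth_between (arr2 G) (arr G) snd"
  unfolding smooth_between_def by (auto simp: Pts_arr2, auto simp: arr2_def sub_diffeology_def prod_diffeology_def)

lemma smooth_pair:
  assumes f: "smooth_between X (arr G) f" and g: "smooth_between X (arr G) g"
    and fg: "\<And>x. x \<in> Pts X \<Longrightarrow> src G (f x) = tgt G (g x)" and X: "diffeological_space X"
  shows "smooth_between X (arr2 G) (\<lambda>x. (f x, g x))"
  unfolding smooth_between_def
proof (intro conjI ballI)
  show "(\<lambda>x. (f x, g x)) \<in> Pts X \<rightarrow> Pts (arr2 G)"
    using smooth_between_in[OF f] smooth_between_in[OF g] fg by (auto simp: Pts_arr2)
  fix P assume P: "P \<in> Plots X"
  obtain k U p where [simp]: "P = (k, U, p)" by (cases P)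
  have p: "(k, U, p) \<in> Plots X" using P by simp
  have "restrict (fst \<circ> restrict ((\<lambda>x. (f x, g x)) \<circ> p) U) U = restrict (f \<circ> p) U"
    "restrict (snd \<circ> restrict ((\<lambda>x. (f x, g x)) \<circ> p) U) U = restrict (g \<circ> p) U"
    by (auto intro!: restrict_ext)
  moreover have "src G (f (p r)) = tgt G (g (p r))" if "r \<in> U" for r using fg plot_in[OF X p that] by blast
  ultimately have "(k, U, restrict ((\<lambda>x. (f x, g x)) \<circ> p) U) \<in> Plots (arr2 G)"
    using smooth_between_plot[OF f p] smooth_between_plot[OF g p]
    by (simp add: arr2_def sub_diffeology_def prod_diffeology_def del: restrict_comp_restrict)
  then show "case P of (n, U, p) \<Rightarrow> (n, U, restrict ((\<lambda>x. (f x, g x)) \<circ> p) U) \<in> Plots (arr2 G)" by simp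
qed

lemma smooth_ident: "diffeological_space X \<Longrightarrow> smooth_between X X (\<lambda>x. x)"
  unfolding smooth_between_def using plot_extensional[of X] by (fastforce simp: o_def)

lemma immersive_src: "immersive (arr G) (base G) (src G)"
  by (rule immersive_local_sections[OF diff_arr diff_base smooth_src])
     (drule etale_local_section[OF manifolds submersions(1)], elim exE conjE, intro exI conjI, assumption+)

text \<open>The first projection is etale because it is the pullback of the target map along the source map:
  a local section \<open>\<sigma>\<close> of the target map yields the local section \<open>g \<mapsto> (g, \<sigma> (src g))\<close>.\<close>

lemma immersive_fst: "immersive (arr2 G) (arr G) fst"
proof (rule immersive_local_sections[OF diff_arr2 diff_arr smooth_fst])
  fix e assume e: "e \<in> Pts (arr2 G)"
  then have snd_e: "snd e \<in> Pts (arr G)" by (auto simp: Pts_arr2)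
  obtain W S \<sigma> where W: "openin (D_topology (arr G)) W" "snd e \<in> W" and S: "openin (D_topology (base G)) S" "tgt G ` W \<subseteq> S"
    and \<sigma>: "smooth_between (sub_diffeology (base G) S) (arr G) \<sigma>" "\<forall>g\<in>W. \<sigma> (tgt G g) = g"
      "\<forall>x\<in>S. tgt G (\<sigma> x) = x \<and> \<sigma> x \<in> W"
    using etale_local_section[OF manifolds submersions(2) snd_e] by blast
  define W' where "W' = {c \<in> Pts (arr2 G). snd c \<in> W}"
  define S' where "S' = {g \<in> Pts (arr G). src G g \<in> S}"
  \<comment> \<open>Smooth maps are continuous for the D-topologies; needed below for
    \<open>snd\<close> and for \<open>src G\<close>.\<close>
  have pre: "openin (D_topology X) {c \<in> Pts X. f c \<in> V}"
    if X: "diffeological_space X" and Y: "diffeological_space Y" and f: "smooth_between X Y f"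
      and V: "openin (D_topology Y) V"
    for X :: "'x diffeology" and Y :: "'y diffeology" and f V
    unfolding openin_D_topology
  proof (intro conjI ballI)
    fix P assume P: "P \<in> Plots X"
    obtain k U p where [simp]: "P = (k, U, p)" by (cases P)
    have p: "(k, U, p) \<in> Plots X" using P by simp
    have "{r \<in> U. p r \<in> {c \<in> Pts X. f c \<in> V}} = {r \<in> U. restrict (f \<circ> p) U r \<in> V}"
      using plot_in[OF X p] by auto
    then show "case P of (n, U, p) \<Rightarrow> openin (Euclidean_space n) {r \<in> U. p r \<in> {c \<in> Pts X. f c \<in> V}}"
      using openin_plot_preimage[OF Y smooth_between_plot[OF f p] V] by simp
  qed auto
  have "openin (D_topology (arr2 G)) W'" unfolding W'_def by (rule pre[OF diff_arr2 diff_arr smooth_snd W(1)])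
  moreover have S': "openin (D_topology (arr G)) S'" unfolding S'_def by (rule pre[OF diff_arr diff_base smooth_src S(1)])
  moreover have "fst ` W' \<subseteq> S'" using S(2) by (auto simp: W'_def S'_def Pts_arr2)
  moreover have "smooth_between (sub_diffeology (arr G) S') (arr2 G) (\<lambda>g. (g, \<sigma> (src G g)))"
  proof (rule smooth_pair)
    show D: "diffeological_space (sub_diffeology (arr G) S')" by (rule diffeological_space_sub[OF diff_arr])
    have inc: "smooth_between (sub_diffeology (arr G) S') (arr G) (\<lambda>g. g)"
      using smooth_ident[OF diff_arr] unfolding smooth_between_def by (auto simp: sub_diffeology_def)
    show "smooth_between (sub_diffeology (arr G) S') (arr G) (\<lambda>g. g)" by (rule inc)
    have "smooth_between (sub_diffeology (arr G) S') (sub_diffeology (base G) S) (src G)"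
      unfolding smooth_between_def
    proof (intro conjI ballI)
      show "src G \<in> Pts (sub_diffeology (arr G) S') \<rightarrow> Pts (sub_diffeology (base G) S)"
        using src_in by (auto simp: sub_diffeology_def S'_def)
      fix P assume P: "P \<in> Plots (sub_diffeology (arr G) S')"
      then show "case P of (n, U, p) \<Rightarrow> (n, U, restrict (src G \<circ> p) U) \<in> Plots (sub_diffeology (base G) S)"
        using smooth_between_plot[OF smooth_src] by (auto simp: sub_diffeology_def S'_def Pi_iff)
    qed
    from smooth_between_compose[OF this \<sigma>(1)]
    show "smooth_between (sub_diffeology (arr G) S') (arr G) (\<lambda>g. \<sigma> (src G g))" by (simp add: o_def)
    show "src G x = tgt G (\<sigma> (src G x))" if "x \<in> Pts (sub_diffeology (arr G) S')" for x
      using that \<sigma>(3) by (auto simp: sub_diffeology_def S'_def)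
  qed
  moreover have "\<forall>c\<in>W'. (\<lambda>g. (g, \<sigma> (src G g))) (fst c) = c" using \<sigma>(2) by (auto simp: W'_def Pts_arr2)
  moreover have "e \<in> W'" using e W(2) by (simp add: W'_def)
  ultimately show "\<exists>W S \<sigma>. openin (D_topology (arr2 G)) W \<and> e \<in> W \<and> openin (D_topology (arr G)) S \<and>
      fst ` W \<subseteq> S \<and> smooth_between (sub_diffeology (arr G) S) (arr2 G) \<sigma> \<and> (\<forall>g\<in>W. \<sigma> (fst g) = g)"
    by blast
qed

section \<open>The 0-metric induced by a 2-metric\<close>

text \<open>The degeneracies of the nerve: \<open>right_unit\<close> is a global section of
  \<open>fst\<close> and \<open>left_unit\<close> one of \<open>snd\<close>. \<open>flip\<close> and
  \<open>turn\<close> are the two generators of the symmetric group action.\<close>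

definition right_unit :: "'g \<Rightarrow> 'g \<times> 'g" where "right_unit g = (g, idn G (src G g))"
definition left_unit :: "'g \<Rightarrow> 'g \<times> 'g" where "left_unit g = (idn G (tgt G g), g)"
definition flip :: "'g \<times> 'g \<Rightarrow> 'g \<times> 'g" where "flip = (\<lambda>(g, h). (ginv G h, ginv G g))"
definition turn :: "'g \<times> 'g \<Rightarrow> 'g \<times> 'g" where "turn = (\<lambda>(g, h). (gmult G g h, ginv G h))"

lemma smooth_right_unit: "smooth_between (arr G) (arr2 G) right_unit"
proof -
  have "smooth_between (arr G) (arr G) (\<lambda>g. idn G (src G g))"
    using smooth_between_compose[OF smooth_src smooth_idn] by (simp add: o_def)
  then show ?thesis unfolding right_unit_def[abs_def]
    by (rule smooth_pair[OF smooth_ident[OF diff_arr] _ _ diff_arr]) (use idn src_in in auto)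
qed

lemma smooth_left_unit: "smooth_between (arr G) (arr2 G) left_unit"
proof -
  have "smooth_between (arr G) (arr G) (\<lambda>g. idn G (tgt G g))"
    using smooth_between_compose[OF smooth_tgt smooth_idn] by (simp add: o_def)
  then show ?thesis unfolding left_unit_def[abs_def]
    by (rule smooth_pair[OF _ smooth_ident[OF diff_arr] _ diff_arr]) (use idn tgt_in in auto)
qed

lemma smooth_flip: "smooth_between (arr2 G) (arr2 G) flip"
proof -
  have "smooth_between (arr2 G) (arr2 G) (\<lambda>c. ((ginv G \<circ> snd) c, (ginv G \<circ> fst) c))"
    by (rule smooth_pair[OF smooth_between_compose[OF smooth_snd smooth_ginv]
        smooth_between_compose[OF smooth_fst smooth_ginv] _ diff_arr2]) (clarsimp simp: Pts_arr2 ginv)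
  moreover have "(\<lambda>c. ((ginv G \<circ> snd) c, (ginv G \<circ> fst) c)) = flip" by (auto simp: flip_def)
  ultimately show ?thesis by simp
qed

lemma smooth_turn: "smooth_between (arr2 G) (arr2 G) turn"
proof -
  have "smooth_between (arr2 G) (arr2 G) (\<lambda>c. ((\<lambda>(g, h). gmult G g h) c, (ginv G \<circ> snd) c))"
    by (rule smooth_pair[OF smooth_gmult smooth_between_compose[OF smooth_snd smooth_ginv] _ diff_arr2])
       (clarsimp simp: Pts_arr2 ginv gmult)
  moreover have "(\<lambda>c. ((\<lambda>(g, h). gmult G g h) c, (ginv G \<circ> snd) c)) = turn" by (auto simp: turn_def)
  ultimately show ?thesis by simp
qed

lemma fst_right_unit:
  assumes "\<tau> \<in> Pts (T2 (arr G))"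
  shows "T2_map (arr G) fst (T2_map (arr2 G) right_unit \<tau>) = \<tau>"
  by (rule tangent_map_left_inverse[OF diff_arr diff_arr2 smooth_right_unit smooth_fst _ assms]) (simp add: right_unit_def)

lemma src_idn:
  assumes "\<tau> \<in> Pts (T2 (base G))"
  shows "T2_map (base G) (src G) (T2_map (arr G) (idn G) \<tau>) = \<tau>"
  by (rule tangent_map_left_inverse[OF diff_base diff_arr smooth_idn smooth_src _ assms]) (simp add: idn)

text \<open>The push-forward along \<open>fst\<close> in closed form. As every vector is horizontal,
  it can be evaluated on the lift given by the global section \<open>right_unit\<close>; likewise
  \<open>base_metric\<close> uses the section \<open>idn G\<close> of the source map.\<close>

definition arrow_metric :: "(('g \<times> 'g) tvec set \<Rightarrow> real) \<Rightarrow> 'g tvec set \<Rightarrow> real" where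
  "arrow_metric \<eta>2 = \<eta>2 \<circ> T2_map (arr2 G) right_unit"

definition base_metric :: "(('g \<times> 'g) tvec set \<Rightarrow> real) \<Rightarrow> 'm tvec set \<Rightarrow> real" where
  "base_metric \<eta>2 = arrow_metric \<eta>2 \<circ> T2_map (arr G) (idn G)"

context
  fixes \<eta>2 assumes \<eta>2: "metric_2 G \<eta>2"
begin

lemma riem2: "riemannian_metric (arr2 G) \<eta>2"
  using \<eta>2 by (simp add: metric_2_def)

lemma flip_invariant: "\<sigma> \<in> Pts (T2 (arr2 G)) \<Longrightarrow> \<eta>2 (T2_map (arr2 G) flip \<sigma>) = \<eta>2 \<sigma>"
  and turn_invariant: "\<sigma> \<in> Pts (T2 (arr2 G)) \<Longrightarrow> \<eta>2 (T2_map (arr2 G) turn \<sigma>) = \<eta>2 \<sigma>"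
  using \<eta>2 unfolding metric_2_def flip_def turn_def by blast+

text \<open>A pair and the unit pair built from its first entry have the same image under
  \<open>fst\<close>, both are horizontal, and transversality equates their values.\<close>

lemma arrow_metric_fst:
  assumes \<sigma>: "\<sigma> \<in> Pts (T2 (arr2 G))"
  shows "arrow_metric \<eta>2 (T2_map (arr G) fst \<sigma>) = \<eta>2 \<sigma>"
proof -
  have hp: "horizontal_pairs (arr2 G) (arr G) fst \<eta>2 = Pts (T2 (arr2 G))"
    by (rule horizontal_pairs_immersive[OF diff_arr2 diff_arr smooth_fst immersive_fst riem2])
  have f\<sigma>: "T2_map (arr G) fst \<sigma> \<in> Pts (T2 (arr G))"
    by (rule tangent_map_Pts[OF diff_arr2 diff_arr smooth_fst \<sigma>])
  define \<sigma>' where "\<sigma>' = T2_map (arr2 G) right_unit (T2_map (arr G) fst \<sigma>)"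
  have \<sigma>': "\<sigma>' \<in> Pts (T2 (arr2 G))"
    unfolding \<sigma>'_def by (rule tangent_map_Pts[OF diff_arr diff_arr2 smooth_right_unit f\<sigma>])
  have "T2_map (arr G) fst \<sigma>' = T2_map (arr G) fst \<sigma>"
    unfolding \<sigma>'_def by (rule fst_right_unit[OF f\<sigma>])
  then have "\<eta>2 \<sigma>' = \<eta>2 \<sigma>"
    using \<eta>2 \<sigma> \<sigma>' unfolding metric_2_def transverse_metric_def hp by blast
  then show ?thesis by (simp add: arrow_metric_def \<sigma>'_def)
qed

text \<open>The composite of the two generators of the action is the rotation \<open>(g, h) \<mapsto> (h, (gh)\<^sup>-\<^sup>1)\<close>.\<close>

lemma arrow_metric_snd:
  assumes \<sigma>: "\<sigma> \<in> Pts (T2 (arr2 G))"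
  shows "arrow_metric \<eta>2 (T2_map (arr G) snd \<sigma>) = \<eta>2 \<sigma>"
proof -
  define \<sigma>1 where "\<sigma>1 = T2_map (arr2 G) turn \<sigma>"
  define \<sigma>2 where "\<sigma>2 = T2_map (arr2 G) flip \<sigma>1"
  have \<sigma>1: "\<sigma>1 \<in> Pts (T2 (arr2 G))" unfolding \<sigma>1_def by (rule tangent_map_Pts[OF diff_arr2 diff_arr2 smooth_turn \<sigma>])
  have \<sigma>2: "\<sigma>2 \<in> Pts (T2 (arr2 G))" unfolding \<sigma>2_def by (rule tangent_map_Pts[OF diff_arr2 diff_arr2 smooth_flip \<sigma>1])
  have ft: "smooth_between (arr2 G) (arr2 G) (flip \<circ> turn)" by (rule smooth_between_compose[OF smooth_turn smooth_flip])
  have "\<sigma>2 = T2_map (arr2 G) (flip \<circ> turn) \<sigma>"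
    unfolding \<sigma>2_def \<sigma>1_def by (rule tangent_map_compose[OF diff_arr2 diff_arr2 diff_arr2 smooth_turn smooth_flip \<sigma>])
  then have "T2_map (arr G) fst \<sigma>2 = T2_map (arr G) (fst \<circ> (flip \<circ> turn)) \<sigma>"
    using tangent_map_compose[OF diff_arr2 diff_arr2 diff_arr ft smooth_fst \<sigma>] by simp
  also have "\<dots> = T2_map (arr G) snd \<sigma>"
    by (rule tangent_map_cong[OF diff_arr2 diff_arr smooth_between_compose[OF ft smooth_fst] smooth_snd _ \<sigma>])
       (auto simp: flip_def turn_def Pts_arr2 ginv_ginv)
  finally have "arrow_metric \<eta>2 (T2_map (arr G) snd \<sigma>) = \<eta>2 \<sigma>2" using arrow_metric_fst[OF \<sigma>2] by simp
  also have "\<dots> = \<eta>2 \<sigma>" unfolding \<sigma>2_def flip_invariant[OF \<sigma>1] unfolding \<sigma>1_def by (rule turn_invariant[OF \<sigma>])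
  finally show ?thesis .
qed

text \<open>Since \<open>idn G \<circ> src G = snd \<circ> right_unit\<close>, the left side is
  \<open>arrow_metric\<close> on the second face of a unit pair whose first face is
  \<open>\<tau>\<close>. By \<open>arrow_metric_snd\<close> it equals the value of the 2-metric on
  that pair.\<close>

lemma base_metric_src:
  assumes \<tau>: "\<tau> \<in> Pts (T2 (arr G))"
  shows "base_metric \<eta>2 (T2_map (base G) (src G) \<tau>) = arrow_metric \<eta>2 \<tau>"
proof -
  define \<sigma> where "\<sigma> = T2_map (arr2 G) right_unit \<tau>"
  have \<sigma>: "\<sigma> \<in> Pts (T2 (arr2 G))" unfolding \<sigma>_def by (rule tangent_map_Pts[OF diff_arr diff_arr2 smooth_right_unit \<tau>])
  have "T2_map (arr G) (idn G) (T2_map (base G) (src G) \<tau>) = T2_map (arr G) (idn G \<circ> src G) \<tau>"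
    by (rule tangent_map_compose[OF diff_arr diff_base diff_arr smooth_src smooth_idn \<tau>])
  also have "idn G \<circ> src G = snd \<circ> right_unit" by (auto simp: right_unit_def)
  also have "T2_map (arr G) (snd \<circ> right_unit) \<tau> = T2_map (arr G) snd \<sigma>"
    unfolding \<sigma>_def by (rule tangent_map_compose[OF diff_arr diff_arr2 diff_arr smooth_right_unit smooth_snd \<tau>, symmetric])
  finally have "base_metric \<eta>2 (T2_map (base G) (src G) \<tau>) = \<eta>2 \<sigma>"
    using arrow_metric_snd[OF \<sigma>] by (simp add: base_metric_def)
  then show ?thesis by (simp add: arrow_metric_def \<sigma>_def)
qed

text \<open>The mirror image with \<open>left_unit\<close>, whose first face is a unit at the target
  and whose second face is \<open>\<tau>\<close>. Here both face formulas are used, and with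
  \<open>base_metric_src\<close> the invariance of the 0-metric follows.\<close>

lemma base_metric_tgt:
  assumes \<tau>: "\<tau> \<in> Pts (T2 (arr G))"
  shows "base_metric \<eta>2 (T2_map (base G) (tgt G) \<tau>) = arrow_metric \<eta>2 \<tau>"
proof -
  define \<sigma> where "\<sigma> = T2_map (arr2 G) left_unit \<tau>"
  have \<sigma>: "\<sigma> \<in> Pts (T2 (arr2 G))" unfolding \<sigma>_def by (rule tangent_map_Pts[OF diff_arr diff_arr2 smooth_left_unit \<tau>])
  have "T2_map (arr G) (idn G) (T2_map (base G) (tgt G) \<tau>) = T2_map (arr G) (idn G \<circ> tgt G) \<tau>"
    by (rule tangent_map_compose[OF diff_arr diff_base diff_arr smooth_tgt smooth_idn \<tau>])
  also have "idn G \<circ> tgt G = fst \<circ> left_unit" by (auto simp: left_unit_def)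
  also have "T2_map (arr G) (fst \<circ> left_unit) \<tau> = T2_map (arr G) fst \<sigma>"
    unfolding \<sigma>_def by (rule tangent_map_compose[OF diff_arr diff_arr2 diff_arr smooth_left_unit smooth_fst \<tau>, symmetric])
  finally have "base_metric \<eta>2 (T2_map (base G) (tgt G) \<tau>) = \<eta>2 \<sigma>"
    using arrow_metric_fst[OF \<sigma>] by (simp add: base_metric_def)
  also have "\<eta>2 \<sigma> = arrow_metric \<eta>2 (T2_map (arr G) snd \<sigma>)" using arrow_metric_snd[OF \<sigma>] by simp
  also have "T2_map (arr G) snd \<sigma> = \<tau>"
    unfolding \<sigma>_def
    by (rule tangent_map_left_inverse[OF diff_arr diff_arr2 smooth_left_unit smooth_snd _ \<tau>]) (simp add: left_unit_def)
  finally show ?thesis .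
qed

lemma riemannian_arrow_metric: "riemannian_metric (arr G) (arrow_metric \<eta>2)"
proof -
  have "immersive (arr G) (arr2 G) right_unit"
    by (rule immersive_left_inverse[OF diff_arr diff_arr2 smooth_right_unit smooth_fst]) (simp add: right_unit_def)
  then show ?thesis
    unfolding arrow_metric_def
    by (rule riemannian_metric_pullback[OF diff_arr2 diff_arr smooth_right_unit _ riem2])
qed

lemma metric_0_base_metric: "metric_0 G (base_metric \<eta>2)"
proof -
  have "immersive (base G) (arr G) (idn G)"
    by (rule immersive_left_inverse[OF diff_base diff_arr smooth_idn smooth_src]) (simp add: idn)
  then have "riemannian_metric (base G) (base_metric \<eta>2)"
    unfolding base_metric_def
    by (rule riemannian_metric_pullback[OF diff_arr diff_base smooth_idn _ riemannian_arrow_metric])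
  then show ?thesis by (simp add: metric_0_def base_metric_src base_metric_tgt)
qed

lemma pushforward_fst:
  assumes \<tau>: "\<tau> \<in> Pts (T2 (arr G))"
  shows "pushforward_metric (arr2 G) (arr G) fst \<eta>2 \<tau> = arrow_metric \<eta>2 \<tau>"
proof -
  have hp: "horizontal_pairs (arr2 G) (arr G) fst \<eta>2 = Pts (T2 (arr2 G))"
    by (rule horizontal_pairs_immersive[OF diff_arr2 diff_arr smooth_fst immersive_fst riem2])
  define \<sigma> where "\<sigma> = T2_map (arr2 G) right_unit \<tau>"
  have \<sigma>: "\<sigma> \<in> Pts (T2 (arr2 G))" unfolding \<sigma>_def by (rule tangent_map_Pts[OF diff_arr diff_arr2 smooth_right_unit \<tau>])
  have f\<sigma>: "T2_map (arr G) fst \<sigma> = \<tau>" unfolding \<sigma>_def by (rule fst_right_unit[OF \<tau>])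
  show ?thesis
    unfolding pushforward_metric_def hp
  proof (rule the_equality)
    show "\<exists>\<sigma>\<in>Pts (T2 (arr2 G)). T2_map (arr G) fst \<sigma> = \<tau> \<and> arrow_metric \<eta>2 \<tau> = \<eta>2 \<sigma>"
      using \<sigma> f\<sigma> arrow_metric_fst[OF \<sigma>] by auto
    show "c = arrow_metric \<eta>2 \<tau>" if "\<exists>\<sigma>\<in>Pts (T2 (arr2 G)). T2_map (arr G) fst \<sigma> = \<tau> \<and> c = \<eta>2 \<sigma>" for c
      using that arrow_metric_fst by auto
  qed
qed

lemma induced_metric_0_eq:
  assumes \<tau>: "\<tau> \<in> Pts (T2 (base G))"
  shows "induced_metric_0 G \<eta>2 \<tau> = base_metric \<eta>2 \<tau>"
proof -
  \<comment> \<open>The inner push-forward is a definite description that agrees with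
    \<open>arrow_metric\<close> on tangent vectors only; it must be shown Riemannian before the
    outer horizontal pairs can be computed.\<close>
  define h1 where "h1 = pushforward_metric (arr2 G) (arr G) fst \<eta>2"
  have h1: "h1 \<sigma> = arrow_metric \<eta>2 \<sigma>" if "\<sigma> \<in> Pts (T2 (arr G))" for \<sigma>
    using pushforward_fst[OF that] by (simp add: h1_def)
  have "riemannian_metric (arr G) h1"
    by (rule riemannian_metric_cong[OF diff_arr riemannian_arrow_metric]) (simp add: h1)
  then have hp: "horizontal_pairs (arr G) (base G) (src G) h1 = Pts (T2 (arr G))"
    by (rule horizontal_pairs_immersive[OF diff_arr diff_base smooth_src immersive_src])
  define \<sigma> where "\<sigma> = T2_map (arr G) (idn G) \<tau>"
  have \<sigma>: "\<sigma> \<in> Pts (T2 (arr G))" unfolding \<sigma>_def by (rule tangent_map_Pts[OF diff_base diff_arr smooth_idn \<tau>])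
  have s\<sigma>: "T2_map (base G) (src G) \<sigma> = \<tau>" unfolding \<sigma>_def by (rule src_idn[OF \<tau>])
  show ?thesis
    unfolding induced_metric_0_def h1_def[symmetric] pushforward_metric_def[of "arr G"] hp
  proof (rule the_equality)
    show "\<exists>\<sigma>\<in>Pts (T2 (arr G)). T2_map (base G) (src G) \<sigma> = \<tau> \<and> base_metric \<eta>2 \<tau> = h1 \<sigma>"
      using \<sigma> s\<sigma> base_metric_src[OF \<sigma>] h1[OF \<sigma>] by auto
    show "c = base_metric \<eta>2 \<tau>" if "\<exists>\<sigma>\<in>Pts (T2 (arr G)). T2_map (base G) (src G) \<sigma> = \<tau> \<and> c = h1 \<sigma>" for c
      using that base_metric_src h1 by auto
  qed
qed

end

section \<open>The pullback of a metric on the orbit space\<close>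

lemma smooth_orbit_proj: "smooth_between (base G) (orbit_space G) (orbit_proj G)"
  unfolding smooth_between_def
proof (intro conjI ballI)
  show "orbit_proj G \<in> Pts (base G) \<rightarrow> Pts (orbit_space G)"
    by (auto simp: orbit_space_def quotient_diffeology_def orbit_proj_def[abs_def] intro: quotientI)
  fix P assume P: "P \<in> Plots (base G)"
  obtain k U p where [simp]: "P = (k, U, p)" by (cases P)
  have p: "(k, U, p) \<in> Plots (base G)" using P by simp
  have "restrict (orbit_proj G \<circ> p) U \<in> U \<rightarrow>\<^sub>E Pts (base G) // orbit_rel G"
    using plot_in[OF diff_base p] by (simp add: orbit_proj_def PiE_iff quotientI)
  moreover have "\<exists>V q. openin (Euclidean_space k) V \<and> r \<in> V \<and> V \<subseteq> U \<and> (k, V, q) \<in> Plots (base G) \<and>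
          (\<forall>z\<in>V. restrict (orbit_proj G \<circ> p) U z = orbit_rel G `` {q z})" if "r \<in> U" for r
    using that p plot_domain_open[OF diff_base p]
    by (intro exI[of _ U] exI[of _ p]) (auto simp: orbit_proj_def)
  ultimately have "(k, U, restrict (orbit_proj G \<circ> p) U) \<in> Plots (orbit_space G)"
    using plot_domain_open[OF diff_base p] by (simp add: orbit_space_def quotient_diffeology_def)
  then show "case P of (n, U, p) \<Rightarrow> (n, U, restrict (orbit_proj G \<circ> p) U) \<in> Plots (orbit_space G)" by simp
qed

lemma orbit_proj_tgt_src: "g \<in> Pts (arr G) \<Longrightarrow> orbit_proj G (tgt G g) = orbit_proj G (src G g)"
  unfolding orbit_proj_def
  by (rule equiv_class_eq[OF equiv_orbit_rel[OF laws], symmetric]) (auto simp: orbit_rel_def)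

lemma metric_0_orbit_pullback:
  assumes "definite_on_orbits G g"
  shows "metric_0 G (orbit_pullback G g)"
  unfolding metric_0_def
proof (intro conjI ballI)
  show "riemannian_metric (base G) (orbit_pullback G g)" using assms by (simp add: definite_on_orbits_def)
  fix \<tau> assume \<tau>: "\<tau> \<in> Pts (T2 (arr G))"
  have "T2_map (orbit_space G) (orbit_proj G) (T2_map (base G) (tgt G) \<tau>) = T2_map (orbit_space G) (orbit_proj G \<circ> tgt G) \<tau>"
    by (rule tangent_map_compose[OF diff_arr diff_base diff_orbit smooth_tgt smooth_orbit_proj \<tau>])
  also have "\<dots> = T2_map (orbit_space G) (orbit_proj G \<circ> src G) \<tau>"
    by (rule tangent_map_cong[OF diff_arr diff_orbit smooth_between_compose[OF smooth_tgt smooth_orbit_proj]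
        smooth_between_compose[OF smooth_src smooth_orbit_proj] _ \<tau>]) (simp add: orbit_proj_tgt_src)
  also have "\<dots> = T2_map (orbit_space G) (orbit_proj G) (T2_map (base G) (src G) \<tau>)"
    by (rule tangent_map_compose[OF diff_arr diff_base diff_orbit smooth_src smooth_orbit_proj \<tau>, symmetric])
  finally show "orbit_pullback G g (T2_map (base G) (tgt G) \<tau>) = orbit_pullback G g (T2_map (base G) (src G) \<tau>)"
    by (simp add: orbit_pullback_def)
qed

context
  fixes \<eta> assumes \<eta>: "metric_0 G \<eta>"
begin

definition pair_metric :: "('g \<times> 'g) tvec set \<Rightarrow> real" where
  "pair_metric = \<eta> \<circ> T2_map (base G) (src G) \<circ> T2_map (arr G) fst"

lemma pair_metric_fst:
  assumes \<sigma>: "\<sigma> \<in> Pts (T2 (arr2 G))"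
  shows "pair_metric \<sigma> = \<eta> (T2_map (base G) (src G \<circ> fst) \<sigma>)"
  using tangent_map_compose[OF diff_arr2 diff_arr diff_base smooth_fst smooth_src \<sigma>]
  by (simp add: pair_metric_def)

text \<open>The vertex \<open>src G g\<close> of the triangle is also \<open>tgt G h\<close>, and
  invariance of the 0-metric along \<open>h\<close> moves the evaluation to
  \<open>src G h\<close>.\<close>

lemma pair_metric_snd:
  assumes \<sigma>: "\<sigma> \<in> Pts (T2 (arr2 G))"
  shows "pair_metric \<sigma> = \<eta> (T2_map (base G) (src G \<circ> snd) \<sigma>)"
proof -
  have s\<sigma>: "T2_map (arr G) snd \<sigma> \<in> Pts (T2 (arr G))" by (rule tangent_map_Pts[OF diff_arr2 diff_arr smooth_snd \<sigma>])
  have "T2_map (base G) (src G \<circ> fst) \<sigma> = T2_map (base G) (tgt G \<circ> snd) \<sigma>"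
    by (rule tangent_map_cong[OF diff_arr2 diff_base smooth_between_compose[OF smooth_fst smooth_src]
        smooth_between_compose[OF smooth_snd smooth_tgt] _ \<sigma>]) (auto simp: Pts_arr2)
  also have "\<dots> = T2_map (base G) (tgt G) (T2_map (arr G) snd \<sigma>)"
    by (rule tangent_map_compose[OF diff_arr2 diff_arr diff_base smooth_snd smooth_tgt \<sigma>, symmetric])
  finally have "pair_metric \<sigma> = \<eta> (T2_map (base G) (tgt G) (T2_map (arr G) snd \<sigma>))"
    using pair_metric_fst[OF \<sigma>] by simp
  also have "\<dots> = \<eta> (T2_map (base G) (src G) (T2_map (arr G) snd \<sigma>))"
    using \<eta> s\<sigma> unfolding metric_0_def by blast
  also have "T2_map (base G) (src G) (T2_map (arr G) snd \<sigma>) = T2_map (base G) (src G \<circ> snd) \<sigma>"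
    by (rule tangent_map_compose[OF diff_arr2 diff_arr diff_base smooth_snd smooth_src \<sigma>])
  finally show ?thesis .
qed

lemma metric_2_pair_metric: "metric_2 G pair_metric"
proof -
  have r1: "riemannian_metric (arr G) (\<eta> \<circ> T2_map (base G) (src G))"
    using \<eta> by (intro riemannian_metric_pullback[OF diff_base diff_arr smooth_src immersive_src]) (simp add: metric_0_def)
  have r2: "riemannian_metric (arr2 G) pair_metric"
    unfolding pair_metric_def by (rule riemannian_metric_pullback[OF diff_arr diff_arr2 smooth_fst immersive_fst r1])
  \<comment> \<open>The metric may be read at the vertex \<open>src G g\<close> or
    \<open>src G h\<close>. A map of pairs whose first source is one of these two vertices therefore
    preserves it: \<open>flip\<close> keeps \<open>src G g\<close>, and \<open>turn\<close> replaces
    it by \<open>src G h\<close>.\<close>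
  have inv: "pair_metric (T2_map (arr2 G) f \<sigma>) = pair_metric \<sigma>"
    if f: "smooth_between (arr2 G) (arr2 G) f" and \<sigma>: "\<sigma> \<in> Pts (T2 (arr2 G))"
      and eq: "(\<forall>c \<in> Pts (arr2 G). src G (fst (f c)) = src G (fst c)) \<or> (\<forall>c \<in> Pts (arr2 G). src G (fst (f c)) = src G (snd c))" for f \<sigma>
  proof -
    have f\<sigma>: "T2_map (arr2 G) f \<sigma> \<in> Pts (T2 (arr2 G))" by (rule tangent_map_Pts[OF diff_arr2 diff_arr2 f \<sigma>])
    have sf: "smooth_between (arr2 G) (base G) (src G \<circ> fst)" "smooth_between (arr2 G) (base G) (src G \<circ> snd)"
      by (rule smooth_between_compose[OF smooth_fst smooth_src] smooth_between_compose[OF smooth_snd smooth_src])+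
    have "pair_metric (T2_map (arr2 G) f \<sigma>) = \<eta> (T2_map (base G) (src G \<circ> fst) (T2_map (arr2 G) f \<sigma>))"
      by (rule pair_metric_fst[OF f\<sigma>])
    also have "T2_map (base G) (src G \<circ> fst) (T2_map (arr2 G) f \<sigma>) = T2_map (base G) (src G \<circ> fst \<circ> f) \<sigma>"
      by (rule tangent_map_compose[OF diff_arr2 diff_arr2 diff_base f sf(1) \<sigma>])
    finally have e: "pair_metric (T2_map (arr2 G) f \<sigma>) = \<eta> (T2_map (base G) (src G \<circ> fst \<circ> f) \<sigma>)" .
    from eq show ?thesis
    proof
      assume "\<forall>c \<in> Pts (arr2 G). src G (fst (f c)) = src G (fst c)"
      then have "T2_map (base G) (src G \<circ> fst \<circ> f) \<sigma> = T2_map (base G) (src G \<circ> fst) \<sigma>"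
        by (intro tangent_map_cong[OF diff_arr2 diff_base smooth_between_compose[OF f sf(1)] sf(1) _ \<sigma>]) simp
      then show ?thesis using e pair_metric_fst[OF \<sigma>] by simp
    next
      assume "\<forall>c \<in> Pts (arr2 G). src G (fst (f c)) = src G (snd c)"
      then have "T2_map (base G) (src G \<circ> fst \<circ> f) \<sigma> = T2_map (base G) (src G \<circ> snd) \<sigma>"
        by (intro tangent_map_cong[OF diff_arr2 diff_base smooth_between_compose[OF f sf(1)] sf(2) _ \<sigma>]) simp
      then show ?thesis using e pair_metric_snd[OF \<sigma>] by simp
    qed
  qed
  have "src G (fst (flip c)) = src G (fst c)" "src G (fst (turn c)) = src G (snd c)" if "c \<in> Pts (arr2 G)" for c
    using that ginv gmult by (auto simp: flip_def turn_def Pts_arr2)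
  then have "\<forall>\<sigma> \<in> Pts (T2 (arr2 G)). pair_metric (T2_map (arr2 G) flip \<sigma>) = pair_metric \<sigma> \<and>
      pair_metric (T2_map (arr2 G) turn \<sigma>) = pair_metric \<sigma>"
    using inv[OF smooth_flip] inv[OF smooth_turn] by blast
  \<comment> \<open>By definition the value depends only on the image under \<open>fst\<close>, so
    pairs with equal images have equal values.\<close>
  moreover have "transverse_metric (arr2 G) (arr G) fst pair_metric"
    unfolding transverse_metric_def using r2 by (simp add: pair_metric_def)
  ultimately show ?thesis
    using r2 unfolding metric_2_def flip_def turn_def by blast
qed

lemma base_metric_pair_metric:
  assumes \<tau>: "\<tau> \<in> Pts (T2 (base G))"
  shows "base_metric pair_metric \<tau> = \<eta> \<tau>"
proof -
  define \<sigma> where "\<sigma> = T2_map (arr G) (idn G) \<tau>"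
  have \<sigma>: "\<sigma> \<in> Pts (T2 (arr G))" unfolding \<sigma>_def by (rule tangent_map_Pts[OF diff_base diff_arr smooth_idn \<tau>])
  have "base_metric pair_metric \<tau> = \<eta> (T2_map (base G) (src G) \<sigma>)"
    using fst_right_unit[OF \<sigma>] by (simp add: base_metric_def arrow_metric_def pair_metric_def \<sigma>_def)
  also have "T2_map (base G) (src G) \<sigma> = \<tau>" unfolding \<sigma>_def by (rule src_idn[OF \<tau>])
  finally show ?thesis .
qed

end

lemma stack_metric_of_orbit_pullback:
  assumes g: "definite_on_orbits G g"
  shows "stack_metric_of G (orbit_pullback G g) \<in> stack_metrics G"
    and "stack_metric_induces G (stack_metric_of G (orbit_pullback G g)) g"
proof -
  have m0: "metric_0 G (orbit_pullback G g)" by (rule metric_0_orbit_pullback[OF g])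
  define \<eta>2 where "\<eta>2 = pair_metric (orbit_pullback G g)"
  have m2: "metric_2 G \<eta>2" unfolding \<eta>2_def by (rule metric_2_pair_metric[OF m0])
  have s: "stack_metric_of G (orbit_pullback G g) = metric_2_equiv G `` {\<eta>2}"
    by (simp add: stack_metric_of_def \<eta>2_def pair_metric_def[OF m0])
  show "stack_metric_of G (orbit_pullback G g) \<in> stack_metrics G"
    unfolding s stack_metrics_def by (rule quotientI) (simp add: m2)
  show "stack_metric_induces G (stack_metric_of G (orbit_pullback G g)) g"
    unfolding s stack_metric_induces_def metric_0_induces_def
  proof (intro ballI)
    fix \<theta>2 \<tau> assume "\<theta>2 \<in> metric_2_equiv G `` {\<eta>2}" and \<tau>: "\<tau> \<in> Pts (T2 (base G))"
    then have "induced_metric_0 G \<theta>2 \<tau> = induced_metric_0 G \<eta>2 \<tau>" by (auto simp: metric_2_equiv_def)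
    also have "\<dots> = orbit_pullback G g \<tau>"
      using induced_metric_0_eq[OF m2 \<tau>] base_metric_pair_metric[OF m0 \<tau>] by (simp add: \<eta>2_def)
    finally show "orbit_pullback G g \<tau> = induced_metric_0 G \<theta>2 \<tau>" by simp
  qed
qed

end

section \<open>The metric on the orbit space\<close>

text \<open>The sets \<open>A i\<close> are the complements of the members of the cover.\<close>

lemma finite_closed_cover_interior:
  assumes "finite I"
  shows "openin X S \<Longrightarrow> S \<noteq> {} \<Longrightarrow> (\<And>i. i \<in> I \<Longrightarrow> openin X (A i)) \<Longrightarrow> (\<And>z. z \<in> S \<Longrightarrow> \<exists>i\<in>I. z \<notin> A i) \<Longrightarrow>
    \<exists>i\<in>I. \<exists>T. openin X T \<and> T \<noteq> {} \<and> T \<subseteq> S \<and> T \<inter> A i = {}"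
  using assms
proof (induction I arbitrary: S rule: finite_induct)
  case empty
  then show ?case by blast
next
  case (insert i I)
  show ?case
  \<comment> \<open>If \<open>S\<close> misses \<open>A i\<close>, then \<open>S\<close> lies in the
    closed set with index \<open>i\<close> and is itself the witness. Otherwise
    \<open>S \<inter> A i\<close> is a nonempty open set that the remaining closed sets
    cover.\<close>
  proof (cases "S \<inter> A i = {}")
    case True
    then show ?thesis using insert.prems by blast
  next
    case False
    have "\<exists>j\<in>I. \<exists>T. openin X T \<and> T \<noteq> {} \<and> T \<subseteq> S \<inter> A i \<and> T \<inter> A j = {}"
    proof (rule insert.IH)
      show "openin X (S \<inter> A i)" using insert.prems(1,3) by (simp add: openin_Int)
    qed (use False insert.prems in auto)
    then show ?thesis by blast
  qed
qed

context etale_groupoid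
begin

text \<open>Invariance of the 0-metric along a plot of arrows. It is applied to a local section of
  the source map composed with a lift.\<close>

lemma arrow_section_invariant:
  assumes \<eta>: "metric_0 G \<eta>" and a: "(k, W, a) \<in> Plots (arr G)" and z: "z \<in> W" "v \<in> Rn k" "w \<in> Rn k"
  shows "\<eta> (tangent_class 2 (base G) (k, W, restrict (tgt G \<circ> a) W) z [v, w]) =
    \<eta> (tangent_class 2 (base G) (k, W, restrict (src G \<circ> a) W) z [v, w])"
proof -
  have "tangent_class 2 (arr G) (k, W, a) z [v, w] \<in> Pts (T2 (arr G))" by (rule tangent_class_2_in_Pts[OF a z])
  then have "\<eta> (T2_map (base G) (tgt G) (tangent_class 2 (arr G) (k, W, a) z [v, w])) =
      \<eta> (T2_map (base G) (src G) (tangent_class 2 (arr G) (k, W, a) z [v, w]))"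
    using \<eta> unfolding metric_0_def by blast
  then show ?thesis
    unfolding T2_map_class[OF diff_arr diff_base smooth_tgt a z] T2_map_class[OF diff_arr diff_base smooth_src a z] .
qed

end

locale orbifold = etale_groupoid G n for G :: "('m, 'g) groupoid" and n :: nat +
  assumes proper: "proper_groupoid G"
begin

text \<open>Properness makes the arrows from \<open>q z\<close> to \<open>q' z\<close> for \<open>z\<close> near \<open>r\<close> lie on finitely many local
  sections \<open>\<sigma>\<close> of the source map. The closed sets on which \<open>q' = tgt \<circ> \<sigma> \<circ> q\<close> cover a neighbourhood of \<open>r\<close>,
  so the points near which one of these equations holds are dense.\<close>

lemma lifts_agree:
  assumes \<eta>: "metric_0 G \<eta>" and q: "(k, V, q) \<in> Plots (base G)" and q': "(k, V, q') \<in> Plots (base G)"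
    and orb: "\<And>z. z \<in> V \<Longrightarrow> (q z, q' z) \<in> orbit_rel G" and r: "r \<in> V" and v: "v \<in> Rn k" and w: "w \<in> Rn k"
  shows "\<eta> (tangent_class 2 (base G) (k, V, q) r [v, w]) = \<eta> (tangent_class 2 (base G) (k, V, q') r [v, w])"
proof (rule ccontr)
  define F where "F z = \<eta> (tangent_class 2 (base G) (k, V, q) z [v, w])" for z
  define F' where "F' z = \<eta> (tangent_class 2 (base G) (k, V, q') z [v, w])" for z
  assume "\<eta> (tangent_class 2 (base G) (k, V, q) r [v, w]) \<noteq> \<eta> (tangent_class 2 (base G) (k, V, q') r [v, w])"
  then have Fr: "F r \<noteq> F' r" by (simp add: F_def F'_def)
  have V: "openin (Euclidean_space k) V" by (rule plot_domain_open[OF diff_base q])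
  have sm: "smooth_between (T2 (base G)) real_diffeology \<eta>"
    using \<eta> by (simp add: metric_0_def riemannian_metric_def covariant_2tensor_def)
  have vw: "set [v, w] \<subseteq> Rn k" "length [v, w] = 2" using v w by auto
  have Fc: "continuous_map (subtopology (Euclidean_space k) V) euclideanreal F"
    unfolding F_def using smooth_real_tangent_const[OF diff_base sm q vw] unfolding smooth_fun_def
    by (blast intro: C_k_continuous)
  have Fc': "continuous_map (subtopology (Euclidean_space k) V) euclideanreal F'"
    unfolding F'_def using smooth_real_tangent_const[OF diff_base sm q' vw] unfolding smooth_fun_def
    by (blast intro: C_k_continuous)
  define sec where "sec g W S \<sigma> \<longleftrightarrow> openin (D_topology (arr G)) W \<and> g \<in> W \<and> openin (D_topology (base G)) S \<and>
    src G ` W \<subseteq> S \<and> smooth_between (sub_diffeology (base G) S) (arr G) \<sigma> \<and> (\<forall>g\<in>W. \<sigma> (src G g) = g) \<and>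
    (\<forall>x\<in>S. src G (\<sigma> x) = x \<and> \<sigma> x \<in> W)" for g W S \<sigma>
  have "\<forall>g\<in>Pts (arr G). \<exists>W S \<sigma>. sec g W S \<sigma>"
    unfolding sec_def using etale_local_section[OF manifolds submersions(1)] by blast
  then obtain Wf Sf \<sigma>f where sec: "\<And>g. g \<in> Pts (arr G) \<Longrightarrow> sec g (Wf g) (Sf g) (\<sigma>f g)" by metis
  \<comment> \<open>The arrows from \<open>q r\<close> to \<open>q' r\<close>: a fibre of the anchor
    over one point, compact by properness, hence covered by finitely many domains of local
    sections.\<close>
  define K where "K = {g \<in> Pts (arr G). tgt G g = q' r \<and> src G g = q r}"
  have topA: "topspace (D_topology (arr G)) = Pts (arr G)" by (rule topspace_D_topology[OF diff_arr])
  have topB: "topspace (D_topology (base G)) = Pts (base G)" by (rule topspace_D_topology[OF diff_base])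
  define anchor where "anchor g = (tgt G g, src G g)" for g
  have pm: "proper_map (D_topology (arr G)) (prod_topology (D_topology (base G)) (D_topology (base G))) anchor"
    using proper by (simp add: proper_groupoid_def anchor_def[abs_def])
  have qr: "q r \<in> Pts (base G)" "q' r \<in> Pts (base G)"
    using plot_in[OF diff_base q r] plot_in[OF diff_base q' r] by auto
  have "compactin (D_topology (arr G)) K"
  proof -
    have "compactin (D_topology (arr G)) {g \<in> Pts (arr G). anchor g = (q' r, q r)}"
      using pm qr unfolding proper_map_def topA by (simp add: topB)
    then show ?thesis by (simp add: K_def anchor_def)
  qed
  moreover have "\<forall>T\<in>Wf ` K. openin (D_topology (arr G)) T" "K \<subseteq> \<Union>(Wf ` K)"
    using sec by (auto simp: sec_def K_def)
  ultimately obtain \<F> where \<F>: "finite \<F>" "\<F> \<subseteq> Wf ` K" "K \<subseteq> \<Union>\<F>"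
    unfolding compactin_def by meson
  then obtain D where D: "finite D" "D \<subseteq> K" "K \<subseteq> (\<Union>d\<in>D. Wf d)"
    using finite_subset_image[OF \<F>(1,2)] by metis
  have DA: "d \<in> Pts (arr G)" if "d \<in> D" for d using that D(2) by (auto simp: K_def)
  \<comment> \<open>The arrows outside these finitely many domains. The anchor is a closed map and
    the point over \<open>r\<close> is not in the image of \<open>C\<close>, so for \<open>z\<close>
    near \<open>r\<close> every arrow from \<open>q z\<close> to \<open>q' z\<close> lies in one of
    the chosen domains.\<close>
  define C where "C = Pts (arr G) - (\<Union>d\<in>D. Wf d)"
  have "openin (D_topology (arr G)) (\<Union>d\<in>D. Wf d)"
    using sec DA by (auto simp: sec_def intro!: openin_Union)
  then have "closedin (D_topology (arr G)) C"
    unfolding C_def topA[symmetric] by (rule closedin_diff[OF closedin_topspace])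
  then have Cim: "closedin (prod_topology (D_topology (base G)) (D_topology (base G))) (anchor ` C)"
    using pm unfolding proper_map_def closed_map_def by blast
  define P where "P z = (q' z, q z)" for z
  have Pc: "continuous_map (subtopology (Euclidean_space k) V) (prod_topology (D_topology (base G)) (D_topology (base G))) P"
    unfolding P_def by (intro continuous_map_pairedI continuous_map_plot[OF diff_base] q q')
  define N1 where "N1 = {z\<in>V. P z \<in> topspace (prod_topology (D_topology (base G)) (D_topology (base G))) -
     anchor ` C}"
  have N1: "openin (Euclidean_space k) N1"
    unfolding N1_def by (rule openin_preimage_open[OF V Pc openin_diff[OF openin_topspace Cim]])
  define N2 where "N2 = (\<Inter>d\<in>D. {z\<in>V. q z \<in> Sf d}) \<inter> Rn k"
  have N2: "openin (Euclidean_space k) N2"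
    unfolding N2_def using sec DA D(1)
    by (intro openin_INT openin_plot_preimage[OF diff_base q]) (auto simp: sec_def)
  define N where "N = N1 \<inter> N2"
  have N: "openin (Euclidean_space k) N" unfolding N_def using N1 N2 by (rule openin_Int)
  have NV: "N \<subseteq> V" by (auto simp: N_def N1_def)
  have "r \<in> N1"
  proof -
    have "P r \<notin> anchor ` C"
    proof
      assume "P r \<in> anchor ` C"
      then obtain g where g: "g \<in> C" "P r = anchor g" by blast
      then have "g \<in> K" by (auto simp: K_def C_def P_def anchor_def)
      then show False using D(3) g(1) by (auto simp: C_def)
    qed
    then show ?thesis using r qr by (simp add: N1_def P_def topB)
  qed
  moreover have "r \<in> N2"
  proof -
    have "q r \<in> Sf d" if d: "d \<in> D" for d
    proof -
      have W: "d \<in> Wf d" "src G ` Wf d \<subseteq> Sf d" using sec[OF DA[OF d]] by (simp_all add: sec_def)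
      have "src G d \<in> Sf d" by (rule subsetD[OF W(2) imageI[OF W(1)]])
      moreover have "src G d = q r" using d D(2) by (auto simp: K_def)
      ultimately show ?thesis by simp
    qed
    then show ?thesis using r openin_subset[OF V] by (auto simp: N2_def)
  qed
  ultimately have rN: "r \<in> N" by (simp add: N_def)
  have qS: "q z \<in> Sf d" if "z \<in> N" "d \<in> D" for z d using that by (auto simp: N_def N2_def)
  define a where "a d = restrict (\<sigma>f d \<circ> q) N" for d
  have a: "(k, N, a d) \<in> Plots (arr G)" if d: "d \<in> D" for d
  proof -
    have "(k, N, restrict q N) \<in> Plots (sub_diffeology (base G) (Sf d))"
      using plot_restrict[OF diff_base q N NV] qS[OF _ d] by (auto simp: sub_diffeology_def)
    moreover have "smooth_between (sub_diffeology (base G) (Sf d)) (arr G) (\<sigma>f d)"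
      using sec[OF DA[OF d]] by (simp add: sec_def)
    ultimately have "(k, N, restrict (\<sigma>f d \<circ> restrict q N) N) \<in> Plots (arr G)" by (metis smooth_between_plot)
    then show ?thesis by (simp add: a_def)
  qed
  have src_a: "src G (a d z) = q z" if "d \<in> D" "z \<in> N" for d z
    using sec[OF DA[OF that(1)]] qS[OF that(2,1)] that(2) by (simp add: sec_def a_def)
  have cover: "\<exists>d\<in>D. tgt G (a d z) = q' z" if z: "z \<in> N" for z
  proof -
    obtain g where g: "g \<in> Pts (arr G)" "src G g = q z" "tgt G g = q' z"
      using orb[OF subsetD[OF NV z]] by (auto simp: orbit_rel_def)
    have notin: "P z \<notin> anchor ` C" using z by (simp add: N_def N1_def)
    have "P z = anchor g" by (simp add: P_def anchor_def g)
    then have "g \<notin> C" using notin by auto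
    then obtain d where d: "d \<in> D" "g \<in> Wf d" using g(1) by (auto simp: C_def)
    have "\<sigma>f d (src G g) = g" using sec[OF DA[OF d(1)]] d(2) by (simp add: sec_def)
    then have "tgt G (a d z) = q' z" using z g by (simp add: a_def)
    then show ?thesis using d(1) by blast
  qed
  \<comment> \<open>The set where the section \<open>d\<close> fails to carry \<open>q\<close> to
    \<open>q'\<close>. It is open because the base is Hausdorff, which makes the coincidence set
    closed.\<close>
  define A where "A d = {z\<in>N. restrict (tgt G \<circ> a d) N z \<noteq> q' z}" for d
  have A: "openin (Euclidean_space k) (A d)" if d: "d \<in> D" for d
  proof -
    have hb: "Hausdorff_space (D_topology (base G))"
      using lie by (simp add: lie_groupoid_def hausdorff_sc_manifold_def)
    have tN: "topspace (subtopology (Euclidean_space k) N) = N" by (rule topspace_subtopology_openin[OF N])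
    have c1: "continuous_map (subtopology (Euclidean_space k) N) (D_topology (base G)) (restrict (tgt G \<circ> a d) N)"
      by (rule continuous_map_plot[OF diff_base smooth_between_plot[OF smooth_tgt a[OF d]]])
    have c2: "continuous_map (subtopology (Euclidean_space k) N) (D_topology (base G)) q'"
      by (rule continuous_map_from_subtopology_mono[OF continuous_map_plot[OF diff_base q'] NV])
    have cl: "closedin (subtopology (Euclidean_space k) N) {z \<in> N. restrict (tgt G \<circ> a d) N z = q' z}"
      using closedin_continuous_maps_eq[OF hb c1 c2] unfolding tN .
    have "openin (subtopology (Euclidean_space k) N) (N - {z \<in> N. restrict (tgt G \<circ> a d) N z = q' z})"
      using openin_diff[OF openin_topspace cl] unfolding tN .
    moreover have "N - {z \<in> N. restrict (tgt G \<circ> a d) N z = q' z} = A d" by (auto simp: A_def)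
    ultimately show ?thesis using N by (simp add: openin_open_subtopology)
  qed
  \<comment> \<open>The open set where the two values differ, assumed to contain \<open>r\<close>.
    One section works on a nonempty open part of it, where invariance forces the values to be
    equal.\<close>
  define S where "S = {z\<in>N. F z - F' z \<in> - {0}}"
  have "openin (Euclidean_space k) S"
    unfolding S_def
    by (rule openin_preimage_open[OF N continuous_map_from_subtopology_mono[OF continuous_map_diff[OF Fc Fc'] NV]]) auto
  moreover have "S \<noteq> {}" using Fr rN by (auto simp: S_def)
  moreover have "\<exists>d\<in>D. z \<notin> A d" if "z \<in> S" for z using cover[of z] that by (auto simp: S_def A_def)
  ultimately obtain d T where d: "d \<in> D" and T: "openin (Euclidean_space k) T" "T \<noteq> {}" "T \<subseteq> S" "T \<inter> A d = {}"
    using finite_closed_cover_interior[OF D(1), of "Euclidean_space k" S A] A by blast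
  obtain z where z: "z \<in> T" using T(2) by blast
  have TN: "T \<subseteq> N" using T(3) by (auto simp: S_def)
  have zN: "z \<in> N" using z TN by blast
  have teq: "restrict (tgt G \<circ> a d) N y = q' y" if "y \<in> T" for y
    using that T(4) TN by (auto simp: A_def)
  have seq: "restrict (src G \<circ> a d) N y = q y" if "y \<in> N" for y
    using that src_a[OF d that] by simp
  have "tangent_class 2 (base G) (k, V, q') z [v, w] = tangent_class 2 (base G) (k, N, restrict (tgt G \<circ> a d) N) z [v, w]"
    by (rule tangent_class_local_eq[OF diff_base q' smooth_between_plot[OF smooth_tgt a[OF d]] T(1) _ TN _ z vw])
       (use TN NV teq in auto)
  moreover have "tangent_class 2 (base G) (k, V, q) z [v, w] = tangent_class 2 (base G) (k, N, restrict (src G \<circ> a d) N) z [v, w]"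
    by (rule tangent_class_local_eq[OF diff_base q smooth_between_plot[OF smooth_src a[OF d]] N NV subset_refl _ zN vw])
       (use seq in auto)
  ultimately have "F z = F' z"
    using arrow_section_invariant[OF \<eta> a[OF d] zN v w] by (simp add: F_def F'_def)
  then show False using z T(3) by (auto simp: S_def)
qed

section \<open>Descent of a 0-metric from local lifts to tangent classes of the orbit space\<close>

definition local_lift :: "'m set plot \<Rightarrow> rvec \<Rightarrow> rvec set \<Rightarrow> (rvec \<Rightarrow> 'm) \<Rightarrow> bool" where
  "local_lift = (\<lambda>(k, U, p) r V q. openin (Euclidean_space k) V \<and> r \<in> V \<and> V \<subseteq> U \<and> (k, V, q) \<in> Plots (base G) \<and>
     (\<forall>z\<in>V. p z = orbit_proj G (q z)))"

lemma local_lift_exists: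
  assumes "(k, U, p) \<in> Plots (orbit_space G)" "r \<in> U"
  obtains V q where "local_lift (k, U, p) r V q"
proof -
  have "\<forall>r\<in>U. \<exists>V q. openin (Euclidean_space k) V \<and> r \<in> V \<and> V \<subseteq> U \<and> (k, V, q) \<in> Plots (base G) \<and>
          (\<forall>z\<in>V. p z = orbit_rel G `` {q z})"
    using assms(1) by (simp add: orbit_space_def quotient_diffeology_def)
  from bspec[OF this assms(2)] show ?thesis
    by (elim exE) (rule that, simp add: local_lift_def orbit_proj_def)
qed

lemma local_lifts_agree:
  assumes \<eta>: "metric_0 G \<eta>" and 1: "local_lift (k, U, p) r V q" and 2: "local_lift (k, U, p) r V' q'"
    and v: "v \<in> Rn k" and w: "w \<in> Rn k"
  shows "\<eta> (tangent_class 2 (base G) (k, V, q) r [v, w]) = \<eta> (tangent_class 2 (base G) (k, V', q') r [v, w])"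
proof -
  have V: "openin (Euclidean_space k) V" "r \<in> V" "(k, V, q) \<in> Plots (base G)" "\<And>z. z \<in> V \<Longrightarrow> p z = orbit_proj G (q z)"
    using 1 by (simp_all add: local_lift_def)
  have V': "openin (Euclidean_space k) V'" "r \<in> V'" "(k, V', q') \<in> Plots (base G)" "\<And>z. z \<in> V' \<Longrightarrow> p z = orbit_proj G (q' z)"
    using 2 by (simp_all add: local_lift_def)
  define W where "W = V \<inter> V'"
  have W: "openin (Euclidean_space k) W" "r \<in> W" "W \<subseteq> V" "W \<subseteq> V'" using V V' by (auto simp: W_def)
  have vw: "set [v, w] \<subseteq> Rn k" "length [v, w] = 2" using v w by auto
  have orb: "(restrict q W z, restrict q' W z) \<in> orbit_rel G" if z: "z \<in> W" for z
  proof -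
    have "orbit_rel G `` {q z} = orbit_rel G `` {q' z}"
      using V(4)[of z] V'(4)[of z] z W(3,4) by (auto simp: orbit_proj_def)
    then have "(q z, q' z) \<in> orbit_rel G"
      using eq_equiv_class[OF _ equiv_orbit_rel[OF laws]] plot_in[OF diff_base V'(3), of z] z W(4) by blast
    then show ?thesis using z by simp
  qed
  have "\<eta> (tangent_class 2 (base G) (k, W, restrict q W) r [v, w]) = \<eta> (tangent_class 2 (base G) (k, W, restrict q' W) r [v, w])"
    by (rule lifts_agree[OF \<eta> plot_restrict[OF diff_base V(3) W(1,3)] plot_restrict[OF diff_base V'(3) W(1,4)] orb W(2) v w])
  then show ?thesis
    using tangent_class_restrict[OF diff_base V(3) W(1,3,2) vw] tangent_class_restrict[OF diff_base V'(3) W(1,4,2) vw] by simp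
qed

definition lift_value :: "('m tvec set \<Rightarrow> real) \<Rightarrow> 'm set tvec \<Rightarrow> real" where
  "lift_value \<eta> = (\<lambda>((k, U, p), r, vs). THE c. \<exists>V q. local_lift (k, U, p) r V q \<and>
     c = \<eta> (tangent_class 2 (base G) (k, V, q) r vs))"

text \<open>The value is read off an arbitrary representative and, through
  \<open>lift_value\<close>, an arbitrary lift of its plot; \<open>orbit_metric_class\<close> shows
  both choices immaterial.\<close>

definition orbit_metric :: "('m tvec set \<Rightarrow> real) \<Rightarrow> 'm set tvec set \<Rightarrow> real" where
  "orbit_metric \<eta> c = lift_value \<eta> (SOME x. x \<in> c)"

lemma lift_value_eq:
  assumes "metric_0 G \<eta>" "local_lift (k, U, p) r V q" "v \<in> Rn k" "w \<in> Rn k"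
  shows "lift_value \<eta> ((k, U, p), r, [v, w]) = \<eta> (tangent_class 2 (base G) (k, V, q) r [v, w])"
  unfolding lift_value_def prod.case
  by (rule the_equality) (use assms local_lifts_agree[OF assms(1) _ assms(2-4)] in blast)+

text \<open>Given a step through \<open>f\<close> from \<open>p\<close> to \<open>q\<close>, a lift
  of \<open>q\<close> near \<open>f r\<close> composes with \<open>f\<close> to a lift of
  \<open>p\<close> near \<open>r\<close>. The two lifts are related by the corresponding step in the
  base, so the values agree.\<close>

lemma orbit_metric_class:
  assumes \<eta>: "metric_0 G \<eta>" and p: "(k, U, p) \<in> Plots (orbit_space G)" and l: "local_lift (k, U, p) r V q"
    and v: "v \<in> Rn k" and w: "w \<in> Rn k"
  shows "orbit_metric \<eta> (tangent_class 2 (orbit_space G) (k, U, p) r [v, w]) =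
    \<eta> (tangent_class 2 (base G) (k, V, q) r [v, w])"
proof -
  have inv: "lift_value \<eta> a = lift_value \<eta> b"
    if ab: "a \<in> pre_tangent_set 2 (orbit_space G)" "b \<in> pre_tangent_set 2 (orbit_space G)" "tangent_step (orbit_space G) a b" for a b
  proof -
    obtain k U p m V q f r vs where *: "(k, U, p) \<in> Plots (orbit_space G)" "(m, V, q) \<in> Plots (orbit_space G)"
      "smooth_map k U m V f" "\<forall>x\<in>U. q (f x) = p x"
      "r \<in> U" "set vs \<subseteq> Rn k" "a = ((k, U, p), r, vs)" "b = ((m, V, q), f r, map (jacobian k f r) vs)"
      using ab(3) unfolding tangent_step_def by blast
    have U: "openin (Euclidean_space k) U" by (rule plot_domain_open[OF diff_orbit *(1)])
    have len: "length vs = 2" using ab(1) *(7) by (simp add: mem_pre_tangent_set)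
    then obtain v w where vs: "vs = [v, w]"
      by (metis (no_types, opaque_lifting) One_nat_def Suc_1 length_0_conv length_Suc_conv)
    have vw: "v \<in> Rn k" "w \<in> Rn k" using *(6) vs by auto
    have jac: "jacobian k f r x \<in> Rn m" for x by (rule jacobian_in_Rn[OF U *(3,5)])
    obtain V0 q0 where l0: "local_lift (m, V, q) (f r) V0 q0"
      by (rule local_lift_exists[OF *(2) smooth_map_image[OF *(3,5)]])
    then have V0: "openin (Euclidean_space m) V0" "f r \<in> V0" "V0 \<subseteq> V" "(m, V0, q0) \<in> Plots (base G)"
      "\<And>z. z \<in> V0 \<Longrightarrow> q z = orbit_proj G (q0 z)" by (simp_all add: local_lift_def)
    define U0 where "U0 = {x\<in>U. f x \<in> V0}"
    have U0: "openin (Euclidean_space k) U0"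
      unfolding U0_def by (rule openin_preimage_open[OF U smooth_map_continuous[OF *(3)] V0(1)])
    have f0: "smooth_map k U0 m V0 f" by (rule smooth_map_subset[OF *(3)]) (use V0(3) in \<open>auto simp: U0_def\<close>)
    have rU0: "r \<in> U0" using *(5) V0(2) by (simp add: U0_def)
    have "local_lift (k, U, p) r U0 (restrict (q0 \<circ> f) U0)"
      unfolding local_lift_def prod.case
      using U0 rU0 plot_compose[OF diff_base V0(4) U0 f0] *(4) V0(5) by (auto simp: U0_def)
    then have "lift_value \<eta> a = \<eta> (tangent_class 2 (base G) (k, U0, restrict (q0 \<circ> f) U0) r vs)"
      unfolding *(7) vs by (rule lift_value_eq[OF \<eta> _ vw])
    also have "\<dots> = \<eta> (tangent_class 2 (base G) (m, V0, q0) (f r) (map (jacobian k f r) vs))"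
      using tangent_class_compose[OF diff_base V0(4) U0 f0 rU0 *(6) len] by simp
    also have "\<dots> = lift_value \<eta> b"
      unfolding *(8) vs list.map by (rule lift_value_eq[OF \<eta> l0 jac jac, symmetric])
    finally show ?thesis .
  qed
  have r: "r \<in> U" using l by (auto simp: local_lift_def)
  have pre: "((k, U, p), r, [v, w]) \<in> pre_tangent_set 2 (orbit_space G)"
    using p r v w by (simp add: mem_pre_tangent_set)
  define x where "x = (SOME x. x \<in> tangent_class 2 (orbit_space G) (k, U, p) r [v, w])"
  have "x \<in> tangent_class 2 (orbit_space G) (k, U, p) r [v, w]"
    unfolding x_def using tangent_class_self[OF pre] by (rule someI)
  then have "(((k, U, p), r, [v, w]), x) \<in> tangent_rel 2 (orbit_space G)" using mem_tangent_class[OF pre] by blast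
  then have "lift_value \<eta> ((k, U, p), r, [v, w]) = lift_value \<eta> x"
    by (rule tangent_rel_invariant[OF diff_orbit]) (rule inv)
  then show ?thesis using lift_value_eq[OF \<eta> l v w] by (simp add: orbit_metric_def x_def)
qed

text \<open>A plot of the base is a lift of its own projection, so the value can be computed on the
  original plot.\<close>

lemma orbit_pullback_orbit_metric:
  assumes \<eta>: "metric_0 G \<eta>" and \<tau>: "\<tau> \<in> Pts (T2 (base G))"
  shows "orbit_pullback G (orbit_metric \<eta>) \<tau> = \<eta> \<tau>"
proof -
  obtain k U q r v w where *: "(k, U, q) \<in> Plots (base G)" "r \<in> U" "v \<in> Rn k" "w \<in> Rn k"
    and \<tau>_eq: "\<tau> = tangent_class 2 (base G) (k, U, q) r [v, w]"
    by (rule Pts_T2[OF \<tau>])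
  have "local_lift (k, U, restrict (orbit_proj G \<circ> q) U) r U q"
    using * plot_domain_open[OF diff_base *(1)] by (simp add: local_lift_def)
  then show ?thesis
    unfolding orbit_pullback_def \<tau>_eq
    using T2_map_class[OF diff_base diff_orbit smooth_orbit_proj *]
      orbit_metric_class[OF \<eta> smooth_between_plot[OF smooth_orbit_proj *(1)] _ *(3,4)] by simp
qed

text \<open>Near a point, a plot of the tangent space moves inside one plot \<open>p\<close> of the
  orbit space, and one lift of \<open>p\<close> serves all nearby base points. The composite is thus
  locally the smooth \<open>\<eta>\<close> along a plot of the tangent space of the base.\<close>

lemma smooth_orbit_metric:
  assumes \<eta>: "metric_0 G \<eta>"
  shows "smooth_between (T2 (orbit_space G)) real_diffeology (orbit_metric \<eta>)"
  unfolding smooth_between_real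
proof (clarify)
  fix l W \<sigma> assume \<sigma>: "(l, W, \<sigma>) \<in> Plots (T2 (orbit_space G))"
  have W: "openin (Euclidean_space l) W" by (rule tangent_plotD(1)[OF \<sigma>])
  have sm: "smooth_between (T2 (base G)) real_diffeology \<eta>"
    using \<eta> by (simp add: metric_0_def riemannian_metric_def covariant_2tensor_def)
  have "smooth_fun l W (orbit_metric \<eta> \<circ> \<sigma>)"
  proof (rule smooth_fun_local[OF W])
    fix z assume z: "z \<in> W"
    obtain W' k U p \<rho> \<nu> where W': "openin (Euclidean_space l) W'" "z \<in> W'" "W' \<subseteq> W"
       and p: "(k, U, p) \<in> Plots (orbit_space G)" and \<rho>: "smooth_map l W' k U \<rho>" and len: "length \<nu> = 2"
       and \<nu>: "\<forall>v \<in> set \<nu>. smooth_map l W' k (Rn k) v"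
       and \<sigma>_eq: "\<forall>y\<in>W'. \<sigma> y = tangent_class 2 (orbit_space G) (k, U, p) (\<rho> y) (map (\<lambda>v. v y) \<nu>)"
      using tangent_plotD(3)[OF \<sigma> z] by (elim exE conjE)
    obtain v w where vw: "\<nu> = [v, w]"
      using len by (metis (no_types, opaque_lifting) One_nat_def Suc_1 length_0_conv length_Suc_conv)
    have v: "smooth_map l W' k (Rn k) v" and w: "smooth_map l W' k (Rn k) w" using \<nu> vw by auto
    obtain V q where lV: "local_lift (k, U, p) (\<rho> z) V q"
      by (rule local_lift_exists[OF p smooth_map_image[OF \<rho> W'(2)]])
    then have V: "openin (Euclidean_space k) V" "\<rho> z \<in> V" "V \<subseteq> U" "(k, V, q) \<in> Plots (base G)" by (simp_all add: local_lift_def)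
    have lift: "local_lift (k, U, p) y V q" if "y \<in> V" for y using lV that by (simp add: local_lift_def)
    define Y where "Y = {y\<in>W'. \<rho> y \<in> V}"
    have Y: "openin (Euclidean_space l) Y"
      unfolding Y_def by (rule openin_preimage_open[OF W'(1) smooth_map_continuous[OF \<rho>] V(1)])
    have YW': "Y \<subseteq> W'" by (auto simp: Y_def)
    define \<theta> where "\<theta> = (\<lambda>y\<in>Y. tangent_class 2 (base G) (k, V, q) (\<rho> y) (map (\<lambda>v. v y) \<nu>))"
    have \<rho>Y: "smooth_map l Y k V \<rho>" by (rule smooth_map_subset[OF \<rho> YW' _ V(3)]) (auto simp: Y_def)
    have \<nu>Y: "\<forall>v\<in>set \<nu>. smooth_map l Y k (Rn k) v"
    proof
      fix u assume "u \<in> set \<nu>"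
      then have "smooth_map l W' k (Rn k) u" using \<nu> by blast
      then show "smooth_map l Y k (Rn k) u"
        by (rule smooth_map_subset[OF _ YW' _ subset_refl]) (use \<open>smooth_map l W' k (Rn k) u\<close> YW' smooth_map_image in blast)
    qed
    have "(l, Y, \<theta>) \<in> Plots (T2 (base G))"
    proof (rule tangent_plotI[OF Y])
      show "\<theta> \<in> extensional Y" by (simp add: \<theta>_def)
      show "\<exists>W' n U p \<rho> \<nu>. openin (Euclidean_space l) W' \<and> y \<in> W' \<and> W' \<subseteq> Y \<and> (n, U, p) \<in> Plots (base G) \<and>
         smooth_map l W' n U \<rho> \<and> length \<nu> = 2 \<and> (\<forall>v\<in>set \<nu>. smooth_map l W' n (Rn n) v) \<and>
         (\<forall>y\<in>W'. \<theta> y = tangent_class 2 (base G) (n, U, p) (\<rho> y) (map (\<lambda>v. v y) \<nu>))" if "y \<in> Y" for y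
        using that Y V(4) \<rho>Y len \<nu>Y
        by (intro exI[of _ Y] exI[of _ k] exI[of _ V] exI[of _ q] exI[of _ \<rho>] exI[of _ \<nu>]) (simp add: \<theta>_def)
    qed
    then have "smooth_fun l Y (\<eta> \<circ> \<theta>)" using sm unfolding smooth_between_real by fast
    moreover have "smooth_fun l Y (\<eta> \<circ> \<theta>) \<longleftrightarrow> smooth_fun l Y (orbit_metric \<eta> \<circ> \<sigma>)"
    proof (rule smooth_fun_cong[OF Y])
      fix y assume y: "y \<in> Y"
      then have y': "y \<in> W'" "\<rho> y \<in> V" by (auto simp: Y_def)
      show "(\<eta> \<circ> \<theta>) y = (orbit_metric \<eta> \<circ> \<sigma>) y"
        using orbit_metric_class[OF \<eta> p lift[OF y'(2)] smooth_map_image[OF v y'(1)] smooth_map_image[OF w y'(1)]]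
          \<sigma>_eq y y' by (simp add: \<theta>_def vw)
    qed
    ultimately show "\<exists>V. openin (Euclidean_space l) V \<and> z \<in> V \<and> V \<subseteq> W \<and> smooth_fun l V (orbit_metric \<eta> \<circ> \<sigma>)"
      using Y W'(2,3) V(2) YW' by (intro exI[of _ Y]) (auto simp: Y_def)
  qed
  then show "openin (Euclidean_space l) W \<and> smooth_fun l W (orbit_metric \<eta> \<circ> \<sigma>)" using W by blast
qed

lemma weak_riemannian_orbit_metric:
  assumes \<eta>: "metric_0 G \<eta>"
  shows "weak_riemannian_metric (orbit_space G) (orbit_metric \<eta>)"
  unfolding weak_riemannian_metric_def
proof (intro conjI ballI smooth_orbit_metric[OF \<eta>])
  fix P assume P: "P \<in> Plots (orbit_space G)"
  obtain n U p where [simp]: "P = (n, U, p)" by (cases P)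
  have p: "(n, U, p) \<in> Plots (orbit_space G)" using P by simp
  define X where "X = open_diffeology n U"
  define h where "h = orbit_metric \<eta> \<circ> T2_map (orbit_space G) p"
  have X: "diffeological_space X" unfolding X_def by (rule diffeological_space_open[OF plot_domain_open[OF diff_orbit p]])
  have ps: "smooth_between X (orbit_space G) p" unfolding X_def by (rule smooth_between_plot_map[OF diff_orbit p])
  have riem: "riemannian_metric (base G) \<eta>" using \<eta> by (simp add: metric_0_def)
  have c: "covariant_2tensor (base G) \<eta>" and s: "symmetric_tensor (base G) \<eta>"
    using riem by (simp_all add: riemannian_metric_def)
  \<comment> \<open>One lift is fixed for all vectors at the point, so bilinearity, symmetry and
    positivity transfer directly from the base.\<close>
  have lift: "\<exists>V q. (k, V, q) \<in> Plots (base G) \<and> r \<in> V \<and>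
      (\<forall>v\<in>Rn k. \<forall>w\<in>Rn k. h (tangent_class 2 X (k, W, f) r [v, w]) = \<eta> (tangent_class 2 (base G) (k, V, q) r [v, w]))"
    if f: "(k, W, f) \<in> Plots X" and r: "r \<in> W" for k W f r
  proof -
    have pf: "(k, W, restrict (p \<circ> f) W) \<in> Plots (orbit_space G)" by (rule smooth_between_plot[OF ps f])
    obtain V q where l: "local_lift (k, W, restrict (p \<circ> f) W) r V q" by (rule local_lift_exists[OF pf r])
    have "h (tangent_class 2 X (k, W, f) r [v, w]) = \<eta> (tangent_class 2 (base G) (k, V, q) r [v, w])"
      if "v \<in> Rn k" "w \<in> Rn k" for v w
      using T2_map_class[OF X diff_orbit ps f r that] orbit_metric_class[OF \<eta> pf l that] by (simp add: h_def)
    moreover have "(k, V, q) \<in> Plots (base G)" "r \<in> V" using l by (simp_all add: local_lift_def)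
    ultimately show ?thesis by blast
  qed
  have "covariant_2tensor X h"
    unfolding covariant_2tensor_def
  proof (intro conjI)
    show "smooth_between (T2 X) real_diffeology h"
      unfolding h_def by (rule smooth_between_compose[OF tangent_map_smooth[OF X diff_orbit ps] smooth_orbit_metric[OF \<eta>]])
    show "\<forall>(n, U, p)\<in>Plots X. \<forall>r\<in>U. \<forall>u\<in>Rn n. \<forall>v\<in>Rn n. \<forall>w\<in>Rn n. \<forall>a b.
        h (tangent_class 2 X (n, U, p) r [\<lambda>i. a * u i + b * v i, w]) =
          a * h (tangent_class 2 X (n, U, p) r [u, w]) + b * h (tangent_class 2 X (n, U, p) r [v, w]) \<and>
        h (tangent_class 2 X (n, U, p) r [w, \<lambda>i. a * u i + b * v i]) =
          a * h (tangent_class 2 X (n, U, p) r [w, u]) + b * h (tangent_class 2 X (n, U, p) r [w, v])"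
    proof (clarify)
      fix k W f r u v w a b
      assume *: "(k, W, f) \<in> Plots X" "r \<in> W" "u \<in> Rn k" "v \<in> Rn k" "w \<in> Rn k"
      obtain V q where q: "(k, V, q) \<in> Plots (base G)" "r \<in> V"
        and e: "\<forall>v\<in>Rn k. \<forall>w\<in>Rn k. h (tangent_class 2 X (k, W, f) r [v, w]) = \<eta> (tangent_class 2 (base G) (k, V, q) r [v, w])"
        using lift[OF *(1,2)] by blast
      show "h (tangent_class 2 X (k, W, f) r [\<lambda>i. a * u i + b * v i, w]) =
          a * h (tangent_class 2 X (k, W, f) r [u, w]) + b * h (tangent_class 2 X (k, W, f) r [v, w]) \<and>
        h (tangent_class 2 X (k, W, f) r [w, \<lambda>i. a * u i + b * v i]) =
          a * h (tangent_class 2 X (k, W, f) r [w, u]) + b * h (tangent_class 2 X (k, W, f) r [w, v])"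
        using e * combination_in_Rn[OF *(3,4)] covariant_2tensorD[OF c q *(3-5)] by simp
    qed
  qed
  moreover have "symmetric_tensor X h"
    unfolding symmetric_tensor_def
  proof (clarify)
    fix k W f r v w assume *: "(k, W, f) \<in> Plots X" "r \<in> W" "v \<in> Rn k" "w \<in> Rn k"
    obtain V q where q: "(k, V, q) \<in> Plots (base G)" "r \<in> V"
      and e: "\<forall>v\<in>Rn k. \<forall>w\<in>Rn k. h (tangent_class 2 X (k, W, f) r [v, w]) = \<eta> (tangent_class 2 (base G) (k, V, q) r [v, w])"
      using lift[OF *(1,2)] by blast
    have "\<eta> (tangent_class 2 (base G) (k, V, q) r [v, w]) = \<eta> (tangent_class 2 (base G) (k, V, q) r [w, v])"
      using s q *(3,4) unfolding symmetric_tensor_def by fast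
    then show "h (tangent_class 2 X (k, W, f) r [v, w]) = h (tangent_class 2 X (k, W, f) r [w, v])"
      using e * by simp
  qed
  moreover have "positive_tensor X h"
    unfolding positive_tensor_def
  proof (clarify)
    fix k W f r v assume *: "(k, W, f) \<in> Plots X" "r \<in> W" "v \<in> Rn k"
    obtain V q where q: "(k, V, q) \<in> Plots (base G)" "r \<in> V"
      and e: "\<forall>v\<in>Rn k. \<forall>w\<in>Rn k. h (tangent_class 2 X (k, W, f) r [v, w]) = \<eta> (tangent_class 2 (base G) (k, V, q) r [v, w])"
      using lift[OF *(1,2)] by blast
    show "0 \<le> h (tangent_class 2 X (k, W, f) r [v, v])"
      using e *(3) riemannian_metric_nonneg[OF diff_base riem q *(3)] by simp
  qed
  ultimately show "case P of (n, U, p) \<Rightarrow>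
        covariant_2tensor (open_diffeology n U) (orbit_metric \<eta> \<circ> T2_map (orbit_space G) p) \<and>
        symmetric_tensor (open_diffeology n U) (orbit_metric \<eta> \<circ> T2_map (orbit_space G) p) \<and>
        positive_tensor (open_diffeology n U) (orbit_metric \<eta> \<circ> T2_map (orbit_space G) p)"
    by (simp add: X_def h_def)
qed

lemma definite_orbit_metric:
  assumes \<eta>: "metric_0 G \<eta>"
  shows "definite_on_orbits G (orbit_metric \<eta>)"
  unfolding definite_on_orbits_def
  by (rule riemannian_metric_cong[OF diff_base, of \<eta>])
     (use \<eta> orbit_pullback_orbit_metric[OF \<eta>] in \<open>simp_all add: metric_0_def\<close>)

text \<open>The orbit metric is built from one representative; equivalent 2-metrics have the same
  induced 0-metric on tangent vectors, so it is induced by all of them.\<close>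

lemma stack_metric_descends:
  assumes "\<mu> \<in> stack_metrics G"
  shows "\<exists>g. weak_riemannian_metric (orbit_space G) g \<and> definite_on_orbits G g \<and> stack_metric_induces G \<mu> g"
proof -
  obtain \<eta>2 where m2: "metric_2 G \<eta>2" and \<mu>: "\<mu> = metric_2_equiv G `` {\<eta>2}"
    using assms by (auto simp: stack_metrics_def elim!: quotientE)
  define \<eta> where "\<eta> = base_metric \<eta>2"
  have \<eta>: "metric_0 G \<eta>" unfolding \<eta>_def by (rule metric_0_base_metric[OF m2])
  have "stack_metric_induces G \<mu> (orbit_metric \<eta>)"
    unfolding \<mu> stack_metric_induces_def metric_0_induces_def
  proof (intro ballI)
    fix \<theta>2 \<tau> assume "\<theta>2 \<in> metric_2_equiv G `` {\<eta>2}" and \<tau>: "\<tau> \<in> Pts (T2 (base G))"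
    then have "induced_metric_0 G \<theta>2 \<tau> = induced_metric_0 G \<eta>2 \<tau>" by (auto simp: metric_2_equiv_def)
    also have "\<dots> = \<eta> \<tau>" using induced_metric_0_eq[OF m2 \<tau>] by (simp add: \<eta>_def)
    finally show "orbit_pullback G (orbit_metric \<eta>) \<tau> = induced_metric_0 G \<theta>2 \<tau>"
      using orbit_pullback_orbit_metric[OF \<eta> \<tau>] by simp
  qed
  then show ?thesis using weak_riemannian_orbit_metric[OF \<eta>] definite_orbit_metric[OF \<eta>] by blast
qed

end

theorem theorem4p24:
  fixes G :: "('m, 'g) groupoid"
  assumes "orbifold_groupoid G"
  shows "(\<forall>\<mu> \<in> stack_metrics G. \<exists>g. weak_riemannian_metric (orbit_space G) g \<and>
            definite_on_orbits G g \<and> stack_metric_induces G \<mu> g) \<and>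
         (\<forall>g. weak_riemannian_metric (orbit_space G) g \<and> definite_on_orbits G g \<longrightarrow>
            metric_0 G (orbit_pullback G g) \<and>
            stack_metric_of G (orbit_pullback G g) \<in> stack_metrics G \<and>
            stack_metric_induces G (stack_metric_of G (orbit_pullback G g)) g)"
proof -
  obtain n where "lie_groupoid n n G" "proper_groupoid G"
    using assms by (auto simp: orbifold_groupoid_def)
  then interpret orbifold G n by unfold_locales
  show ?thesis
    using stack_metric_descends metric_0_orbit_pullback stack_metric_of_orbit_pullback by blast
qed

end
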